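(* Let $d\ge 2$. Then $$\inf\{F_{1/2}(\Omega)\ :\ \Omega\in\mathcal{A}_{convex}\}=3^{-1/2},$$ and the infimum is asymptotically reached by thin slabs: for every nonempty bounded open convex set $A\subset\mathbb{R}^{d-1}$, setting $\Omega_\varepsilon=A\times\left(-\varepsilon/2,\varepsilon/2\right)$ for $\varepsilon>0$, one has $$\lim_{\varepsilon\to0^+}F_{1/2}(\Omega_\varepsilon)=3^{-1/2}.$$
   Context: $\mathcal{A}_{convex}$ is the class of all nonempty open convex sets $\Omega\subset\mathbb{R}^d$ with finite Lebesgue measure $|\Omega|$. For such $\Omega$: - $P(\Omega)=\sup\{\int_\Omega \mathrm{div}\,\phi\,dx : \phi\in C^1_c(\mathbb{R}^d;\mathbb{R}^d),\ \|\phi\|_{L^\infty(\mathbb{R}^d)}\le 1\}$ is the (De Giorgi) perimeter. - $T(\Omega)=\int_\Omega u\,dx$ is the torsional rigidity, where $u\in H^1_0(\Omega)$ is the unique (weak) solution of $-\Delta u=1$ in $\Omega$. Equivalently, $T(\Omega)=\max\{(\int_\Omega u\,dx)^2(\int_\Omega|\nabla u|^2dx)^{-1} : u\in H^1_0(\Omega)\setminus\{0\}\}$. - $F_{1/2}(\Omega)=\dfrac{P(\Omega)\,T(\Omega)^{1/2}}{|\Omega|^{3/2}}$. *)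

theory Defs
  imports "HOL-Analysis.Analysis"
begin

definition C1c :: "'a::euclidean_space set \<Rightarrow> ('a \<Rightarrow> 'b::real_normed_vector) set" where
  "C1c \<Omega> = {\<phi>. (\<exists>\<phi>' :: 'a \<Rightarrow> 'a \<Rightarrow>\<^sub>L 'b.
                  (\<forall>x. (\<phi> has_derivative blinfun_apply (\<phi>' x)) (at x)) \<and> continuous_on UNIV \<phi>') \<and>
              compact (closure {x. \<phi> x \<noteq> 0}) \<and> closure {x. \<phi> x \<noteq> 0} \<subseteq> \<Omega>}"

definition divergence :: "('a::euclidean_space \<Rightarrow> 'a) \<Rightarrow> 'a \<Rightarrow> real" where
  "divergence \<phi> x = (\<Sum>b\<in>Basis. frechet_derivative \<phi> (at x) b \<bullet> b)"

definition grad :: "('a::euclidean_space \<Rightarrow> real) \<Rightarrow> 'a \<Rightarrow> 'a" where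
  "grad \<phi> x = (\<Sum>b\<in>Basis. frechet_derivative \<phi> (at x) b *\<^sub>R b)"

definition perimeter :: "'a::euclidean_space set \<Rightarrow> ereal" where
  "perimeter \<Omega> = (SUP \<phi> \<in> {\<phi> \<in> C1c UNIV. \<forall>x. norm (\<phi> x) \<le> 1}.
                     ereal (LINT x:\<Omega>|lborel. divergence \<phi> x))"

text \<open>Elements of Lebesgue and Sobolev spaces are represented by functions on the whole space of
  which only the values on \<open>\<Omega>\<close> matter, and that only up to null sets. Every class has a Borel
  representative, so Borel measurability is no restriction.\<close>

definition square_integrable_on ::
  "('a::euclidean_space \<Rightarrow> 'b::euclidean_space) \<Rightarrow> 'a set \<Rightarrow> bool" where
  "square_integrable_on f \<Omega> \<longleftrightarrow>
     set_borel_measurable lborel \<Omega> f \<and> set_integrable lborel \<Omega> (\<lambda>x. (norm (f x))\<^sup>2)"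

text \<open>\<open>u\<close> belongs to the Sobolev space \<open>H\<^sup>1(\<Omega>)\<close> and has weak gradient \<open>g\<close>; as usual, \<open>C\<^sup>1\<close> test
  functions with compact support may be used in place of smooth ones.\<close>

definition H1_gradient :: "'a::euclidean_space set \<Rightarrow> ('a \<Rightarrow> real) \<Rightarrow> ('a \<Rightarrow> 'a) \<Rightarrow> bool" where
  "H1_gradient \<Omega> u g \<longleftrightarrow> square_integrable_on u \<Omega> \<and> square_integrable_on g \<Omega> \<and>
     (\<forall>\<phi>\<in>C1c \<Omega>. (LINT x:\<Omega>|lborel. u x *\<^sub>R grad \<phi> x) = - (LINT x:\<Omega>|lborel. \<phi> x *\<^sub>R g x))"

text \<open>\<open>H\<^sup>1\<^sub>0(\<Omega>)\<close> is the closure of \<open>C\<^sup>1\<^sub>c(\<Omega>)\<close> in the norm of \<open>H\<^sup>1(\<Omega>)\<close>, which coincides with the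
  closure of the smooth functions with compact support in \<open>\<Omega>\<close>.\<close>

definition H10 :: "'a::euclidean_space set \<Rightarrow> ('a \<Rightarrow> real) set" where
  "H10 \<Omega> = {u. \<exists>g. H1_gradient \<Omega> u g \<and>
     (\<exists>\<phi> :: nat \<Rightarrow> 'a \<Rightarrow> real. (\<forall>n. \<phi> n \<in> C1c \<Omega>) \<and>
        (\<lambda>n. LINT x:\<Omega>|lborel. (u x - \<phi> n x)\<^sup>2 + (norm (g x - grad (\<phi> n) x))\<^sup>2) \<longlonglongrightarrow> 0)}"

definition weak_torsion_solution :: "'a::euclidean_space set \<Rightarrow> ('a \<Rightarrow> real) \<Rightarrow> bool" where
  "weak_torsion_solution \<Omega> u \<longleftrightarrow> u \<in> H10 \<Omega> \<and>
     (\<exists>g. H1_gradient \<Omega> u g \<and>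
        (\<forall>v\<in>H10 \<Omega>. \<forall>h. H1_gradient \<Omega> v h \<longrightarrow>
           (LINT x:\<Omega>|lborel. g x \<bullet> h x) = (LINT x:\<Omega>|lborel. v x)))"

text \<open>The solution is unique only up to null sets, hence \<open>SOME\<close> rather than \<open>THE\<close>; the integral
  does not depend on the choice.\<close>

definition torsional_rigidity :: "'a::euclidean_space set \<Rightarrow> real" where
  "torsional_rigidity \<Omega> = (LINT x:\<Omega>|lborel. (SOME u. weak_torsion_solution \<Omega> u) x)"

definition A_convex :: "'a::euclidean_space set set" where
  "A_convex = {\<Omega>. \<Omega> \<noteq> {} \<and> open \<Omega> \<and> convex \<Omega> \<and> emeasure lborel \<Omega> < \<infinity>}"

definition F_half :: "'a::euclidean_space set \<Rightarrow> ereal" where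
  "F_half \<Omega> = perimeter \<Omega> * ereal (torsional_rigidity \<Omega> powr (1/2))
                / ereal (measure lborel \<Omega> powr (3/2))"

end

theory Submission
  imports Defs
begin

text \<open>
  For the lower bound let \<open>V = |\<Omega>|\<close>, \<open>P = P(\<Omega>)\<close> and \<open>a = V / P\<close>. With the distance \<open>d\<close> to the boundary,
  the test function \<open>F(d)\<close>, \<open>F'(t) = (a - t)\<^sup>+\<close>, gives \<open>T \<ge> V\<^sup>3 / (3 P\<^sup>2)\<close>, because the push-forward of
  Lebesgue measure on \<open>\<Omega>\<close> under \<open>d\<close> has density at most \<open>P\<close>. To avoid the coarea formula and the
  nonsmoothness of \<open>d\<close>, this distance is replaced by a soft minimum \<open>w\<close> of finitely many affine functions
  with unit gradients, cutting out a polytope close to \<open>\<Omega>\<close>. It is smooth with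
  \<open>\<Delta>w = - \<beta> (1 - |\<nabla>w|\<^sup>2)\<close>, and the density bound for \<open>w\<close> comes from inserting the explicit
  fields \<open>- h(w) \<nabla>w\<close> into the definition of the perimeter.

  For the slabs, \<open>T(\<Omega>\<^sub>\<epsilon>) \<le> |A| \<epsilon>\<^sup>3 / 12\<close> follows by writing \<open>\<integral> \<phi> = - \<integral> t \<partial>\<^sub>t\<phi>\<close>, and
  \<open>P(\<Omega>\<^sub>\<epsilon>) \<le> 2 |A| + O(\<epsilon>)\<close> by comparing \<open>\<Omega>\<^sub>\<epsilon>\<close> with its translates along the coordinate axes.
\<close>

section \<open>\<open>C\<^sup>1\<close> test functions\<close>

text \<open>The number a = V / P is the half-width of a thin slab of volume V and perimeter P. If
  the layers {t < d < t + dt} have measure at most P dt, the extreme case fills [0, a] at full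
  density, and the trial function is then the torsion function of the slab, F(t) = a t - t^2 / 2.
  One density bound serves both parts of the quotient: applied to F'(d)^2 it bounds the energy, and
  applied to F(a) - F(d) it bounds the integral of F(d) from below, because V is exactly P a. Both
  come out as P a^3 / 3, whence T \<ge> P a^3 / 3 = V^3 / (3 P^2). Since
  \<open>torsional_rigidity\<close> integrates a function picked by \<open>SOME\<close>, nothing is
  known about it before a solution is shown to exist. Hence the minimisation argument on bounded
  open sets, the reduction of convex sets of finite volume to bounded ones, and the passage to the
  quotient over C^1 test functions, the only form in which T is used later. The perimeter is
  likewise used through its definition only: particular fields bound it from below, shifts of the
  set from above.\<close>

definition C1_with_derivative ::
  "('a::euclidean_space \<Rightarrow> 'b::real_normed_vector) \<Rightarrow> ('a \<Rightarrow> 'a \<Rightarrow> 'b) \<Rightarrow> bool" where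
  "C1_with_derivative f D \<longleftrightarrow>
     (\<forall>x. (f has_derivative D x) (at x)) \<and> (\<forall>v. continuous_on UNIV (\<lambda>x. D x v))"

lemma C1_with_derivativeI:
  assumes "\<And>x. (f has_derivative D x) (at x)" "\<And>v. continuous_on UNIV (\<lambda>x. D x v)"
  shows "C1_with_derivative f D"
  using assms by (simp add: C1_with_derivative_def)

lemma C1_with_derivativeD:
  assumes "C1_with_derivative f D"
  shows "(f has_derivative D x) (at x)" "continuous_on UNIV (\<lambda>x. D x v)" "continuous_on UNIV f"
    "bounded_linear (D x)" "frechet_derivative f (at x) = D x"
proof -
  show "(f has_derivative D x) (at x)" for x
    using assms by (simp add: C1_with_derivative_def)
  from this[of x] show "bounded_linear (D x)" "frechet_derivative f (at x) = D x"
    by (auto dest: has_derivative_bounded_linear frechet_derivative_at)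
  show "continuous_on UNIV (\<lambda>x. D x v)"
    using assms by (simp add: C1_with_derivative_def)
  show "continuous_on UNIV f"
    using \<open>\<And>x. (f has_derivative D x) (at x)\<close>
    by (rule has_derivative_continuous_on)
qed

text \<open>In finite dimension a family of linear maps is continuous in operator norm as soon as it
  is continuous on each vector. Test functions can therefore be handled through plain directional
  derivatives, and the type of bounded linear maps from the definition of \<open>C1c\<close> does
  not appear again.\<close>

lemma C1c_iff:
  "\<phi> \<in> C1c \<Omega> \<longleftrightarrow>
     C1_with_derivative \<phi> (\<lambda>x. frechet_derivative \<phi> (at x)) \<and>
     compact (closure {x. \<phi> x \<noteq> 0}) \<and> closure {x. \<phi> x \<noteq> 0} \<subseteq> \<Omega>" (is "_ \<longleftrightarrow> ?D \<and> _")
proof -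
  have "?D" if "\<And>x. (\<phi> has_derivative blinfun_apply (\<phi>' x)) (at x)" "continuous_on UNIV \<phi>'" for \<phi>'
  proof -
    have "frechet_derivative \<phi> (at x) = blinfun_apply (\<phi>' x)" for x
      using frechet_derivative_at[OF that(1)] by simp
    then show ?thesis
      using that by (auto intro!: C1_with_derivativeI continuous_intros)
  qed
  moreover have "\<exists>\<phi>'. (\<forall>x. (\<phi> has_derivative blinfun_apply (\<phi>' x)) (at x)) \<and> continuous_on UNIV \<phi>'" if ?D
  proof (intro exI conjI allI)
    let ?\<phi>' = "\<lambda>x. Blinfun (frechet_derivative \<phi> (at x))"
    have eq: "blinfun_apply (?\<phi>' x) = frechet_derivative \<phi> (at x)" for x
      using C1_with_derivativeD(4)[OF that] by (rule bounded_linear_Blinfun_apply)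
    show "(\<phi> has_derivative blinfun_apply (?\<phi>' x)) (at x)" for x
      unfolding eq using C1_with_derivativeD(1)[OF that] .
    show "continuous_on UNIV ?\<phi>'"
      by (rule continuous_on_blinfun_componentwise) (simp add: eq C1_with_derivativeD(2)[OF that])
  qed
  ultimately show ?thesis
    unfolding C1c_def by blast
qed

lemma C1cI:
  assumes "C1_with_derivative \<phi> D" "compact K" "K \<subseteq> \<Omega>" "\<And>x. x \<notin> K \<Longrightarrow> \<phi> x = 0"
  shows "\<phi> \<in> C1c \<Omega>"
proof -
  have "{x. \<phi> x \<noteq> 0} \<subseteq> K" using assms(4) by blast
  then have "closure {x. \<phi> x \<noteq> 0} \<subseteq> K"
    using assms(2) by (simp add: closure_minimal compact_imp_closed)
  moreover from this have "compact (closure {x. \<phi> x \<noteq> 0})"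
    using \<open>{x. \<phi> x \<noteq> 0} \<subseteq> K\<close> bounded_subset[OF compact_imp_bounded[OF assms(2)]]
    by auto
  moreover have "(\<lambda>x. frechet_derivative \<phi> (at x)) = D"
    using C1_with_derivativeD(5)[OF assms(1)] by auto
  ultimately show ?thesis
    unfolding C1c_iff using assms(1,3) by (metis subset_trans)
qed

lemma C1c_derivative:
  "\<phi> \<in> C1c \<Omega> \<Longrightarrow> C1_with_derivative \<phi> (\<lambda>x. frechet_derivative \<phi> (at x))"
  by (simp add: C1c_iff)

lemma C1c_support:
  assumes "\<phi> \<in> C1c \<Omega>"
  obtains K where "compact K" "K \<subseteq> \<Omega>" "\<And>x. x \<notin> K \<Longrightarrow> \<phi> x = 0"
    "\<And>x v. x \<notin> K \<Longrightarrow> frechet_derivative \<phi> (at x) v = 0"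
proof -
  let ?K = "closure {x. \<phi> x \<noteq> 0}"
  have "frechet_derivative \<phi> (at x) = (\<lambda>v. 0)" if "x \<notin> ?K" for x
  proof -
    have "(\<phi> has_derivative (\<lambda>v. 0)) (at x)"
      by (rule has_derivative_transform_within_open[OF has_derivative_const[of 0], of "-?K"])
         (use that closure_subset[of "{x. \<phi> x \<noteq> 0}"] in \<open>auto simp: open_Compl\<close>)
    from frechet_derivative_at[OF this] show ?thesis by simp
  qed
  then show ?thesis
    using assms closure_subset[of "{x. \<phi> x \<noteq> 0}"] by (intro that[of ?K]) (auto simp: C1c_iff)
qed

lemma C1_with_derivative_inner_right:
  "C1_with_derivative (\<lambda>x. x \<bullet> b) (\<lambda>x v. v \<bullet> b)"
  by (rule C1_with_derivativeI) (auto intro!: derivative_eq_intros)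

lemma C1_with_derivative_add:
  "C1_with_derivative f D \<Longrightarrow> C1_with_derivative g E \<Longrightarrow>
    C1_with_derivative (\<lambda>x. f x + g x) (\<lambda>x v. D x v + E x v)"
  unfolding C1_with_derivative_def by (auto intro!: has_derivative_add continuous_on_add)

lemma C1_with_derivative_diff:
  "C1_with_derivative f D \<Longrightarrow> C1_with_derivative g E \<Longrightarrow>
    C1_with_derivative (\<lambda>x. f x - g x) (\<lambda>x v. D x v - E x v)"
  unfolding C1_with_derivative_def by (auto intro!: has_derivative_diff continuous_on_diff)

lemma C1_with_derivative_scaleR:
  assumes "C1_with_derivative f D" "C1_with_derivative g E"
  shows "C1_with_derivative (\<lambda>x. f x *\<^sub>R g x) (\<lambda>x v. f x *\<^sub>R E x v + D x v *\<^sub>R g x)"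
  using assms C1_with_derivativeD(3)[OF assms(1)] C1_with_derivativeD(3)[OF assms(2)]
  unfolding C1_with_derivative_def
  by (auto intro!: has_derivative_scaleR continuous_intros)

lemma C1_with_derivative_mult:
  fixes f g :: "'a::euclidean_space \<Rightarrow> real"
  assumes "C1_with_derivative f D" "C1_with_derivative g E"
  shows "C1_with_derivative (\<lambda>x. f x * g x) (\<lambda>x v. f x * E x v + D x v * g x)"
  using C1_with_derivative_scaleR[OF assms] by simp

lemma C1_with_derivative_cmult:
  "C1_with_derivative f D \<Longrightarrow> C1_with_derivative (\<lambda>x. c *\<^sub>R f x) (\<lambda>x v. c *\<^sub>R D x v)"
  unfolding C1_with_derivative_def by (auto intro!: has_derivative_scaleR_right continuous_intros)

lemma C1_with_derivative_inner:
  "C1_with_derivative f D \<Longrightarrow> C1_with_derivative (\<lambda>x. f x \<bullet> b) (\<lambda>x v. D x v \<bullet> b)"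
  unfolding C1_with_derivative_def by (auto intro!: has_derivative_inner_left continuous_intros)

lemma C1_with_derivative_compose:
  fixes f :: "'a::euclidean_space \<Rightarrow> real"
  assumes "C1_with_derivative f D" "\<And>t. (h has_real_derivative h' t) (at t)" "continuous_on UNIV h'"
  shows "C1_with_derivative (\<lambda>x. h (f x)) (\<lambda>x v. h' (f x) * D x v)"
proof (rule C1_with_derivativeI)
  have "(h has_derivative (\<lambda>s. h' t * s)) (at t)" for t
    using assms(2)[of t] by (simp add: has_field_derivative_def)
  then show "((\<lambda>x. h (f x)) has_derivative (\<lambda>v. h' (f x) * D x v)) (at x)" for x
    using has_derivative_compose[of f "D x" x UNIV h "\<lambda>s. h' (f x) * s"] C1_with_derivativeD(1)[OF assms(1)]
    by auto
  show "continuous_on UNIV (\<lambda>x. h' (f x) * D x v)" for v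
    using C1_with_derivativeD(2,3)[OF assms(1)] continuous_on_compose2[OF assms(3), of UNIV f]
    by (auto intro!: continuous_intros)
qed

lemma C1_with_derivative_translate:
  assumes "C1_with_derivative f D"
  shows "C1_with_derivative (\<lambda>x. f (x + a)) (\<lambda>x. D (x + a))"
proof (rule C1_with_derivativeI)
  show "((\<lambda>x. f (x + a)) has_derivative D (x + a)) (at x)" for x
    by (rule has_derivative_compose[where f = "\<lambda>x. x + a" and f' = "\<lambda>x. x" and g = f])
       (auto intro!: derivative_eq_intros C1_with_derivativeD(1)[OF assms])
  show "continuous_on UNIV (\<lambda>x. D (x + a) v)" for v
    using continuous_on_compose2[OF C1_with_derivativeD(2)[OF assms, of v], of UNIV "\<lambda>x. x + a"]
    by (simp add: continuous_on_add)
qed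

lemma C1c_mult:
  fixes \<phi> \<psi> :: "'a::euclidean_space \<Rightarrow> real"
  assumes "\<phi> \<in> C1c \<Omega>" "C1_with_derivative \<psi> E"
  shows "(\<lambda>x. \<phi> x * \<psi> x) \<in> C1c \<Omega>"
proof -
  obtain K where "compact K" "K \<subseteq> \<Omega>" "\<And>x. x \<notin> K \<Longrightarrow> \<phi> x = 0"
    using C1c_support[OF assms(1)] by metis
  then show ?thesis
    by (intro C1cI[OF C1_with_derivative_mult[OF C1c_derivative[OF assms(1)] assms(2)]]) auto
qed

lemma C1c_lincomb:
  fixes \<phi> \<psi> :: "'a::euclidean_space \<Rightarrow> 'b::real_normed_vector"
  assumes "\<phi> \<in> C1c \<Omega>" "\<psi> \<in> C1c \<Omega>"
  shows "(\<lambda>x. a *\<^sub>R \<phi> x + b *\<^sub>R \<psi> x) \<in> C1c \<Omega>"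
proof -
  obtain K L where "compact K" "K \<subseteq> \<Omega>" "\<And>x. x \<notin> K \<Longrightarrow> \<phi> x = 0"
    "compact L" "L \<subseteq> \<Omega>" "\<And>x. x \<notin> L \<Longrightarrow> \<psi> x = 0"
    using C1c_support assms by metis
  then show ?thesis
    by (intro C1cI[OF C1_with_derivative_add[OF C1_with_derivative_cmult C1_with_derivative_cmult,
      OF C1c_derivative[OF assms(1)] C1c_derivative[OF assms(2)]], of "K \<union> L"]) (auto intro: compact_Un)
qed

lemma C1c_inner:
  assumes "\<phi> \<in> C1c \<Omega>"
  shows "(\<lambda>x. \<phi> x \<bullet> b) \<in> C1c \<Omega>"
proof -
  obtain K where "compact K" "K \<subseteq> \<Omega>" "\<And>x. x \<notin> K \<Longrightarrow> \<phi> x = 0"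
    using C1c_support[OF assms(1)] by metis
  then show ?thesis
    by (intro C1cI[OF C1_with_derivative_inner[OF C1c_derivative[OF assms(1)]]]) auto
qed

lemma C1c_bounded:
  assumes "\<phi> \<in> C1c \<Omega>"
  obtains B where "B > 0" "\<And>x. norm (\<phi> x) \<le> B"
proof -
  obtain K where K: "compact K" "K \<subseteq> \<Omega>" "\<And>x. x \<notin> K \<Longrightarrow> \<phi> x = 0"
    using C1c_support[OF assms(1)] by metis
  have "continuous_on K \<phi>"
    using C1_with_derivativeD(3)[OF C1c_derivative[OF assms]] continuous_on_subset by blast
  then have "bounded (\<phi> ` K)"
    using K compact_continuous_image compact_imp_bounded by blast
  then obtain B where B: "B > 0" "\<And>x. x \<in> K \<Longrightarrow> norm (\<phi> x) \<le> B"
    unfolding bounded_pos by auto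
  show ?thesis
    by (rule that[OF B(1)]) (metis B K(3) less_imp_le norm_zero)
qed

lemma C1c_derivative_bounded:
  assumes "\<phi> \<in> C1c \<Omega>"
  obtains B where "B > 0" "\<And>x. norm (frechet_derivative \<phi> (at x) v) \<le> B"
proof -
  obtain K where K: "compact K" "K \<subseteq> \<Omega>" "\<And>x. x \<notin> K \<Longrightarrow> frechet_derivative \<phi> (at x) v = 0"
    using C1c_support[OF assms(1)] by metis
  let ?f = "\<lambda>x. frechet_derivative \<phi> (at x) v"
  have "continuous_on K ?f"
    using C1_with_derivativeD(2)[OF C1c_derivative[OF assms]] continuous_on_subset by blast
  then have "bounded (?f ` K)"
    using K compact_continuous_image compact_imp_bounded by blast
  then obtain B where B: "B > 0" "\<And>x. x \<in> K \<Longrightarrow> norm (?f x) \<le> B"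
    unfolding bounded_pos by auto
  show ?thesis
    by (rule that[OF B(1)]) (metis B K(3) less_imp_le norm_zero)
qed

section \<open>Gradients and difference quotients\<close>

lemma grad_inner:
  assumes "C1_with_derivative \<phi> D"
  shows "grad \<phi> x \<bullet> v = D x v"
proof -
  interpret bounded_linear "D x" using C1_with_derivativeD(4)[OF assms] .
  have "D x v = D x (\<Sum>b\<in>Basis. (v \<bullet> b) *\<^sub>R b)" by (simp add: euclidean_representation)
  also have "\<dots> = (\<Sum>b\<in>Basis. (v \<bullet> b) * D x b)" by (simp add: sum scaleR)
  finally show ?thesis
    by (simp add: grad_def C1_with_derivativeD(5)[OF assms] inner_sum_left inner_commute[of v] mult.commute)
qed

lemma grad_continuous:
  assumes "C1_with_derivative \<phi> D"
  shows "continuous_on UNIV (grad \<phi>)"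
  unfolding grad_def C1_with_derivativeD(5)[OF assms]
  using C1_with_derivativeD(2)[OF assms] by (intro continuous_intros)

lemma grad_eqI:
  assumes "C1_with_derivative \<phi> D" "\<And>v. D x v = g \<bullet> v"
  shows "grad \<phi> x = g"
  using grad_inner[OF assms(1), of x] assms(2) by (metis inner_commute vector_eq_ldot)

lemma C1c_grad_bounded:
  assumes "\<phi> \<in> C1c \<Omega>"
  obtains B where "B > 0" "\<And>x. norm (grad \<phi> x) \<le> B"
proof -
  obtain K where K: "compact K" "K \<subseteq> \<Omega>" "\<And>x v. x \<notin> K \<Longrightarrow> frechet_derivative \<phi> (at x) v = 0"
    using C1c_support[OF assms(1)] by metis
  have "continuous_on K (grad \<phi>)"
    using grad_continuous[OF C1c_derivative[OF assms]] continuous_on_subset by blast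
  then have "bounded (grad \<phi> ` K)"
    using K compact_continuous_image compact_imp_bounded by blast
  then obtain B where B: "B > 0" "\<And>x. x \<in> K \<Longrightarrow> norm (grad \<phi> x) \<le> B"
    unfolding bounded_pos by auto
  have "grad \<phi> x = 0" if "x \<notin> K" for x
    using K(3)[OF that] by (simp add: grad_def)
  then show ?thesis
    by (intro that[OF B(1)]) (metis B less_imp_le norm_zero)
qed

text \<open>The mean value inequality along the segment from x to x + t v. The bound depends on
  neither x nor t, so it dominates all difference quotients at once when limits are taken under the
  integral.\<close>

lemma C1c_difference_quotient_bounded:
  fixes \<phi> :: "'a::euclidean_space \<Rightarrow> real"
  assumes "\<phi> \<in> C1c \<Omega>"
  obtains B where "B > 0" "\<And>x t. t > 0 \<Longrightarrow> norm ((\<phi> (x + t *\<^sub>R v) - \<phi> x) / t) \<le> B"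
    "\<And>x. norm (frechet_derivative \<phi> (at x) v) \<le> B"
proof -
  obtain B where B: "B > 0" "\<And>x. norm (frechet_derivative \<phi> (at x) v) \<le> B"
    using C1c_derivative_bounded[OF assms] by blast
  have "norm ((\<phi> (x + t *\<^sub>R v) - \<phi> x) / t) \<le> B" if "t > 0" for x t
  proof -
    let ?g = "\<lambda>s. \<phi> (x + s *\<^sub>R v)"
    have "(?g has_derivative (\<lambda>h. frechet_derivative \<phi> (at (x + s *\<^sub>R v)) (h *\<^sub>R v))) (at s)" for s
      by (rule has_derivative_compose[where f = "\<lambda>s. x + s *\<^sub>R v" and f' = "\<lambda>h. h *\<^sub>R v" and g = \<phi>])
         (auto intro!: derivative_eq_intros C1_with_derivativeD(1)[OF C1c_derivative[OF assms]])
    moreover have "norm (frechet_derivative \<phi> (at y) (h *\<^sub>R v)) \<le> B * norm h" for y h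
      using C1_with_derivativeD(4)[OF C1c_derivative[OF assms]] B(2)[of y]
      by (simp add: bounded_linear.linear linear_scale abs_mult mult.commute[of B] mult_left_mono)
    ultimately have "norm (?g t - ?g 0) \<le> B * norm (t - 0)"
      by (intro differentiable_bound[of UNIV]) (auto intro!: onorm_bound B(1)[THEN less_imp_le])
    then show ?thesis using that by (simp add: field_simps)
  qed
  with B show ?thesis using that by blast
qed

lemma directional_derivative_limit:
  fixes \<phi> :: "'a::euclidean_space \<Rightarrow> real"
  assumes "C1_with_derivative \<phi> D"
  shows "(\<lambda>n. (\<phi> (x + (1 / Suc n) *\<^sub>R v) - \<phi> x) / (1 / Suc n)) \<longlonglongrightarrow> D x v"
proof -
  interpret bounded_linear "D x" using C1_with_derivativeD(4)[OF assms] .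
  have "((\<lambda>s. \<phi> (x + s *\<^sub>R v)) has_derivative (\<lambda>h. D x (h *\<^sub>R v))) (at 0)"
    by (rule has_derivative_compose[where f = "\<lambda>s. x + s *\<^sub>R v" and f' = "\<lambda>h. h *\<^sub>R v" and g = \<phi>])
       (auto intro!: derivative_eq_intros C1_with_derivativeD(1)[OF assms, of x])
  moreover have "(\<lambda>h. D x (h *\<^sub>R v)) = (*) (D x v)" by (auto simp: scaleR)
  ultimately have "((\<lambda>s. \<phi> (x + s *\<^sub>R v)) has_real_derivative D x v) (at 0)"
    by (simp add: has_field_derivative_def)
  then have lim: "((\<lambda>h. (\<phi> (x + h *\<^sub>R v) - \<phi> x) / h) \<longlongrightarrow> D x v) (at 0)"
    by (simp add: DERIV_def)
  show ?thesis
    by (rule filterlim_compose[OF lim])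
       (use LIMSEQ_inverse_real_of_nat in \<open>simp add: filterlim_at inverse_eq_divide\<close>)
qed

section \<open>Integration of test functions and \<open>L\<^sup>2\<close>\<close>

lemma integrable_continuous_compact_support:
  fixes f :: "'a::euclidean_space \<Rightarrow> 'b::{banach, second_countable_topology}"
  assumes "continuous_on UNIV f" "compact K" "\<And>x. x \<notin> K \<Longrightarrow> f x = 0"
  shows "integrable lborel f"
proof -
  have "integrable lborel (\<lambda>x. indicator K x *\<^sub>R f x)"
    using borel_integrable_compact[OF assms(2)] assms(1) continuous_on_subset by blast
  moreover have "(\<lambda>x. indicator K x *\<^sub>R f x) = f"
    using assms(3) by (auto simp: indicator_def)
  ultimately show ?thesis by simp
qed

lemma set_lebesgue_integral_support:
  assumes "\<And>x. x \<notin> \<Omega> \<Longrightarrow> f x = 0"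
  shows "(LINT x:\<Omega>|M. f x) = (LINT x|M. f x)"
  unfolding set_lebesgue_integral_def
  by (rule Bochner_Integration.integral_cong) (use assms in \<open>auto simp: indicator_def\<close>)

lemma set_integrable_support:
  assumes "\<And>x. x \<notin> \<Omega> \<Longrightarrow> f x = 0"
  shows "set_integrable M \<Omega> f \<longleftrightarrow> integrable M f"
proof -
  have "(\<lambda>x. indicator \<Omega> x *\<^sub>R f x) = f"
    using assms by (auto simp: indicator_def)
  then show ?thesis by (simp add: set_integrable_def)
qed

lemma set_integrable_bounded_measurable:
  fixes f :: "'a::euclidean_space \<Rightarrow> 'b::{banach, second_countable_topology}"
  assumes "\<Omega> \<in> sets lborel" "emeasure lborel \<Omega> < \<infinity>" "set_borel_measurable lborel \<Omega> f"
    "\<And>x. x \<in> \<Omega> \<Longrightarrow> norm (f x) \<le> B"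
  shows "set_integrable lborel \<Omega> f"
proof -
  have "integrable lborel (\<lambda>x. indicator \<Omega> x *\<^sub>R B)"
    using assms(1,2) by simp
  then show ?thesis
    unfolding set_integrable_def
    by (rule Bochner_Integration.integrable_bound)
       (use assms in \<open>auto simp: set_borel_measurable_def indicator_def intro!: AE_I2 order_trans[OF _ abs_ge_self]\<close>)
qed

lemma set_borel_measurable_continuous_UNIV:
  fixes f :: "'a::euclidean_space \<Rightarrow> 'b::euclidean_space"
  assumes "\<Omega> \<in> sets lborel" "continuous_on UNIV f"
  shows "set_borel_measurable lborel \<Omega> f"
  using assms borel_measurable_continuous_onI[OF assms(2)]
  by (simp add: set_borel_measurable_def)

lemma C1c_integrable:
  fixes \<phi> :: "'a::euclidean_space \<Rightarrow> 'b::euclidean_space"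
  assumes "\<phi> \<in> C1c \<Omega>"
  shows "integrable lborel \<phi>" "integrable lborel (\<lambda>x. frechet_derivative \<phi> (at x) v)"
proof -
  obtain K where K: "compact K" "\<And>x. x \<notin> K \<Longrightarrow> \<phi> x = 0"
    "\<And>x v. x \<notin> K \<Longrightarrow> frechet_derivative \<phi> (at x) v = 0"
    using C1c_support[OF assms] by metis
  show "integrable lborel \<phi>"
    using integrable_continuous_compact_support[OF C1_with_derivativeD(3)[OF C1c_derivative[OF assms]]] K
    by blast
  show "integrable lborel (\<lambda>x. frechet_derivative \<phi> (at x) v)"
    using integrable_continuous_compact_support[OF C1_with_derivativeD(2)[OF C1c_derivative[OF assms]]] K
    by blast
qed

lemma lborel_integral_translate:
  fixes f :: "'a::euclidean_space \<Rightarrow> 'b::{banach, second_countable_topology}"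
  assumes "f \<in> borel_measurable borel"
  shows "(LINT x|lborel. f (x + c)) = (LINT x|lborel. f x)"
proof -
  have "(LINT x|lborel. f x) = (LINT x|distr lborel borel ((+) c). f x)"
    by (simp add: lborel_distr_plus)
  also have "\<dots> = (LINT x|lborel. f (c + x))"
    using assms by (subst integral_distr) auto
  finally show ?thesis by (simp add: add.commute)
qed

text \<open>Dominated convergence along the steps 1 / (n + 1). The weight z is left free because
  three arguments rest on this limit: z is the indicator of a large ball to show that derivatives of
  test functions have integral 0, an annihilator of test functions to compare weak gradients, and
  the indicator of \<Omega> to bound the perimeter.\<close>

lemma integral_difference_quotient_limit:
  fixes \<phi> :: "'a::euclidean_space \<Rightarrow> real"
  assumes "\<phi> \<in> C1c \<Omega>" "integrable lborel z"
  shows "(\<lambda>n. LINT x|lborel. z x * ((\<phi> (x + (1 / Suc n) *\<^sub>R v) - \<phi> x) / (1 / Suc n)))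
           \<longlonglongrightarrow> (LINT x|lborel. z x * frechet_derivative \<phi> (at x) v)"
proof -
  note D = C1c_derivative[OF assms(1)]
  obtain B where B: "B > 0" "\<And>x t. t > 0 \<Longrightarrow> norm ((\<phi> (x + t *\<^sub>R v) - \<phi> x) / t) \<le> B"
    using C1c_difference_quotient_bounded[OF assms(1)] by metis
  have [measurable]: "\<phi> \<in> borel_measurable borel" "(\<lambda>x. frechet_derivative \<phi> (at x) v) \<in> borel_measurable borel"
    using C1_with_derivativeD(2,3)[OF D] by (auto intro: borel_measurable_continuous_onI)
  have [measurable]: "z \<in> borel_measurable lborel" using assms(2) by auto
  show ?thesis
  proof (rule integral_dominated_convergence[where w = "\<lambda>x. norm (z x) * B"])
    show "integrable lborel (\<lambda>x. norm (z x) * B)" using assms(2) by auto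
    show "AE x in lborel. (\<lambda>n. z x * ((\<phi> (x + (1 / Suc n) *\<^sub>R v) - \<phi> x) / (1 / Suc n)))
            \<longlonglongrightarrow> z x * frechet_derivative \<phi> (at x) v"
      using directional_derivative_limit[OF D] by (intro AE_I2 tendsto_mult tendsto_const)
    show "AE x in lborel. norm (z x * ((\<phi> (x + (1 / Suc n) *\<^sub>R v) - \<phi> x) / (1 / Suc n))) \<le> norm (z x) * B" for n
      unfolding norm_mult using B(2)[of "1 / Suc n"] by (intro AE_I2 mult_left_mono) auto
  qed measurable
qed

text \<open>Difference quotients integrate to 0 by translation invariance of Lebesgue measure, which
  replaces Fubini and the fundamental theorem of calculus.\<close>

lemma integral_C1c_derivative:
  fixes \<phi> :: "'a::euclidean_space \<Rightarrow> real"
  assumes "\<phi> \<in> C1c \<Omega>"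
  shows "(LINT x|lborel. frechet_derivative \<phi> (at x) v) = 0"
proof -
  obtain K where K: "compact K" "\<And>x. x \<notin> K \<Longrightarrow> \<phi> x = 0"
    "\<And>x v. x \<notin> K \<Longrightarrow> frechet_derivative \<phi> (at x) v = 0"
    using C1c_support[OF assms] by metis
  obtain R where R: "K \<subseteq> cball 0 R"
    using compact_imp_bounded[OF K(1)] by (auto simp: bounded_iff subset_iff)
  \<comment> \<open>The ball has to contain the support of \<phi> and of all its shifts by v / (n +
    1), whose length is at most that of v. Its indicator is then an integrable weight that changes
    nothing.\<close>
  let ?S = "cball (0::'a) (R + norm v)"
  let ?z = "indicator ?S :: 'a \<Rightarrow> real"
  have [measurable]: "\<phi> \<in> borel_measurable borel"
    using C1_with_derivativeD(3)[OF C1c_derivative[OF assms]] by (auto intro: borel_measurable_continuous_onI)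
  have z: "integrable lborel ?z"
    using emeasure_bounded_finite[OF bounded_cball] by (intro integrable_real_indicator) (simp, blast)
  have "(LINT x|lborel. ?z x * ((\<phi> (x + (1 / Suc n) *\<^sub>R v) - \<phi> x) / (1 / Suc n))) = 0" for n
  proof -
    let ?t = "1 / real (Suc n)"
    have "norm (?t *\<^sub>R v) \<le> norm v"
      by (simp add: divide_simps distrib_left)
    then have "x \<in> ?S" if "x + ?t *\<^sub>R v \<in> K" for x
      using norm_triangle_ineq4[of "x + ?t *\<^sub>R v" "?t *\<^sub>R v"] that R by auto
    moreover have "x \<in> ?S" if "x \<in> K" for x
      using that R by (auto simp: add_increasing2)
    ultimately have "x \<in> ?S \<or> \<phi> (x + ?t *\<^sub>R v) = 0 \<and> \<phi> x = 0" for x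
      using K(2)[of x] K(2)[of "x + ?t *\<^sub>R v"] by blast
    from this[of x for x] have eq: "?z x * ((\<phi> (x + ?t *\<^sub>R v) - \<phi> x) / ?t) = (\<phi> (x + ?t *\<^sub>R v) - \<phi> x) / ?t" for x
      by (metis diff_self div_0 indicator_simps(1) mult_1 mult_zero_right)
    have i: "integrable lborel (\<lambda>x. \<phi> (x + ?t *\<^sub>R v))"
    proof (rule integrable_continuous_compact_support[where K = "(\<lambda>x. x - ?t *\<^sub>R v) ` K"])
      show "continuous_on UNIV (\<lambda>x. \<phi> (x + ?t *\<^sub>R v))"
        using C1_with_derivativeD(3)[OF C1_with_derivative_translate[OF C1c_derivative[OF assms]]] .
      show "compact ((\<lambda>x. x - ?t *\<^sub>R v) ` K)"
        by (rule compact_translation_subtract[OF K(1)])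
      fix x assume "x \<notin> (\<lambda>x. x - ?t *\<^sub>R v) ` K"
      then have "x + ?t *\<^sub>R v \<notin> K" by (metis add_diff_cancel_right' imageI)
      then show "\<phi> (x + ?t *\<^sub>R v) = 0" by (rule K(2))
    qed
    have "(LINT x|lborel. ?z x * ((\<phi> (x + ?t *\<^sub>R v) - \<phi> x) / ?t)) =
        (LINT x|lborel. (\<phi> (x + ?t *\<^sub>R v) - \<phi> x) / ?t)"
      by (simp only: eq)
    also have "\<dots> = ((LINT x|lborel. \<phi> (x + ?t *\<^sub>R v)) - (LINT x|lborel. \<phi> x)) / ?t"
      unfolding integral_divide_zero Bochner_Integration.integral_diff[OF i C1c_integrable(1)[OF assms]] ..
    also have "\<dots> = 0" unfolding lborel_integral_translate[OF \<open>\<phi> \<in> borel_measurable borel\<close>] by simp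
    finally show ?thesis .
  qed
  then have "(LINT x|lborel. ?z x * frechet_derivative \<phi> (at x) v) = 0"
    using integral_difference_quotient_limit[OF assms z, of v] by (simp only: LIMSEQ_const_iff)
  moreover have "?z x * frechet_derivative \<phi> (at x) v = frechet_derivative \<phi> (at x) v" for x
  proof (cases "x \<in> K")
    case True
    then show ?thesis using R by (auto simp: add_increasing2)
  next
    case False
    then show ?thesis using K(3) by simp
  qed
  ultimately show ?thesis by simp
qed

text \<open>Compact support of \<phi> alone makes the product a test function, whose derivative has
  integral 0. Leaving the support of \<psi> unrestricted allows coordinate functions in its
  place.\<close>

lemma C1c_integration_by_parts:
  fixes \<phi> \<psi> :: "'a::euclidean_space \<Rightarrow> real"
  assumes "\<phi> \<in> C1c \<Omega>" "C1_with_derivative \<psi> E"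
  shows "integrable lborel (\<lambda>x. \<phi> x * E x v)"
    "integrable lborel (\<lambda>x. frechet_derivative \<phi> (at x) v * \<psi> x)"
    "(LINT x|lborel. \<phi> x * E x v) = - (LINT x|lborel. frechet_derivative \<phi> (at x) v * \<psi> x)"
proof -
  obtain K where K: "compact K" "\<And>x. x \<notin> K \<Longrightarrow> \<phi> x = 0"
    "\<And>x v. x \<notin> K \<Longrightarrow> frechet_derivative \<phi> (at x) v = 0"
    using C1c_support[OF assms(1)] by metis
  note D = C1c_derivative[OF assms(1)]
  show 1: "integrable lborel (\<lambda>x. \<phi> x * E x v)"
    by (rule integrable_continuous_compact_support[OF _ K(1)])
       (auto intro!: continuous_on_mult C1_with_derivativeD(3)[OF D] C1_with_derivativeD(2)[OF assms(2)] simp: K)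
  show 2: "integrable lborel (\<lambda>x. frechet_derivative \<phi> (at x) v * \<psi> x)"
    by (rule integrable_continuous_compact_support[OF _ K(1)])
       (auto intro!: continuous_on_mult C1_with_derivativeD(2)[OF D] C1_with_derivativeD(3)[OF assms(2)] simp: K)
  have "(LINT x|lborel. frechet_derivative (\<lambda>x. \<phi> x * \<psi> x) (at x) v) = 0"
    by (rule integral_C1c_derivative[OF C1c_mult[OF assms]])
  then show "(LINT x|lborel. \<phi> x * E x v) = - (LINT x|lborel. frechet_derivative \<phi> (at x) v * \<psi> x)"
    unfolding C1_with_derivativeD(5)[OF C1_with_derivative_mult[OF D assms(2)]]
    using 1 2 by simp
qed

section \<open>Square-integrable functions: Cauchy-Schwarz, limits, completeness\<close>

lemma square_integrable_on_inner:
  assumes "square_integrable_on f \<Omega>" "square_integrable_on g \<Omega>"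
  shows "set_integrable lborel \<Omega> (\<lambda>x. f x \<bullet> g x)"
proof -
  let ?f = "\<lambda>x. indicator \<Omega> x *\<^sub>R f x" and ?g = "\<lambda>x. indicator \<Omega> x *\<^sub>R g x"
  have [measurable]: "?f \<in> borel_measurable lborel" "?g \<in> borel_measurable lborel"
    using assms by (auto simp: square_integrable_on_def set_borel_measurable_def)
  have eq: "(\<lambda>x. indicator \<Omega> x *\<^sub>R (f x \<bullet> g x)) = (\<lambda>x. ?f x \<bullet> ?g x)"
    by (auto simp: indicator_def)
  have meas: "(\<lambda>x. indicator \<Omega> x *\<^sub>R (f x \<bullet> g x)) \<in> borel_measurable lborel"
    unfolding eq by measurable
  have "set_integrable lborel \<Omega> (\<lambda>x. (norm (f x))\<^sup>2 + (norm (g x))\<^sup>2)"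
    using assms by (auto simp: square_integrable_on_def)
  moreover have "norm (f x \<bullet> g x) \<le> norm ((norm (f x))\<^sup>2 + (norm (g x))\<^sup>2)" for x
  proof -
    have "0 \<le> (norm (f x) - norm (g x))\<^sup>2" by simp
    then have "2 * (norm (f x) * norm (g x)) \<le> (norm (f x))\<^sup>2 + (norm (g x))\<^sup>2"
      by (simp add: power2_diff)
    moreover have "0 \<le> norm (f x) * norm (g x)" by simp
    ultimately show ?thesis
      using Cauchy_Schwarz_ineq2[of "f x" "g x"] by simp
  qed
  ultimately show ?thesis
    unfolding set_integrable_def
    by (elim Bochner_Integration.integrable_bound) (use meas in \<open>auto simp: indicator_def\<close>)
qed

lemma square_integrable_on_norm:
  "square_integrable_on f \<Omega> \<Longrightarrow> set_integrable lborel \<Omega> (\<lambda>x. (norm (f x))\<^sup>2)"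
  by (simp add: square_integrable_on_def)

lemma square_integrable_on_lincomb:
  fixes f g :: "'a::euclidean_space \<Rightarrow> 'b::euclidean_space"
  assumes "square_integrable_on f \<Omega>" "square_integrable_on g \<Omega>"
  shows "square_integrable_on (\<lambda>x. a *\<^sub>R f x + b *\<^sub>R g x) \<Omega>"
    and "(LINT x:\<Omega>|lborel. (norm (a *\<^sub>R f x + b *\<^sub>R g x))\<^sup>2) =
      a\<^sup>2 * (LINT x:\<Omega>|lborel. (norm (f x))\<^sup>2) + 2 * a * b * (LINT x:\<Omega>|lborel. f x \<bullet> g x)
       + b\<^sup>2 * (LINT x:\<Omega>|lborel. (norm (g x))\<^sup>2)"
proof -
  let ?f = "\<lambda>x. indicator \<Omega> x *\<^sub>R f x" and ?g = "\<lambda>x. indicator \<Omega> x *\<^sub>R g x"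
  have [measurable]: "?f \<in> borel_measurable lborel" "?g \<in> borel_measurable lborel"
    using assms by (auto simp: square_integrable_on_def set_borel_measurable_def)
  have meas_eq: "(\<lambda>x. indicator \<Omega> x *\<^sub>R (a *\<^sub>R f x + b *\<^sub>R g x)) = (\<lambda>x. a *\<^sub>R ?f x + b *\<^sub>R ?g x)"
    by (auto simp: indicator_def)
  have meas: "set_borel_measurable lborel \<Omega> (\<lambda>x. a *\<^sub>R f x + b *\<^sub>R g x)"
    unfolding set_borel_measurable_def meas_eq by measurable
  have eq: "(norm (a *\<^sub>R f x + b *\<^sub>R g x))\<^sup>2 =
      a\<^sup>2 * (norm (f x))\<^sup>2 + 2 * a * b * (f x \<bullet> g x) + b\<^sup>2 * (norm (g x))\<^sup>2" for x
    unfolding power2_norm_eq_inner inner_add_left inner_add_right inner_scaleR_left inner_scaleR_right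
      inner_commute[of "g x" "f x"]
    by (simp add: power2_eq_square distrib_left)
  note i = square_integrable_on_norm[OF assms(1)] square_integrable_on_norm[OF assms(2)]
    square_integrable_on_inner[OF assms]
  show "square_integrable_on (\<lambda>x. a *\<^sub>R f x + b *\<^sub>R g x) \<Omega>"
    unfolding square_integrable_on_def eq using meas i
    by (intro conjI set_integral_add(1) set_integrable_mult_right)
  show "(LINT x:\<Omega>|lborel. (norm (a *\<^sub>R f x + b *\<^sub>R g x))\<^sup>2) =
      a\<^sup>2 * (LINT x:\<Omega>|lborel. (norm (f x))\<^sup>2) + 2 * a * b * (LINT x:\<Omega>|lborel. f x \<bullet> g x)
       + b\<^sup>2 * (LINT x:\<Omega>|lborel. (norm (g x))\<^sup>2)"
    unfolding eq using i
    by (simp add: set_integral_add set_integrable_mult_right)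
qed

lemma square_integrable_on_diff:
  fixes f g :: "'a::euclidean_space \<Rightarrow> 'b::euclidean_space"
  assumes "square_integrable_on f \<Omega>" "square_integrable_on g \<Omega>"
  shows "square_integrable_on (\<lambda>x. f x - g x) \<Omega>"
  using square_integrable_on_lincomb(1)[OF assms, of 1 "-1"] by simp

lemma set_integral_square_nonneg: "0 \<le> (LINT x:\<Omega>|lborel. (norm (f x))\<^sup>2)"
  unfolding set_lebesgue_integral_def by (intro integral_nonneg_AE) simp

text \<open>Serves twice: for the Cauchy-Schwarz inequality, and for a nearly minimising function,
  where a is a bound for the gap to the infimum and the conclusion says that the Euler-Lagrange
  equation nearly holds.\<close>

lemma quadratic_nonneg_imp_discriminant:
  fixes a b c :: real
  assumes "\<And>s. 0 \<le> a + 2 * s * b + s\<^sup>2 * c"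
  shows "b\<^sup>2 \<le> a * c"
proof -
  have a: "0 \<le> a" using assms[of 0] by simp
  have "0 \<le> c"
  proof (rule ccontr)
    assume "\<not> 0 \<le> c"
    then have c: "c < 0" by simp
    \<comment> \<open>Chosen so that s c = c - a - 2 |b|; together with s \<ge> 1 this bounds the
      quadratic by a + s (c - a) \<le> c < 0.\<close>
    define s where "s = 1 + a / (- c) + 2 * \<bar>b\<bar> / (- c)"
    have "0 \<le> a / (- c)" "0 \<le> 2 * \<bar>b\<bar> / (- c)"
      using c a by (auto intro!: divide_nonneg_pos simp del: minus_divide_right[symmetric])
    then have s: "s \<ge> 1" by (simp add: s_def)
    have "s * c = c - a - 2 * \<bar>b\<bar>" using c by (simp add: s_def field_simps)
    moreover have "a + 2 * s * b + s\<^sup>2 * c = a + s * (2 * b + s * c)"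
      by (simp add: power2_eq_square algebra_simps)
    moreover from \<open>s * c = c - a - 2 * \<bar>b\<bar>\<close> have "2 * b + s * c = 2 * b - 2 * \<bar>b\<bar> + c - a" by simp
    ultimately have "a + 2 * s * b + s\<^sup>2 * c = a + s * (2 * b - 2 * \<bar>b\<bar> + c - a)" by simp
    moreover have "s * (2 * b - 2 * \<bar>b\<bar> + c - a) \<le> s * (c - a)"
      using s by (intro mult_left_mono) auto
    moreover have "s * (c - a) \<le> 1 * (c - a)"
      using s a c by (intro mult_right_mono_neg) auto
    ultimately have "a + 2 * s * b + s\<^sup>2 * c \<le> c" by simp
    then show False using assms[of s] c by simp
  qed
  show ?thesis
  proof (cases "c = 0")
    case True
    have "b = 0"
    proof (rule ccontr)
      assume "b \<noteq> 0"
      \<comment> \<open>With c = 0 this value of s turns the expression into -1.\<close>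
      then show False using assms[of "- (a + 1) / (2 * b)"] True by (simp add: field_simps)
    qed
    then show ?thesis using True by simp
  next
    case False
    then have "0 \<le> c * (a + 2 * (- b / c) * b + (- b / c)\<^sup>2 * c)"
      using assms \<open>0 \<le> c\<close> by (intro mult_nonneg_nonneg)
    also have "\<dots> = a * c - b\<^sup>2" using False by (simp add: field_simps power2_eq_square)
    finally show ?thesis by simp
  qed
qed

lemma set_integral_Cauchy_Schwarz:
  fixes f g :: "'a::euclidean_space \<Rightarrow> 'b::euclidean_space"
  assumes "square_integrable_on f \<Omega>" "square_integrable_on g \<Omega>"
  shows "(LINT x:\<Omega>|lborel. f x \<bullet> g x)\<^sup>2 \<le>
    (LINT x:\<Omega>|lborel. (norm (f x))\<^sup>2) * (LINT x:\<Omega>|lborel. (norm (g x))\<^sup>2)"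
proof (rule quadratic_nonneg_imp_discriminant)
  fix s :: real
  show "0 \<le> (LINT x:\<Omega>|lborel. (norm (f x))\<^sup>2) + 2 * s * (LINT x:\<Omega>|lborel. f x \<bullet> g x)
          + s\<^sup>2 * (LINT x:\<Omega>|lborel. (norm (g x))\<^sup>2)"
    using set_integral_square_nonneg[of \<Omega> "\<lambda>x. 1 *\<^sub>R f x + s *\<^sub>R g x"]
      square_integrable_on_lincomb(2)[OF assms, of 1 s] by simp
qed


lemma tendsto_zero_of_square:
  fixes f g :: "nat \<Rightarrow> real"
  assumes "\<And>n. (f n)\<^sup>2 \<le> g n" "g \<longlonglongrightarrow> 0"
  shows "f \<longlonglongrightarrow> 0"
proof -
  have "(\<lambda>n. sqrt (g n)) \<longlonglongrightarrow> sqrt 0"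
    using assms(2) by (rule tendsto_real_sqrt)
  moreover have "norm (f n) \<le> sqrt (g n)" for n
    using real_sqrt_le_mono[OF assms(1)[of n]] by simp
  ultimately show ?thesis
    by (intro Lim_null_comparison[of f "\<lambda>n. sqrt (g n)"]) (auto intro: always_eventually)
qed

lemma L2_tendsto_inner:
  fixes f g :: "'a::euclidean_space \<Rightarrow> 'b::euclidean_space"
  assumes "square_integrable_on f \<Omega>" "square_integrable_on g \<Omega>" "\<And>n. square_integrable_on (F n) \<Omega>"
    "(\<lambda>n. LINT x:\<Omega>|lborel. (norm (f x - F n x))\<^sup>2) \<longlonglongrightarrow> 0"
  shows "(\<lambda>n. LINT x:\<Omega>|lborel. F n x \<bullet> g x) \<longlonglongrightarrow> (LINT x:\<Omega>|lborel. f x \<bullet> g x)"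
proof -
  have "((LINT x:\<Omega>|lborel. f x \<bullet> g x) - (LINT x:\<Omega>|lborel. F n x \<bullet> g x))\<^sup>2 \<le>
      (LINT x:\<Omega>|lborel. (norm (f x - F n x))\<^sup>2) * (LINT x:\<Omega>|lborel. (norm (g x))\<^sup>2)" for n
  proof -
    have "(LINT x:\<Omega>|lborel. f x \<bullet> g x) - (LINT x:\<Omega>|lborel. F n x \<bullet> g x) =
        (LINT x:\<Omega>|lborel. (f x - F n x) \<bullet> g x)"
      using assms by (simp add: inner_diff_left set_integral_diff square_integrable_on_inner)
    then show ?thesis
      using set_integral_Cauchy_Schwarz[OF square_integrable_on_diff[OF assms(1,3)] assms(2)] by simp
  qed
  moreover have "(\<lambda>n. (LINT x:\<Omega>|lborel. (norm (f x - F n x))\<^sup>2) * (LINT x:\<Omega>|lborel. (norm (g x))\<^sup>2)) \<longlonglongrightarrow> 0"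
    using tendsto_mult_right[OF assms(4)] by simp
  ultimately have "(\<lambda>n. (LINT x:\<Omega>|lborel. f x \<bullet> g x) - (LINT x:\<Omega>|lborel. F n x \<bullet> g x)) \<longlonglongrightarrow> 0"
    by (rule tendsto_zero_of_square)
  from tendsto_diff[OF tendsto_const[of "LINT x:\<Omega>|lborel. f x \<bullet> g x"] this] show ?thesis by simp
qed

lemma L2_tendsto_norm:
  fixes f :: "'a::euclidean_space \<Rightarrow> 'b::euclidean_space"
  assumes "square_integrable_on f \<Omega>" "\<And>n. square_integrable_on (F n) \<Omega>"
    "(\<lambda>n. LINT x:\<Omega>|lborel. (norm (f x - F n x))\<^sup>2) \<longlonglongrightarrow> 0"
  shows "(\<lambda>n. LINT x:\<Omega>|lborel. (norm (F n x))\<^sup>2) \<longlonglongrightarrow> (LINT x:\<Omega>|lborel. (norm (f x))\<^sup>2)"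
proof -
  let ?N = "\<lambda>f. LINT x:\<Omega>|lborel. (norm (f x))\<^sup>2"
  have "?N (F n) = ?N (\<lambda>x. f x - F n x) + 2 * (LINT x:\<Omega>|lborel. F n x \<bullet> f x) - ?N f" for n
    using square_integrable_on_lincomb(2)[OF assms(1) assms(2)[of n], of 1 "-1"]
    by (simp add: inner_commute)
  moreover have "(\<lambda>n. ?N (\<lambda>x. f x - F n x) + 2 * (LINT x:\<Omega>|lborel. F n x \<bullet> f x) - ?N f)
      \<longlonglongrightarrow> 0 + 2 * (LINT x:\<Omega>|lborel. f x \<bullet> f x) - ?N f"
    by (intro tendsto_intros assms(3) L2_tendsto_inner assms)
  ultimately show ?thesis by (simp add: power2_norm_eq_inner)
qed

lemma square_integrable_on_const:
  fixes c :: "'b::euclidean_space"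
  assumes "\<Omega> \<in> sets lborel" "emeasure lborel \<Omega> < \<infinity>"
  shows "square_integrable_on (\<lambda>x::'a::euclidean_space. c) \<Omega>"
  using assms by (auto simp: square_integrable_on_def set_borel_measurable_def set_integrable_def)

text \<open>On a set of finite measure an L^2-Cauchy sequence is L^1-Cauchy, so a subsequence
  converges almost everywhere. Fatou's lemma along that subsequence transfers the Cauchy estimate to
  the pointwise limit.\<close>

lemma L2_complete:
  fixes f :: "nat \<Rightarrow> 'a::euclidean_space \<Rightarrow> 'b::euclidean_space"
  assumes \<Omega>: "\<Omega> \<in> sets lborel" "emeasure lborel \<Omega> < \<infinity>"
    and f: "\<And>n. square_integrable_on (f n) \<Omega>"
    and Cauchy: "\<And>e. e > 0 \<Longrightarrow> \<exists>M. \<forall>m\<ge>M. \<forall>n\<ge>M. (LINT x:\<Omega>|lborel. (norm (f m x - f n x))\<^sup>2) < e"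
  obtains g where "square_integrable_on g \<Omega>"
    "(\<lambda>n. LINT x:\<Omega>|lborel. (norm (g x - f n x))\<^sup>2) \<longlonglongrightarrow> 0"
proof -
  define s where "s n x = indicator \<Omega> x *\<^sub>R f n x" for n x
  have s_meas [measurable]: "s n \<in> borel_measurable lborel" for n
    using f[of n] by (simp add: square_integrable_on_def set_borel_measurable_def s_def[abs_def])
  note d = square_integrable_on_diff[OF f f]
  define V where "V = measure lborel \<Omega>"
  have L1: "set_integrable lborel \<Omega> (\<lambda>x. norm (h x))"
    "(LINT x:\<Omega>|lborel. norm (h x))\<^sup>2 \<le> V * (LINT x:\<Omega>|lborel. (norm (h x))\<^sup>2)"
    if "square_integrable_on h \<Omega>" for h :: "'a \<Rightarrow> 'b"
  proof -
    have eq: "(\<lambda>x. indicator \<Omega> x *\<^sub>R norm (h x)) = (\<lambda>x. norm (indicator \<Omega> x *\<^sub>R h x))"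
      by (auto simp: indicator_def)
    have [measurable]: "(\<lambda>x. indicator \<Omega> x *\<^sub>R h x) \<in> borel_measurable lborel"
      using that by (simp add: square_integrable_on_def set_borel_measurable_def)
    have "set_borel_measurable lborel \<Omega> (\<lambda>x. norm (h x))"
      unfolding set_borel_measurable_def eq by measurable
    then have sq: "square_integrable_on (\<lambda>x. norm (h x)) \<Omega>"
      using that by (simp add: square_integrable_on_def)
    have "(LINT x:\<Omega>|lborel. 1::real) = V"
      using \<Omega> by (simp add: set_lebesgue_integral_def V_def)
    with square_integrable_on_inner[OF square_integrable_on_const[OF \<Omega>, of "1::real"] sq]
      set_integral_Cauchy_Schwarz[OF square_integrable_on_const[OF \<Omega>, of "1::real"] sq]
    show "set_integrable lborel \<Omega> (\<lambda>x. norm (h x))"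
      "(LINT x:\<Omega>|lborel. norm (h x))\<^sup>2 \<le> V * (LINT x:\<Omega>|lborel. (norm (h x))\<^sup>2)"
      by simp_all
  qed
  have s_int: "integrable lborel (s n)" for n
  proof -
    have "integrable lborel (\<lambda>x. norm (s n x))"
      using L1(1)[OF f[of n]] by (simp add: set_integrable_def s_def)
    then show ?thesis by (simp add: integrable_norm_iff)
  qed
  have s_diff: "norm (s m x - s n x) = indicator \<Omega> x *\<^sub>R norm (f m x - f n x)" for m n x
    by (simp add: s_def indicator_def)
  have "\<exists>N. \<forall>i\<ge>N. \<forall>j\<ge>N. (LINT x|lborel. norm (s i x - s j x)) < e" if "e > 0" for e
  proof -
    have "V \<ge> 0" by (simp add: V_def)
    \<comment> \<open>V + 1 in place of V avoids a division by 0 when \<Omega> is a null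
      set.\<close>
    have "e\<^sup>2 / (V + 1) > 0" using that \<open>V \<ge> 0\<close> by simp
    then obtain M where M: "\<And>m n. m \<ge> M \<Longrightarrow> n \<ge> M \<Longrightarrow>
        (LINT x:\<Omega>|lborel. (norm (f m x - f n x))\<^sup>2) < e\<^sup>2 / (V + 1)"
      using Cauchy by metis
    have "(LINT x|lborel. norm (s i x - s j x)) < e" if "i \<ge> M" "j \<ge> M" for i j
    proof -
      have "(LINT x|lborel. norm (s i x - s j x))\<^sup>2 \<le> V * (LINT x:\<Omega>|lborel. (norm (f i x - f j x))\<^sup>2)"
        using L1(2)[OF d[of i j]] by (simp add: s_diff set_lebesgue_integral_def)
      also have "\<dots> \<le> (V + 1) * (LINT x:\<Omega>|lborel. (norm (f i x - f j x))\<^sup>2)"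
        using set_integral_square_nonneg by (intro mult_right_mono) auto
      also have "\<dots> < e\<^sup>2"
        using M[OF that] \<open>V \<ge> 0\<close> by (simp add: field_simps)
      finally show ?thesis
        using \<open>e > 0\<close> by (simp add: power2_less_imp_less)
    qed
    then show ?thesis by blast
  qed
  from cauchy_L1_AE_cauchy_subseq[of lborel s, OF s_int this]
  obtain r where r: "strict_mono r" "AE x in lborel. Cauchy (\<lambda>i. s (r i) x)" by blast
  \<comment> \<open>\<open>lim\<close> is unspecified where the subsequence diverges, which happens
    only on a null set; outside \<Omega> every term is 0 and so is the limit.\<close>
  define g where "g x = lim (\<lambda>i. s (r i) x)" for x
  have g_meas [measurable]: "g \<in> borel_measurable lborel"
    unfolding g_def[abs_def] by (rule borel_measurable_lim_metric) measurable
  have g_out: "g x = 0" if "x \<notin> \<Omega>" for x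
    using that by (simp add: g_def s_def)
  have conv: "AE x in lborel. (\<lambda>i. s (r i) x) \<longlonglongrightarrow> g x"
    using r(2) by eventually_elim (simp add: g_def Cauchy_convergent_iff convergent_LIMSEQ_iff)
  have key: "\<exists>M. \<forall>n\<ge>M. integrable lborel (\<lambda>x. (norm (g x - s n x))\<^sup>2) \<and>
      (LINT x|lborel. (norm (g x - s n x))\<^sup>2) \<le> e" if "e > 0" for e
  proof -
    obtain M where M: "\<And>m n. m \<ge> M \<Longrightarrow> n \<ge> M \<Longrightarrow>
        (LINT x:\<Omega>|lborel. (norm (f m x - f n x))\<^sup>2) < e"
      using Cauchy[OF \<open>e > 0\<close>] by metis
    have "integrable lborel (\<lambda>x. (norm (g x - s n x))\<^sup>2) \<and>
      (LINT x|lborel. (norm (g x - s n x))\<^sup>2) \<le> e" if n: "n \<ge> M" for n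
    proof -
      have bound: "(\<integral>\<^sup>+x. ennreal ((norm (s m x - s n x))\<^sup>2) \<partial>lborel) \<le> ennreal e" if "m \<ge> M" for m
      proof -
        have eq: "(norm (s m x - s n x))\<^sup>2 = indicator \<Omega> x *\<^sub>R (norm (f m x - f n x))\<^sup>2" for x
          by (simp add: s_def indicator_def)
        have "integrable lborel (\<lambda>x. (norm (s m x - s n x))\<^sup>2)"
          unfolding eq using square_integrable_on_norm[OF d[of m n]] by (simp add: set_integrable_def)
        then have "(\<integral>\<^sup>+x. ennreal ((norm (s m x - s n x))\<^sup>2) \<partial>lborel) =
            ennreal (LINT x|lborel. (norm (s m x - s n x))\<^sup>2)"
          by (intro nn_integral_eq_integral) auto
        also have "(LINT x|lborel. (norm (s m x - s n x))\<^sup>2) \<le> e"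
          unfolding eq using M[OF that n] by (simp add: set_lebesgue_integral_def)
        finally show ?thesis by (simp add: ennreal_leI)
      qed
      \<comment> \<open>Fatou with n fixed: only the other index runs along the subsequence, and r i
        \<ge> i puts it beyond M.\<close>
      have "(\<integral>\<^sup>+x. ennreal ((norm (g x - s n x))\<^sup>2) \<partial>lborel) =
          (\<integral>\<^sup>+x. liminf (\<lambda>i. ennreal ((norm (s (r i) x - s n x))\<^sup>2)) \<partial>lborel)"
      proof (rule nn_integral_cong_AE)
        show "AE x in lborel. ennreal ((norm (g x - s n x))\<^sup>2) =
            liminf (\<lambda>i. ennreal ((norm (s (r i) x - s n x))\<^sup>2))"
          using conv
        proof eventually_elim
          case (elim x)
          have "(\<lambda>i. ennreal ((norm (s (r i) x - s n x))\<^sup>2)) \<longlonglongrightarrow> ennreal ((norm (g x - s n x))\<^sup>2)"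
            by (intro tendsto_intros elim)
          from lim_imp_Liminf[OF sequentially_bot this] show ?case by simp
        qed
      qed
      also have "\<dots> \<le> liminf (\<lambda>i. \<integral>\<^sup>+x. ennreal ((norm (s (r i) x - s n x))\<^sup>2) \<partial>lborel)"
        by (rule nn_integral_liminf) measurable
      also have "\<dots> \<le> ennreal e"
      proof (rule Liminf_le[OF sequentially_bot])
        show "eventually (\<lambda>i. (\<integral>\<^sup>+x. ennreal ((norm (s (r i) x - s n x))\<^sup>2) \<partial>lborel) \<le> ennreal e) sequentially"
          using bound seq_suble[OF r(1)] by (intro eventually_sequentiallyI[of M]) (meson le_trans)
      qed
      finally have le: "(\<integral>\<^sup>+x. ennreal ((norm (g x - s n x))\<^sup>2) \<partial>lborel) \<le> ennreal e" .
      then have int: "integrable lborel (\<lambda>x. (norm (g x - s n x))\<^sup>2)"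
        by (intro integrableI_bounded) (auto simp: le_less_trans ennreal_less_top)
      moreover have "(LINT x|lborel. (norm (g x - s n x))\<^sup>2) \<le> e"
        using le nn_integral_eq_integral[OF int] \<open>e > 0\<close> by simp
      ultimately show ?thesis by blast
    qed
    then show ?thesis by blast
  qed
  have g_s: "(norm (g x - s n x))\<^sup>2 = indicator \<Omega> x *\<^sub>R (norm (g x - f n x))\<^sup>2" for n x
    using g_out by (simp add: s_def indicator_def)
  have g_ind: "indicator \<Omega> x *\<^sub>R g x = g x" for x
    using g_out by (simp add: indicator_def)
  obtain n where n: "integrable lborel (\<lambda>x. (norm (g x - s n x))\<^sup>2)"
    using key[of 1] by auto
  have "square_integrable_on (\<lambda>x. g x - f n x) \<Omega>"
    unfolding square_integrable_on_def
  proof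
    have eq: "indicator \<Omega> x *\<^sub>R (g x - f n x) = g x - s n x" for x
      using g_out by (simp add: s_def indicator_def)
    show "set_borel_measurable lborel \<Omega> (\<lambda>x. g x - f n x)"
      unfolding set_borel_measurable_def eq by measurable
    show "set_integrable lborel \<Omega> (\<lambda>x. (norm (g x - f n x))\<^sup>2)"
      using n by (simp add: set_integrable_def g_s)
  qed
  from square_integrable_on_lincomb(1)[OF this f[of n], of 1 1]
  have "square_integrable_on g \<Omega>" by simp
  moreover have "(\<lambda>n. LINT x:\<Omega>|lborel. (norm (g x - f n x))\<^sup>2) \<longlonglongrightarrow> 0"
  proof (rule LIMSEQ_I)
    fix e :: real assume "e > 0"
    then obtain M where M: "\<And>n. n \<ge> M \<Longrightarrow> (LINT x|lborel. (norm (g x - s n x))\<^sup>2) \<le> e / 2"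
      using key[of "e / 2"] by auto
    have "norm ((LINT x:\<Omega>|lborel. (norm (g x - f n x))\<^sup>2) - 0) < e" if "n \<ge> M" for n
      using M[OF that] \<open>e > 0\<close> set_integral_square_nonneg[of \<Omega> "\<lambda>x. g x - f n x"]
      by (simp add: g_s set_lebesgue_integral_def)
    then show "\<exists>M. \<forall>n\<ge>M. norm ((LINT x:\<Omega>|lborel. (norm (g x - f n x))\<^sup>2) - 0) < e" by blast
  qed
  ultimately show ?thesis using that by blast
qed

section \<open>Torsional rigidity\<close>

lemma set_integral_inner_left:
  fixes f :: "'a \<Rightarrow> 'b::euclidean_space"
  assumes "set_integrable M \<Omega> f"
  shows "(LINT x:\<Omega>|M. f x \<bullet> b) = (LINT x:\<Omega>|M. f x) \<bullet> b"
  using integral_inner_left[of b M "\<lambda>x. indicator \<Omega> x *\<^sub>R f x"] assms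
  by (simp add: set_lebesgue_integral_def set_integrable_def)

lemma set_integrable_inner_left:
  fixes f :: "'a \<Rightarrow> 'b::euclidean_space"
  assumes "set_integrable M \<Omega> f"
  shows "set_integrable M \<Omega> (\<lambda>x. f x \<bullet> b)"
  using integrable_inner_left[of b M "\<lambda>x. indicator \<Omega> x *\<^sub>R f x"] assms
  by (simp add: set_integrable_def)

lemma square_integrable_on_scaleR:
  fixes f :: "'a::euclidean_space \<Rightarrow> real" and g :: "'a \<Rightarrow> 'b::euclidean_space"
  assumes "square_integrable_on f \<Omega>" "square_integrable_on g \<Omega>"
  shows "set_integrable lborel \<Omega> (\<lambda>x. f x *\<^sub>R g x)"
proof -
  let ?f = "\<lambda>x. indicator \<Omega> x *\<^sub>R f x" and ?g = "\<lambda>x. indicator \<Omega> x *\<^sub>R g x"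
  have [measurable]: "?f \<in> borel_measurable lborel" "?g \<in> borel_measurable lborel"
    using assms by (auto simp: square_integrable_on_def set_borel_measurable_def)
  have eq: "(\<lambda>x. indicator \<Omega> x *\<^sub>R (f x *\<^sub>R g x)) = (\<lambda>x. ?f x *\<^sub>R ?g x)"
    by (auto simp: indicator_def)
  have meas: "(\<lambda>x. indicator \<Omega> x *\<^sub>R (f x *\<^sub>R g x)) \<in> borel_measurable lborel"
    unfolding eq by measurable
  have "set_integrable lborel \<Omega> (\<lambda>x. (norm (f x))\<^sup>2 + (norm (g x))\<^sup>2)"
    using assms by (intro set_integral_add(1) square_integrable_on_norm)
  moreover have "norm (f x *\<^sub>R g x) \<le> norm ((norm (f x))\<^sup>2 + (norm (g x))\<^sup>2)" for x
  proof -
    have "0 \<le> (norm (f x) - norm (g x))\<^sup>2" by simp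
    then have "2 * (norm (f x) * norm (g x)) \<le> (norm (f x))\<^sup>2 + (norm (g x))\<^sup>2"
      by (simp add: power2_diff)
    moreover have "0 \<le> norm (f x) * norm (g x)" by simp
    ultimately have "norm (f x) * norm (g x) \<le> (norm (f x))\<^sup>2 + (norm (g x))\<^sup>2" by linarith
    then show ?thesis by simp
  qed
  ultimately show ?thesis
    unfolding set_integrable_def
    by (elim Bochner_Integration.integrable_bound) (use meas in \<open>auto simp: indicator_def\<close>)
qed

lemma square_integrable_on_bounded_continuous:
  fixes f :: "'a::euclidean_space \<Rightarrow> 'b::euclidean_space"
  assumes "\<Omega> \<in> sets lborel" "emeasure lborel \<Omega> < \<infinity>" "continuous_on UNIV f"
    "\<And>x. x \<in> \<Omega> \<Longrightarrow> norm (f x) \<le> B"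
  shows "square_integrable_on f \<Omega>"
proof -
  have "set_integrable lborel \<Omega> (\<lambda>x. (norm (f x))\<^sup>2)"
  proof (rule set_integrable_bounded_measurable[OF assms(1,2), where B = "B\<^sup>2"])
    show "set_borel_measurable lborel \<Omega> (\<lambda>x. (norm (f x))\<^sup>2)"
      by (intro set_borel_measurable_continuous_UNIV assms continuous_intros)
    show "norm ((norm (f x))\<^sup>2) \<le> B\<^sup>2" if "x \<in> \<Omega>" for x
      using assms(4)[OF that] by (simp add: power_mono)
  qed
  then show ?thesis
    using set_borel_measurable_continuous_UNIV[OF assms(1,3)] by (simp add: square_integrable_on_def)
qed

lemma C1c_square_integrable:
  fixes \<phi> :: "'a::euclidean_space \<Rightarrow> real"
  assumes "\<Omega> \<in> sets lborel" "emeasure lborel \<Omega> < \<infinity>" "\<phi> \<in> C1c U"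
  shows "square_integrable_on \<phi> \<Omega>" "square_integrable_on (grad \<phi>) \<Omega>"
proof -
  obtain B where "\<And>x. norm (\<phi> x) \<le> B" using C1c_bounded[OF assms(3)] by metis
  then show "square_integrable_on \<phi> \<Omega>"
    by (intro square_integrable_on_bounded_continuous[OF assms(1,2)]
        C1_with_derivativeD(3)[OF C1c_derivative[OF assms(3)]])
  obtain B where "\<And>x. norm (grad \<phi> x) \<le> B" using C1c_grad_bounded[OF assms(3)] by metis
  then show "square_integrable_on (grad \<phi>) \<Omega>"
    by (intro square_integrable_on_bounded_continuous[OF assms(1,2)]
        grad_continuous[OF C1c_derivative[OF assms(3)]])
qed

lemma C1c_eq_0_outside:
  fixes \<phi> :: "'a::euclidean_space \<Rightarrow> 'b::real_normed_vector"
  assumes "\<phi> \<in> C1c \<Omega>" "x \<notin> \<Omega>"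
  shows "\<phi> x = 0" "frechet_derivative \<phi> (at x) v = 0"
proof -
  obtain K where K: "compact K" "K \<subseteq> \<Omega>" "\<And>x. x \<notin> K \<Longrightarrow> \<phi> x = 0"
    "\<And>x v. x \<notin> K \<Longrightarrow> frechet_derivative \<phi> (at x) v = 0"
    using C1c_support[OF assms(1)] by metis
  have "x \<notin> K" using K(2) assms(2) by blast
  then show "\<phi> x = 0" "frechet_derivative \<phi> (at x) v = 0" using K by blast+
qed

lemma grad_lincomb:
  fixes \<phi> \<psi> :: "'a::euclidean_space \<Rightarrow> real"
  assumes "C1_with_derivative \<phi> D" "C1_with_derivative \<psi> E"
  shows "grad (\<lambda>x. a *\<^sub>R \<phi> x + b *\<^sub>R \<psi> x) x = a *\<^sub>R grad \<phi> x + b *\<^sub>R grad \<psi> x"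
  by (rule grad_eqI[OF C1_with_derivative_add[OF C1_with_derivative_cmult[OF assms(1)]
        C1_with_derivative_cmult[OF assms(2)]]])
     (simp add: inner_add_left grad_inner[OF assms(1)] grad_inner[OF assms(2)])

lemma H1_gradient_test:
  assumes "H1_gradient \<Omega> u g" "\<phi> \<in> C1c \<Omega>" "\<Omega> \<in> sets lborel" "emeasure lborel \<Omega> < \<infinity>"
  shows "(LINT x:\<Omega>|lborel. u x * (grad \<phi> x \<bullet> c)) = - (LINT x:\<Omega>|lborel. \<phi> x * (g x \<bullet> c))"
proof -
  have u: "square_integrable_on u \<Omega>" and g: "square_integrable_on g \<Omega>"
    and eq: "(LINT x:\<Omega>|lborel. u x *\<^sub>R grad \<phi> x) = - (LINT x:\<Omega>|lborel. \<phi> x *\<^sub>R g x)"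
    using assms(1,2) unfolding H1_gradient_def by blast+
  note \<phi> = C1c_square_integrable[OF assms(3,4,2)]
  show ?thesis
    using arg_cong[OF eq, of "\<lambda>v. v \<bullet> c"]
      set_integral_inner_left[OF square_integrable_on_scaleR[OF u \<phi>(2)], of c]
      set_integral_inner_left[OF square_integrable_on_scaleR[OF \<phi>(1) g], of c]
    by simp
qed

lemma H1_gradientI:
  assumes "square_integrable_on u \<Omega>" "square_integrable_on g \<Omega>"
    "\<Omega> \<in> sets lborel" "emeasure lborel \<Omega> < \<infinity>"
    "\<And>\<phi> c. \<phi> \<in> C1c \<Omega> \<Longrightarrow>
      (LINT x:\<Omega>|lborel. u x * (grad \<phi> x \<bullet> c)) = - (LINT x:\<Omega>|lborel. \<phi> x * (g x \<bullet> c))"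
  shows "H1_gradient \<Omega> u g"
  unfolding H1_gradient_def
proof (intro conjI ballI assms(1,2))
  fix \<phi> :: "'a \<Rightarrow> real" assume "\<phi> \<in> C1c \<Omega>"
  note \<phi> = this C1c_square_integrable[OF assms(3,4) this]
  have "(LINT x:\<Omega>|lborel. u x *\<^sub>R grad \<phi> x) \<bullet> c = (- (LINT x:\<Omega>|lborel. \<phi> x *\<^sub>R g x)) \<bullet> c" for c
    using assms(5)[OF \<phi>(1), of c]
      set_integral_inner_left[OF square_integrable_on_scaleR[OF assms(1) \<phi>(3)], of c]
      set_integral_inner_left[OF square_integrable_on_scaleR[OF \<phi>(2) assms(2)], of c]
    by simp
  then show "(LINT x:\<Omega>|lborel. u x *\<^sub>R grad \<phi> x) = - (LINT x:\<Omega>|lborel. \<phi> x *\<^sub>R g x)"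
    by (metis inner_commute vector_eq_ldot)
qed

lemma C1c_H1_gradient:
  assumes "\<phi> \<in> C1c \<Omega>" "\<Omega> \<in> sets lborel" "emeasure lborel \<Omega> < \<infinity>"
  shows "H1_gradient \<Omega> \<phi> (grad \<phi>)"
proof (rule H1_gradientI[OF C1c_square_integrable[OF assms(2,3,1)] assms(2,3)])
  fix \<psi> :: "'a \<Rightarrow> real" and c assume \<psi>: "\<psi> \<in> C1c \<Omega>"
  note D = C1c_derivative[OF assms(1)] and E = C1c_derivative[OF \<psi>]
  show "(LINT x:\<Omega>|lborel. \<phi> x * (grad \<psi> x \<bullet> c)) = - (LINT x:\<Omega>|lborel. \<psi> x * (grad \<phi> x \<bullet> c))"
    using C1c_integration_by_parts(3)[OF assms(1) E, of c]
    by (subst (1 2) set_lebesgue_integral_support)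
       (simp_all add: C1c_eq_0_outside[OF assms(1)] C1c_eq_0_outside[OF \<psi>] grad_inner[OF D] grad_inner[OF E] mult.commute)
qed

lemma C1c_subset_H10:
  assumes "\<phi> \<in> C1c \<Omega>" "\<Omega> \<in> sets lborel" "emeasure lborel \<Omega> < \<infinity>"
  shows "\<phi> \<in> H10 \<Omega>"
  unfolding H10_def using C1c_H1_gradient[OF assms] assms(1)
  by (auto intro!: exI[of _ "grad \<phi>"] exI[of _ "\<lambda>_. \<phi>"])

lemma H10E:
  assumes "u \<in> H10 \<Omega>" "\<Omega> \<in> sets lborel" "emeasure lborel \<Omega> < \<infinity>"
  obtains g \<phi> where "H1_gradient \<Omega> u g" "\<And>n. \<phi> n \<in> C1c \<Omega>"
    "(\<lambda>n. LINT x:\<Omega>|lborel. (norm (u x - \<phi> n x))\<^sup>2) \<longlonglongrightarrow> 0"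
    "(\<lambda>n. LINT x:\<Omega>|lborel. (norm (g x - grad (\<phi> n) x))\<^sup>2) \<longlonglongrightarrow> 0"
proof -
  obtain g \<phi> where g: "H1_gradient \<Omega> u g" and \<phi>: "\<And>n. \<phi> n \<in> C1c \<Omega>"
    and lim: "(\<lambda>n. LINT x:\<Omega>|lborel. (u x - \<phi> n x)\<^sup>2 + (norm (g x - grad (\<phi> n) x))\<^sup>2) \<longlonglongrightarrow> 0"
    using assms(1) unfolding H10_def by blast
  have sq: "square_integrable_on u \<Omega>" "square_integrable_on g \<Omega>"
    using g unfolding H1_gradient_def by blast+
  note \<phi>sq = C1c_square_integrable[OF assms(2,3) \<phi>]
  have sum: "(LINT x:\<Omega>|lborel. (u x - \<phi> n x)\<^sup>2 + (norm (g x - grad (\<phi> n) x))\<^sup>2) =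
      (LINT x:\<Omega>|lborel. (norm (u x - \<phi> n x))\<^sup>2) + (LINT x:\<Omega>|lborel. (norm (g x - grad (\<phi> n) x))\<^sup>2)" for n
    using square_integrable_on_norm[OF square_integrable_on_diff[OF sq(1) \<phi>sq(1)[of n]]]
      square_integrable_on_norm[OF square_integrable_on_diff[OF sq(2) \<phi>sq(2)[of n]]]
    by (subst set_integral_add(2)[symmetric]) auto
  note nonneg = set_integral_square_nonneg[of \<Omega> "\<lambda>x. u x - \<phi> n x" for n]
    set_integral_square_nonneg[of \<Omega> "\<lambda>x. g x - grad (\<phi> n) x" for n]
  show ?thesis
  proof (rule that[OF g \<phi>])
    show "(\<lambda>n. LINT x:\<Omega>|lborel. (norm (u x - \<phi> n x))\<^sup>2) \<longlonglongrightarrow> 0"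
      by (rule tendsto_sandwich[OF _ _ tendsto_const lim]) (use nonneg in \<open>simp_all add: sum\<close>)
    show "(\<lambda>n. LINT x:\<Omega>|lborel. (norm (g x - grad (\<phi> n) x))\<^sup>2) \<longlonglongrightarrow> 0"
      by (rule tendsto_sandwich[OF _ _ tendsto_const lim]) (use nonneg in \<open>simp_all add: sum\<close>)
  qed
qed

text \<open>Difference quotients of a \<open>C\<^sup>1\<close> test function are themselves \<open>C\<^sup>1\<close> test functions, so a function
  that annihilates all test functions also annihilates their merely continuous derivatives.\<close>

lemma annihilates_test_derivatives:
  fixes z :: "'a::euclidean_space \<Rightarrow> real"
  assumes "open \<Omega>" "set_integrable lborel \<Omega> z" "\<phi> \<in> C1c \<Omega>"
    and zero: "\<And>\<psi>. \<psi> \<in> C1c \<Omega> \<Longrightarrow> (LINT x:\<Omega>|lborel. \<psi> x * z x) = 0"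
  shows "(LINT x:\<Omega>|lborel. frechet_derivative \<phi> (at x) v * z x) = 0"
proof -
  obtain K where K: "compact K" "K \<subseteq> \<Omega>" "\<And>x. x \<notin> K \<Longrightarrow> \<phi> x = 0"
    using C1c_support[OF assms(3)] by metis
  obtain e where e: "e > 0" "(\<Union>x\<in>K. ball x e) \<subseteq> \<Omega>"
    using compact_subset_open_imp_ball_epsilon_subset[OF K(1) assms(1) K(2)] by blast
  let ?z = "\<lambda>x. indicator \<Omega> x * z x"
  let ?q = "\<lambda>n x. (\<phi> (x + (1 / Suc n) *\<^sub>R v) - \<phi> x) / (1 / Suc n)"
  have z: "integrable lborel ?z" using assms(2) by (simp add: set_integrable_def)
  \<comment> \<open>The support of \<phi> keeps a distance from the complement of \<Omega>, so the
    shifted support stays inside once the shift is shorter than e. Only large n qualify, which is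
    enough for the limit.\<close>
  have q: "?q n \<in> C1c \<Omega>" if "norm ((1 / Suc n) *\<^sub>R v) < e" for n
  proof -
    let ?w = "(1 / Suc n) *\<^sub>R v"
    have "x - ?w \<in> ball x e" for x using that by (simp add: dist_norm)
    then have "(\<lambda>x. x - ?w) ` K \<subseteq> \<Omega>" using e(2) by blast
    moreover have "C1_with_derivative (\<lambda>x. (1 / (1 / Suc n)) *\<^sub>R (\<phi> (x + ?w) - \<phi> x))
       (\<lambda>x u. (1 / (1 / Suc n)) *\<^sub>R (frechet_derivative \<phi> (at (x + ?w)) u - frechet_derivative \<phi> (at x) u))"
      by (rule C1_with_derivative_cmult[OF C1_with_derivative_diff[OF C1_with_derivative_translate]])
         (use C1c_derivative[OF assms(3)] in auto)
    moreover have "(\<lambda>x. (1 / (1 / Suc n)) *\<^sub>R (\<phi> (x + ?w) - \<phi> x)) = ?q n" by auto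
    moreover have "?q n x = 0" if "x \<notin> K \<union> (\<lambda>x. x - ?w) ` K" for x
    proof -
      have "x + ?w \<notin> K" using that by (metis UnCI add_diff_cancel_right' imageI)
      then show ?thesis using K(3) that by simp
    qed
    ultimately show ?thesis
      using K compact_translation_subtract[OF K(1), of ?w]
      by (intro C1cI[of _ _ "K \<union> (\<lambda>x. x - ?w) ` K"]) (auto intro: compact_Un)
  qed
  have "(\<lambda>n. norm (inverse (real (Suc n)) *\<^sub>R v)) \<longlonglongrightarrow> norm (0 *\<^sub>R v)"
    by (intro tendsto_intros LIMSEQ_inverse_real_of_nat)
  then have "\<forall>\<^sub>F n in sequentially. norm (inverse (real (Suc n)) *\<^sub>R v) < e"
    using e(1) by (intro order_tendstoD) auto
  then have "\<forall>\<^sub>F n in sequentially. (LINT x|lborel. ?z x * ?q n x) = 0"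
  proof eventually_elim
    case (elim n)
    then have "?q n \<in> C1c \<Omega>" by (intro q) (simp add: inverse_eq_divide)
    from zero[OF this] show ?case
      by (simp add: set_lebesgue_integral_def mult_ac)
  qed
  then have "(\<lambda>n. LINT x|lborel. ?z x * ?q n x) \<longlonglongrightarrow> 0"
    by (rule tendsto_eventually)
  with integral_difference_quotient_limit[OF assms(3) z, of v]
  have "(LINT x|lborel. ?z x * frechet_derivative \<phi> (at x) v) = 0"
    by (rule LIMSEQ_unique)
  then show ?thesis by (simp add: set_lebesgue_integral_def mult_ac)
qed

text \<open>In place of uniqueness almost everywhere, only the pairing with grad \<phi> is compared,
  which is all that is used below. The components of grad \<phi> are merely continuous and need not
  be test functions, so the equality goes through
  \<open>annihilates_test_derivatives\<close>.\<close>

lemma H1_gradient_unique_weak: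
  fixes u :: "'a::euclidean_space \<Rightarrow> real"
  assumes \<Omega>: "open \<Omega>" "emeasure lborel \<Omega> < \<infinity>" and "H1_gradient \<Omega> u g" "H1_gradient \<Omega> u h" "\<phi> \<in> C1c \<Omega>"
  shows "(LINT x:\<Omega>|lborel. grad \<phi> x \<bullet> g x) = (LINT x:\<Omega>|lborel. grad \<phi> x \<bullet> h x)"
proof -
  have \<Omega>': "\<Omega> \<in> sets lborel" using \<Omega>(1) by simp
  have sq: "square_integrable_on g \<Omega>" "square_integrable_on h \<Omega>"
    using assms(3,4) unfolding H1_gradient_def by blast+
  note d = square_integrable_on_diff[OF sq]
  have one: "square_integrable_on (\<lambda>x. b) \<Omega>" for b :: 'a
    by (rule square_integrable_on_const[OF \<Omega>' \<Omega>(2)])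
  have int: "set_integrable lborel \<Omega> (\<lambda>x. (g x - h x) \<bullet> b)" for b
    using square_integrable_on_inner[OF d one[of b]] .
  have "(LINT x:\<Omega>|lborel. frechet_derivative \<phi> (at x) b * ((g x - h x) \<bullet> b)) = 0" for b
  proof (rule annihilates_test_derivatives[OF \<Omega>(1) int assms(5)])
    fix \<psi> :: "'a \<Rightarrow> real" assume \<psi>: "\<psi> \<in> C1c \<Omega>"
    note \<psi>sq = C1c_square_integrable(1)[OF \<Omega>' \<Omega>(2) \<psi>]
    have i: "set_integrable lborel \<Omega> (\<lambda>x. \<psi> x * (g x \<bullet> b))" "set_integrable lborel \<Omega> (\<lambda>x. \<psi> x * (h x \<bullet> b))"
      using set_integrable_inner_left[OF square_integrable_on_scaleR[OF \<psi>sq sq(1)], of b]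
        set_integrable_inner_left[OF square_integrable_on_scaleR[OF \<psi>sq sq(2)], of b]
      by simp_all
    have "(LINT x:\<Omega>|lborel. \<psi> x * (g x \<bullet> b)) = (LINT x:\<Omega>|lborel. \<psi> x * (h x \<bullet> b))"
      using H1_gradient_test[OF assms(3) \<psi> \<Omega>' \<Omega>(2), of b] H1_gradient_test[OF assms(4) \<psi> \<Omega>' \<Omega>(2), of b]
      by simp
    then show "(LINT x:\<Omega>|lborel. \<psi> x * ((g x - h x) \<bullet> b)) = 0"
      using i by (simp add: inner_diff_left right_diff_distrib set_integral_diff)
  qed
  moreover have "grad \<phi> x \<bullet> (g x - h x) = (\<Sum>b\<in>Basis. frechet_derivative \<phi> (at x) b * ((g x - h x) \<bullet> b))" for x
    by (subst euclidean_inner) (simp add: grad_inner[OF C1c_derivative[OF assms(5)]])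
  moreover have "set_integrable lborel \<Omega> (\<lambda>x. frechet_derivative \<phi> (at x) b * ((g x - h x) \<bullet> b))" for b
  proof -
    have "set_integrable lborel \<Omega> (\<lambda>x. (grad \<phi> x \<bullet> b) *\<^sub>R (g x - h x))"
    proof (rule square_integrable_on_scaleR[OF _ d])
      obtain B where "\<And>x. norm (frechet_derivative \<phi> (at x) b) \<le> B"
        using C1c_derivative_bounded[OF assms(5)] by metis
      then show "square_integrable_on (\<lambda>x. grad \<phi> x \<bullet> b) \<Omega>"
        unfolding grad_inner[OF C1c_derivative[OF assms(5)]]
        by (intro square_integrable_on_bounded_continuous[OF \<Omega>' \<Omega>(2)]
            C1_with_derivativeD(2)[OF C1c_derivative[OF assms(5)]])
    qed
    from set_integrable_inner_left[OF this, of b] show ?thesis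
      by (simp add: grad_inner[OF C1c_derivative[OF assms(5)]])
  qed
  ultimately have "(LINT x:\<Omega>|lborel. grad \<phi> x \<bullet> (g x - h x)) = 0"
    unfolding set_lebesgue_integral_def set_integrable_def
    by (simp only: scaleR_sum_right Bochner_Integration.integral_sum sum.neutral_const)
  then show ?thesis
    using square_integrable_on_inner[OF C1c_square_integrable(2)[OF \<Omega>' \<Omega>(2) assms(5)]] sq
    by (simp add: inner_diff_right set_integral_diff)
qed


section \<open>Existence of the torsion function and the variational formula for T\<close>

lemma C1c_integral_via_coordinate:
  fixes \<phi> :: "'a::euclidean_space \<Rightarrow> real"
  assumes "\<Omega> \<in> sets lborel" "emeasure lborel \<Omega> < \<infinity>" "bounded \<Omega>" "b \<in> Basis" "\<phi> \<in> C1c \<Omega>"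
  shows "(LINT x:\<Omega>|lborel. \<phi> x)\<^sup>2 \<le>
    (LINT x:\<Omega>|lborel. (x \<bullet> b)\<^sup>2) * (LINT x:\<Omega>|lborel. (norm (grad \<phi> x))\<^sup>2)"
proof -
  note D = C1c_derivative[OF assms(5)]
  obtain R where R: "\<And>x. x \<in> \<Omega> \<Longrightarrow> norm x \<le> R"
    using assms(3) by (auto simp: bounded_iff)
  have sq: "square_integrable_on (\<lambda>x. (x \<bullet> b) *\<^sub>R b) \<Omega>"
  proof (rule square_integrable_on_bounded_continuous[OF assms(1,2)])
    show "norm ((x \<bullet> b) *\<^sub>R b) \<le> R" if "x \<in> \<Omega>" for x
      using Basis_le_norm[OF assms(4), of x] R[OF that] assms(4) by simp
  qed (intro continuous_intros)
  \<comment> \<open>The constant 1 = b \<bullet> b is the derivative of x \<bullet> b in direction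
    b, which prepares integration by parts. The resulting estimate has two roles: it bounds the
    Dirichlet functional from below, and on a slab, with b the thin direction, it gives an
    asymptotically sharp bound on the torsion.\<close>
  have "(LINT x:\<Omega>|lborel. \<phi> x) = (LINT x|lborel. \<phi> x * (b \<bullet> b))"
    using assms(4) by (subst set_lebesgue_integral_support) (auto simp: C1c_eq_0_outside[OF assms(5)])
  also have "\<dots> = - (LINT x|lborel. frechet_derivative \<phi> (at x) b * (x \<bullet> b))"
    by (rule C1c_integration_by_parts(3)[OF assms(5) C1_with_derivative_inner_right])
  also have "\<dots> = - (LINT x:\<Omega>|lborel. grad \<phi> x \<bullet> ((x \<bullet> b) *\<^sub>R b))"
    by (subst set_lebesgue_integral_support)
       (auto simp: C1c_eq_0_outside[OF assms(5)] grad_inner[OF D] mult.commute)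
  finally show ?thesis
    using set_integral_Cauchy_Schwarz[OF C1c_square_integrable(2)[OF assms(1,2,5)] sq] assms(4)
    by (simp add: mult.commute power2_abs)
qed

text \<open>Integration by parts against x \<bullet> b, which is at most R in modulus on \<Omega>,
  leaves a product of \<phi> and its derivative. Young's inequality with weight 1/2 on \<phi>^2 lets
  that half be absorbed on the left, which doubles 2 R^2 to 4 R^2.\<close>

lemma Poincare_inequality:
  fixes \<phi> :: "'a::euclidean_space \<Rightarrow> real"
  assumes "\<Omega> \<in> sets lborel" "emeasure lborel \<Omega> < \<infinity>" "\<And>x. x \<in> \<Omega> \<Longrightarrow> norm x \<le> R" "\<phi> \<in> C1c \<Omega>"
  shows "(LINT x:\<Omega>|lborel. (\<phi> x)\<^sup>2) \<le> 4 * R\<^sup>2 * (LINT x:\<Omega>|lborel. (norm (grad \<phi> x))\<^sup>2)"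
proof -
  note D = C1c_derivative[OF assms(4)]
  note sq = C1c_square_integrable[OF assms(1,2,4)]
  let ?D = "\<lambda>x. frechet_derivative \<phi> (at x)"
  obtain b :: 'a where b: "b \<in> Basis" by (metis nonempty_Basis ex_in_conv)
  have D2: "C1_with_derivative (\<lambda>x. \<phi> x * \<phi> x) (\<lambda>x v. \<phi> x * ?D x v + ?D x v * \<phi> x)"
    by (rule C1_with_derivative_mult[OF D D])
  have C2: "(\<lambda>x. \<phi> x * \<phi> x) \<in> C1c \<Omega>"
    by (rule C1c_mult[OF assms(4) D])
  note parts = C1c_integration_by_parts[OF C2 C1_with_derivative_inner_right, of b b]
  have "(LINT x:\<Omega>|lborel. (\<phi> x)\<^sup>2) = (LINT x|lborel. (\<phi> x * \<phi> x) * (b \<bullet> b))"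
    using b by (subst set_lebesgue_integral_support) (auto simp: C1c_eq_0_outside[OF assms(4)] power2_eq_square)
  also have "\<dots> = - (LINT x|lborel. (\<phi> x * ?D x b + ?D x b * \<phi> x) * (x \<bullet> b))"
    using parts(3) unfolding C1_with_derivativeD(5)[OF D2] .
  also have "\<dots> = (LINT x:\<Omega>|lborel. - ((\<phi> x * ?D x b + ?D x b * \<phi> x) * (x \<bullet> b)))"
    by (subst set_lebesgue_integral_support) (auto simp: C1c_eq_0_outside[OF assms(4)])
  also have "\<dots> \<le> (LINT x:\<Omega>|lborel. (\<phi> x)\<^sup>2 / 2 + 2 * R\<^sup>2 * (norm (grad \<phi> x))\<^sup>2)"
  proof (rule set_integral_mono)
    show "set_integrable lborel \<Omega> (\<lambda>x. - ((\<phi> x * ?D x b + ?D x b * \<phi> x) * (x \<bullet> b)))"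
      using parts(2) unfolding C1_with_derivativeD(5)[OF D2]
      by (subst set_integrable_support) (auto simp: C1c_eq_0_outside[OF assms(4)])
    show "set_integrable lborel \<Omega> (\<lambda>x. (\<phi> x)\<^sup>2 / 2 + 2 * R\<^sup>2 * (norm (grad \<phi> x))\<^sup>2)"
      using square_integrable_on_norm[OF sq(1)] square_integrable_on_norm[OF sq(2)] by auto
    fix x assume x: "x \<in> \<Omega>"
    have "\<bar>?D x b\<bar> \<le> norm (grad \<phi> x)"
      using Basis_le_norm[OF b, of "grad \<phi> x"] by (simp add: grad_inner[OF D])
    moreover have "\<bar>x \<bullet> b\<bar> \<le> R"
      using Basis_le_norm[OF b, of x] assms(3)[OF x] by simp
    ultimately have "\<bar>?D x b * (x \<bullet> b)\<bar> \<le> norm (grad \<phi> x) * R"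
      unfolding abs_mult by (intro mult_mono) auto
    then have "(?D x b * (x \<bullet> b))\<^sup>2 \<le> R\<^sup>2 * (norm (grad \<phi> x))\<^sup>2"
      using power_mono[of "\<bar>?D x b * (x \<bullet> b)\<bar>" "norm (grad \<phi> x) * R" 2]
      by (simp add: power_mult_distrib mult.commute)
    moreover have "0 \<le> (\<phi> x + 2 * (?D x b * (x \<bullet> b)))\<^sup>2" by simp
    ultimately show "- ((\<phi> x * ?D x b + ?D x b * \<phi> x) * (x \<bullet> b)) \<le> (\<phi> x)\<^sup>2 / 2 + 2 * R\<^sup>2 * (norm (grad \<phi> x))\<^sup>2"
      by (simp add: power2_sum field_simps)
  qed
  also have "\<dots> = (LINT x:\<Omega>|lborel. (\<phi> x)\<^sup>2) / 2 + 2 * R\<^sup>2 * (LINT x:\<Omega>|lborel. (norm (grad \<phi> x))\<^sup>2)"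
    using square_integrable_on_norm[OF sq(1)] square_integrable_on_norm[OF sq(2)] by (simp add: set_integral_add)
  finally show ?thesis by simp
qed

text \<open>Direct method for J = E - 2 L without weak compactness: a nearly minimising function
  nearly satisfies the Euler-Lagrange equation, and subtracting two such relations shows that a
  minimising sequence is Cauchy in energy. The Poincare inequality makes it Cauchy in L^2 as well,
  so completeness yields both the limit and its gradient.\<close>

theorem weak_torsion_solution_exists:
  fixes \<Omega> :: "'a::euclidean_space set"
  assumes "open \<Omega>" "bounded \<Omega>"
  shows "\<exists>u. weak_torsion_solution \<Omega> u"
proof -
  have \<Omega>: "\<Omega> \<in> sets lborel" "emeasure lborel \<Omega> < \<infinity>"
    using assms(1) emeasure_bounded_finite[OF assms(2)] by auto
  obtain R where R: "\<And>x. x \<in> \<Omega> \<Longrightarrow> norm x \<le> R"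
    using assms(2) by (auto simp: bounded_iff)
  obtain b :: 'a where b: "b \<in> Basis" by (metis nonempty_Basis ex_in_conv)
  define E where "E \<phi> = (LINT x:\<Omega>|lborel. (norm (grad \<phi> x))\<^sup>2)" for \<phi> :: "'a \<Rightarrow> real"
  define L where "L \<phi> = (LINT x:\<Omega>|lborel. \<phi> x)" for \<phi> :: "'a \<Rightarrow> real"
  define J where "J \<phi> = E \<phi> - 2 * L \<phi>" for \<phi> :: "'a \<Rightarrow> real"
  define Bil where "Bil \<phi> \<psi> = (LINT x:\<Omega>|lborel. grad \<phi> x \<bullet> grad \<psi> x)" for \<phi> \<psi> :: "'a \<Rightarrow> real"
  define C where "C = (LINT x:\<Omega>|lborel. (x \<bullet> b)\<^sup>2)"
  note sq = C1c_square_integrable[OF \<Omega>]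
  have one: "square_integrable_on (\<lambda>x::'a. 1::real) \<Omega>"
    by (rule square_integrable_on_const[OF \<Omega>])
  have int: "set_integrable lborel \<Omega> \<phi>" if "square_integrable_on \<phi> \<Omega>" for \<phi> :: "'a \<Rightarrow> real"
    using square_integrable_on_inner[OF that one] by simp
  have E_nonneg: "0 \<le> E \<phi>" for \<phi>
    unfolding E_def by (rule set_integral_square_nonneg)
  have C_nonneg: "0 \<le> C"
    unfolding C_def using set_integral_square_nonneg[of \<Omega> "\<lambda>x. x \<bullet> b"] by simp
  have L_bound: "(L \<phi>)\<^sup>2 \<le> C * E \<phi>" if "\<phi> \<in> C1c \<Omega>" for \<phi>
    unfolding L_def E_def C_def using C1c_integral_via_coordinate[OF \<Omega> assms(2) b that] .
  have J_bound: "- C \<le> J \<phi>" if "\<phi> \<in> C1c \<Omega>" for \<phi>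
  proof (rule ccontr)
    \<comment> \<open>E + C < 2 L would, with L^2 \<le> C E, force (E + C)^2 < 4 C E, that is, a
      negative square.\<close>
    assume "\<not> - C \<le> J \<phi>"
    then have "E \<phi> + C < 2 * L \<phi>" by (simp add: J_def)
    then have "(E \<phi> + C)\<^sup>2 < (2 * L \<phi>)\<^sup>2"
      using E_nonneg[of \<phi>] C_nonneg by (intro power_strict_mono) auto
    also have "\<dots> \<le> 4 * (C * E \<phi>)" using L_bound[OF that] by (simp add: power_mult_distrib)
    finally have "(E \<phi> - C)\<^sup>2 < 0" by (simp add: power2_eq_square algebra_simps)
    then show False by simp
  qed
  define m where "m = Inf (J ` C1c \<Omega>)"
  have bdd: "bdd_below (J ` C1c \<Omega>)" using J_bound by (auto intro!: bdd_belowI2)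
  have m_le: "m \<le> J \<phi>" if "\<phi> \<in> C1c \<Omega>" for \<phi>
    unfolding m_def using bdd that by (intro cInf_lower) auto
  have zero: "(\<lambda>x. 0) \<in> C1c \<Omega>"
    by (rule C1cI[of _ "\<lambda>_ _. 0" "{}"]) (auto intro: C1_with_derivativeI)
  have "\<exists>\<phi>. \<phi> \<in> C1c \<Omega> \<and> J \<phi> < m + 1 / Suc n" for n
  proof -
    have "Inf (J ` C1c \<Omega>) < m + 1 / Suc n" by (simp add: m_def)
    then show ?thesis using zero bdd by (subst (asm) cInf_less_iff) auto
  qed
  then obtain \<phi> where \<phi>: "\<And>n. \<phi> n \<in> C1c \<Omega>" and J\<phi>: "\<And>n. J (\<phi> n) < m + 1 / Suc n"
    by metis
  have grad_lin: "grad (\<lambda>x. a *\<^sub>R \<phi>1 x + c *\<^sub>R \<phi>2 x) = (\<lambda>x. a *\<^sub>R grad \<phi>1 x + c *\<^sub>R grad \<phi>2 x)"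
    if "\<phi>1 \<in> C1c \<Omega>" "\<phi>2 \<in> C1c \<Omega>" for \<phi>1 \<phi>2 a c
    using grad_lincomb[OF C1c_derivative[OF that(1)] C1c_derivative[OF that(2)]] by auto
  have L_lin: "L (\<lambda>x. a *\<^sub>R \<phi>1 x + c *\<^sub>R \<phi>2 x) = a * L \<phi>1 + c * L \<phi>2"
    if "\<phi>1 \<in> C1c \<Omega>" "\<phi>2 \<in> C1c \<Omega>" for \<phi>1 \<phi>2 a c
    unfolding L_def using int[OF sq(1)[OF that(1)]] int[OF sq(1)[OF that(2)]] by (simp add: set_integral_add)
  \<comment> \<open>The value of J at \<open>\<phi> n + s \<psi>\<close> is at least m, while at
    \<open>\<phi> n\<close> it exceeds m by less than 1 / (n + 1). The expansion in s, with that gap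
    as constant term, is therefore nonnegative for every s.\<close>
  have EL: "(Bil (\<phi> n) \<psi> - L \<psi>)\<^sup>2 \<le> 1 / Suc n * E \<psi>" if \<psi>: "\<psi> \<in> C1c \<Omega>" for n \<psi>
  proof (rule quadratic_nonneg_imp_discriminant)
    fix s :: real
    let ?p = "\<lambda>x. 1 *\<^sub>R \<phi> n x + s *\<^sub>R \<psi> x"
    have "E ?p = E (\<phi> n) + 2 * s * Bil (\<phi> n) \<psi> + s\<^sup>2 * E \<psi>"
      unfolding E_def Bil_def grad_lin[OF \<phi> \<psi>]
      using square_integrable_on_lincomb(2)[OF sq(2)[OF \<phi>[of n]] sq(2)[OF \<psi>], of 1 s] by simp
    then have "J ?p = J (\<phi> n) + 2 * s * (Bil (\<phi> n) \<psi> - L \<psi>) + s\<^sup>2 * E \<psi>"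
      unfolding J_def L_lin[OF \<phi> \<psi>] by (simp add: algebra_simps)
    moreover have "m \<le> J ?p" by (rule m_le[OF C1c_lincomb[OF \<phi> \<psi>]])
    ultimately show "0 \<le> 1 / Suc n + 2 * s * (Bil (\<phi> n) \<psi> - L \<psi>) + s\<^sup>2 * E \<psi>"
      using J\<phi>[of n] by linarith
  qed
  have diff: "(\<lambda>x. \<phi> i x - \<phi> j x) \<in> C1c \<Omega>" "grad (\<lambda>x. \<phi> i x - \<phi> j x) = (\<lambda>x. grad (\<phi> i) x - grad (\<phi> j) x)" for i j
    using C1c_lincomb[OF \<phi>[of i] \<phi>[of j], of 1 "-1"] grad_lin[OF \<phi>[of i] \<phi>[of j], of 1 "-1"] by simp_all
  have E_Cauchy: "E (\<lambda>x. \<phi> i x - \<phi> j x) \<le> 2 / Suc i + 2 / Suc j" for i j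
  proof -
    let ?d = "\<lambda>x. \<phi> i x - \<phi> j x"
    \<comment> \<open>With the difference of the two functions as test function, the linear terms
      cancel in p - q and the energy of the difference remains. This energy is thus bounded by a
      small multiple of its own square root.\<close>
    define p q where "p = Bil (\<phi> i) ?d - L ?d" and "q = Bil (\<phi> j) ?d - L ?d"
    have "p - q = E ?d"
      unfolding p_def q_def Bil_def E_def diff(2)
      using square_integrable_on_inner[OF sq(2)[OF \<phi>[of i]] square_integrable_on_diff[OF sq(2)[OF \<phi>[of i]] sq(2)[OF \<phi>[of j]]]]
        square_integrable_on_inner[OF sq(2)[OF \<phi>[of j]] square_integrable_on_diff[OF sq(2)[OF \<phi>[of i]] sq(2)[OF \<phi>[of j]]]]
      by (simp add: set_integral_diff(2)[symmetric] inner_diff_left[symmetric] power2_norm_eq_inner)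
    moreover have "(p - q)\<^sup>2 \<le> 2 * p\<^sup>2 + 2 * q\<^sup>2"
      using zero_le_power2[of "p + q"] by (simp add: power2_eq_square algebra_simps)
    moreover have "p\<^sup>2 \<le> 1 / Suc i * E ?d" "q\<^sup>2 \<le> 1 / Suc j * E ?d"
      unfolding p_def q_def using EL[OF diff(1)] by blast+
    ultimately have "E ?d * E ?d \<le> 2 * (1 / Suc i * E ?d) + 2 * (1 / Suc j * E ?d)"
      by (simp add: power2_eq_square)
    then have "E ?d * E ?d \<le> (2 / Suc i + 2 / Suc j) * E ?d"
      by (simp add: algebra_simps)
    then show ?thesis
      using E_nonneg[of ?d] by (cases "E ?d = 0") (auto simp: mult_le_cancel_right)
  qed
  have small: "\<exists>M. \<forall>i\<ge>M. \<forall>j\<ge>M. K * E (\<lambda>x. \<phi> i x - \<phi> j x) < e" if "e > 0" "K \<ge> 0" for e K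
  proof -
    have "0 < e / (4 * (K + 1))" using that by simp
    then obtain M where M: "inverse (real (Suc M)) < e / (4 * (K + 1))"
      using reals_Archimedean by blast
    have "K * E (\<lambda>x. \<phi> i x - \<phi> j x) < e" if "i \<ge> M" "j \<ge> M" for i j
    proof -
      have "1 / Suc i \<le> inverse (real (Suc M))" "1 / Suc j \<le> inverse (real (Suc M))"
        using that by (simp_all add: inverse_eq_divide frac_le)
      then have "E (\<lambda>x. \<phi> i x - \<phi> j x) \<le> 4 * inverse (real (Suc M))"
        using E_Cauchy[of i j] by simp
      also have "\<dots> < e / (K + 1)" using M \<open>K \<ge> 0\<close> by (simp add: field_simps)
      finally have "(K + 1) * E (\<lambda>x. \<phi> i x - \<phi> j x) < e"
        using \<open>K \<ge> 0\<close> by (simp add: field_simps)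
      then show ?thesis using E_nonneg[of "\<lambda>x. \<phi> i x - \<phi> j x"] by (simp add: algebra_simps)
    qed
    then show ?thesis by blast
  qed
  obtain g where g: "square_integrable_on g \<Omega>"
    "(\<lambda>n. LINT x:\<Omega>|lborel. (norm (g x - grad (\<phi> n) x))\<^sup>2) \<longlonglongrightarrow> 0"
  proof (rule L2_complete[OF \<Omega> sq(2)[OF \<phi>]])
    show "\<exists>M. \<forall>i\<ge>M. \<forall>j\<ge>M. (LINT x:\<Omega>|lborel. (norm (grad (\<phi> i) x - grad (\<phi> j) x))\<^sup>2) < e" if "e > 0" for e
      using small[OF that, of 1] by (simp add: E_def diff(2))
  qed blast
  obtain u where u: "square_integrable_on u \<Omega>"
    "(\<lambda>n. LINT x:\<Omega>|lborel. (norm (u x - \<phi> n x))\<^sup>2) \<longlonglongrightarrow> 0"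
  proof (rule L2_complete[OF \<Omega> sq(1)[OF \<phi>]])
    show "\<exists>M. \<forall>i\<ge>M. \<forall>j\<ge>M. (LINT x:\<Omega>|lborel. (norm (\<phi> i x - \<phi> j x))\<^sup>2) < e" if "e > 0" for e
    proof -
      have "(LINT x:\<Omega>|lborel. (norm (\<phi> i x - \<phi> j x))\<^sup>2) \<le> 4 * R\<^sup>2 * E (\<lambda>x. \<phi> i x - \<phi> j x)" for i j
        using Poincare_inequality[OF \<Omega> R diff(1)[of i j]] by (simp add: E_def)
      then show ?thesis using small[OF that, of "4 * R\<^sup>2"] by (meson le_less_trans zero_le_mult_iff zero_le_numeral zero_le_power2)
    qed
  qed blast
  have grad: "H1_gradient \<Omega> u g"
  proof (rule H1_gradientI[OF u(1) g(1) \<Omega>])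
    fix \<psi> :: "'a \<Rightarrow> real" and c assume \<psi>: "\<psi> \<in> C1c \<Omega>"
    obtain B where B: "\<And>x. norm (grad \<psi> x) \<le> B" using C1c_grad_bounded[OF \<psi>] by metis
    obtain B' where B': "\<And>x. norm (\<psi> x) \<le> B'" using C1c_bounded[OF \<psi>] by metis
    have 1: "square_integrable_on (\<lambda>x. grad \<psi> x \<bullet> c) \<Omega>"
    proof (rule square_integrable_on_bounded_continuous[OF \<Omega>])
      show "continuous_on UNIV (\<lambda>x. grad \<psi> x \<bullet> c)"
        by (intro continuous_intros grad_continuous[OF C1c_derivative[OF \<psi>]])
      show "norm (grad \<psi> x \<bullet> c) \<le> B * norm c" for x
        using Cauchy_Schwarz_ineq2[of "grad \<psi> x" c] mult_right_mono[OF B[of x], of "norm c"] by simp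
    qed
    have 2: "square_integrable_on (\<lambda>x. \<psi> x *\<^sub>R c) \<Omega>"
    proof (rule square_integrable_on_bounded_continuous[OF \<Omega>])
      show "continuous_on UNIV (\<lambda>x. \<psi> x *\<^sub>R c)"
        by (intro continuous_intros C1_with_derivativeD(3)[OF C1c_derivative[OF \<psi>]])
      show "norm (\<psi> x *\<^sub>R c) \<le> B' * norm c" for x
        using mult_right_mono[OF B'[of x], of "norm c"] by simp
    qed
    have "(\<lambda>n. LINT x:\<Omega>|lborel. \<phi> n x * (grad \<psi> x \<bullet> c)) \<longlonglongrightarrow> (LINT x:\<Omega>|lborel. u x * (grad \<psi> x \<bullet> c))"
      using L2_tendsto_inner[OF u(1) 1 sq(1)[OF \<phi>] u(2)] by simp
    moreover have "(LINT x:\<Omega>|lborel. \<phi> n x * (grad \<psi> x \<bullet> c)) = - (LINT x:\<Omega>|lborel. grad (\<phi> n) x \<bullet> (\<psi> x *\<^sub>R c))" for n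
      using H1_gradient_test[OF C1c_H1_gradient[OF \<phi> \<Omega>] \<psi> \<Omega>] by simp
    moreover have "(\<lambda>n. - (LINT x:\<Omega>|lborel. grad (\<phi> n) x \<bullet> (\<psi> x *\<^sub>R c))) \<longlonglongrightarrow>
        - (LINT x:\<Omega>|lborel. g x \<bullet> (\<psi> x *\<^sub>R c))"
      by (intro tendsto_minus L2_tendsto_inner[OF g(1) 2 sq(2)[OF \<phi>] g(2)])
    ultimately show "(LINT x:\<Omega>|lborel. u x * (grad \<psi> x \<bullet> c)) = - (LINT x:\<Omega>|lborel. \<psi> x * (g x \<bullet> c))"
      using LIMSEQ_unique by fastforce
  qed
  have "u \<in> H10 \<Omega>"
  proof -
    have "(LINT x:\<Omega>|lborel. (u x - \<phi> n x)\<^sup>2 + (norm (g x - grad (\<phi> n) x))\<^sup>2) =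
      (LINT x:\<Omega>|lborel. (norm (u x - \<phi> n x))\<^sup>2) + (LINT x:\<Omega>|lborel. (norm (g x - grad (\<phi> n) x))\<^sup>2)" for n
      using square_integrable_on_norm[OF square_integrable_on_diff[OF u(1) sq(1)[OF \<phi>[of n]]]]
        square_integrable_on_norm[OF square_integrable_on_diff[OF g(1) sq(2)[OF \<phi>[of n]]]]
      by (subst set_integral_add(2)[symmetric]) auto
    then have "(\<lambda>n. LINT x:\<Omega>|lborel. (u x - \<phi> n x)\<^sup>2 + (norm (g x - grad (\<phi> n) x))\<^sup>2) \<longlonglongrightarrow> 0"
      using tendsto_add[OF u(2) g(2)] by simp
    then show ?thesis
      unfolding H10_def using grad \<phi> by blast
  qed
  moreover have "(LINT x:\<Omega>|lborel. g x \<bullet> h x) = (LINT x:\<Omega>|lborel. v x)"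
    if v: "v \<in> H10 \<Omega>" and h: "H1_gradient \<Omega> v h" for v h
  proof -
    \<comment> \<open>\<open>g'\<close> is the gradient that comes with an approximation by test
      functions, whereas h is an arbitrary weak gradient of v. The equation is proved for
      \<open>g'\<close> by density and carried over to h by pairing both with the gradients of
      \<open>\<phi> n\<close>.\<close>
    obtain g' \<psi> where g': "H1_gradient \<Omega> v g'" and \<psi>: "\<And>n. \<psi> n \<in> C1c \<Omega>"
      and lim: "(\<lambda>n. LINT x:\<Omega>|lborel. (norm (v x - \<psi> n x))\<^sup>2) \<longlonglongrightarrow> 0"
      "(\<lambda>n. LINT x:\<Omega>|lborel. (norm (g' x - grad (\<psi> n) x))\<^sup>2) \<longlonglongrightarrow> 0"
      using H10E[OF v \<Omega>] by blast
    have sq': "square_integrable_on v \<Omega>" "square_integrable_on g' \<Omega>" "square_integrable_on h \<Omega>"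
      using g' h by (auto simp: H1_gradient_def)
    have test: "(LINT x:\<Omega>|lborel. g x \<bullet> grad \<psi> x) = L \<psi>" if "\<psi> \<in> C1c \<Omega>" for \<psi>
    proof -
      have "(\<lambda>n. 1 / real (Suc n) * E \<psi>) \<longlonglongrightarrow> 0 * E \<psi>"
        using LIMSEQ_inverse_real_of_nat by (intro tendsto_mult tendsto_const) (simp add: inverse_eq_divide)
      then have "(\<lambda>n. Bil (\<phi> n) \<psi> - L \<psi>) \<longlonglongrightarrow> 0"
        by (intro tendsto_zero_of_square[OF EL[OF that]]) simp
      then have "(\<lambda>n. Bil (\<phi> n) \<psi>) \<longlonglongrightarrow> L \<psi>" by (simp add: LIM_zero_iff)
      moreover have "(\<lambda>n. Bil (\<phi> n) \<psi>) \<longlonglongrightarrow> (LINT x:\<Omega>|lborel. g x \<bullet> grad \<psi> x)"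
        unfolding Bil_def by (rule L2_tendsto_inner[OF g(1) sq(2)[OF that] sq(2)[OF \<phi>] g(2)])
      ultimately show ?thesis using LIMSEQ_unique by blast
    qed
    have "(\<lambda>n. LINT x:\<Omega>|lborel. grad (\<psi> n) x \<bullet> g x) \<longlonglongrightarrow> (LINT x:\<Omega>|lborel. g' x \<bullet> g x)"
      by (rule L2_tendsto_inner[OF sq'(2) g(1) sq(2)[OF \<psi>] lim(2)])
    moreover have "(LINT x:\<Omega>|lborel. grad (\<psi> n) x \<bullet> g x) = (LINT x:\<Omega>|lborel. \<psi> n x \<bullet> 1)" for n
      using test[OF \<psi>[of n]] by (simp add: inner_commute L_def)
    moreover have "(\<lambda>n. LINT x:\<Omega>|lborel. \<psi> n x \<bullet> 1) \<longlonglongrightarrow> (LINT x:\<Omega>|lborel. v x \<bullet> 1)"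
      by (rule L2_tendsto_inner[OF sq'(1) one sq(1)[OF \<psi>] lim(1)])
    ultimately have *: "(LINT x:\<Omega>|lborel. g' x \<bullet> g x) = (LINT x:\<Omega>|lborel. v x)"
      using LIMSEQ_unique by fastforce
    have "(\<lambda>n. LINT x:\<Omega>|lborel. grad (\<phi> n) x \<bullet> h x) \<longlonglongrightarrow> (LINT x:\<Omega>|lborel. g x \<bullet> h x)"
      by (rule L2_tendsto_inner[OF g(1) sq'(3) sq(2)[OF \<phi>] g(2)])
    moreover have "(\<lambda>n. LINT x:\<Omega>|lborel. grad (\<phi> n) x \<bullet> g' x) \<longlonglongrightarrow> (LINT x:\<Omega>|lborel. g x \<bullet> g' x)"
      by (rule L2_tendsto_inner[OF g(1) sq'(2) sq(2)[OF \<phi>] g(2)])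
    moreover have "(LINT x:\<Omega>|lborel. grad (\<phi> n) x \<bullet> h x) = (LINT x:\<Omega>|lborel. grad (\<phi> n) x \<bullet> g' x)" for n
      by (rule H1_gradient_unique_weak[OF assms(1) \<Omega>(2) h g' \<phi>])
    ultimately have "(LINT x:\<Omega>|lborel. g x \<bullet> h x) = (LINT x:\<Omega>|lborel. g x \<bullet> g' x)"
      using LIMSEQ_unique by fastforce
    with * show ?thesis by (simp add: inner_commute)
  qed
  ultimately show ?thesis
    using grad unfolding weak_torsion_solution_def by blast
qed

text \<open>Whatever \<open>SOME\<close> picks, only its weak equation enters, and that pins T down
  as the supremum of (integral of \<phi>)^2 / (integral of |grad \<phi>|^2). The supremum is split
  into the two inequalities applied later: one test function bounds T from below, an estimate for
  all of them bounds it from above.\<close>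

lemma torsional_rigidity_bounds:
  fixes \<Omega> :: "'a::euclidean_space set"
  assumes "open \<Omega>" "bounded \<Omega>"
  shows "\<phi> \<in> C1c \<Omega> \<Longrightarrow> (LINT x:\<Omega>|lborel. \<phi> x)\<^sup>2 \<le>
      torsional_rigidity \<Omega> * (LINT x:\<Omega>|lborel. (norm (grad \<phi> x))\<^sup>2)"
    and "(\<And>\<phi>. \<phi> \<in> C1c \<Omega> \<Longrightarrow> (LINT x:\<Omega>|lborel. \<phi> x)\<^sup>2 \<le> K * (LINT x:\<Omega>|lborel. (norm (grad \<phi> x))\<^sup>2))
      \<Longrightarrow> 0 \<le> K \<Longrightarrow> torsional_rigidity \<Omega> \<le> K"
    and "0 \<le> torsional_rigidity \<Omega>"
proof -
  have \<Omega>: "\<Omega> \<in> sets lborel" "emeasure lborel \<Omega> < \<infinity>"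
    using assms(1) emeasure_bounded_finite[OF assms(2)] by auto
  note sq = C1c_square_integrable[OF \<Omega>]
  have one: "square_integrable_on (\<lambda>x::'a. 1::real) \<Omega>"
    by (rule square_integrable_on_const[OF \<Omega>])
  define u where "u = (SOME u. weak_torsion_solution \<Omega> u)"
  define T where "T = torsional_rigidity \<Omega>"
  have T: "T = (LINT x:\<Omega>|lborel. u x)" by (simp add: T_def torsional_rigidity_def u_def)
  have "weak_torsion_solution \<Omega> u"
    unfolding u_def by (rule someI_ex[OF weak_torsion_solution_exists[OF assms]])
  then obtain g where u: "u \<in> H10 \<Omega>" and g: "H1_gradient \<Omega> u g"
    and eq: "\<And>v h. v \<in> H10 \<Omega> \<Longrightarrow> H1_gradient \<Omega> v h \<Longrightarrow> (LINT x:\<Omega>|lborel. g x \<bullet> h x) = (LINT x:\<Omega>|lborel. v x)"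
    unfolding weak_torsion_solution_def by blast
  have sqg: "square_integrable_on u \<Omega>" "square_integrable_on g \<Omega>"
    using g by (auto simp: H1_gradient_def)
  have T_eq: "T = (LINT x:\<Omega>|lborel. (norm (g x))\<^sup>2)"
    using eq[OF u g] by (simp add: T power2_norm_eq_inner)
  show "0 \<le> torsional_rigidity \<Omega>"
    using T_eq set_integral_square_nonneg[of \<Omega> g] by (simp add: T_def)
  show "(LINT x:\<Omega>|lborel. \<phi> x)\<^sup>2 \<le> torsional_rigidity \<Omega> * (LINT x:\<Omega>|lborel. (norm (grad \<phi> x))\<^sup>2)"
    if "\<phi> \<in> C1c \<Omega>"
    using eq[OF C1c_subset_H10[OF that \<Omega>] C1c_H1_gradient[OF that \<Omega>]]
      set_integral_Cauchy_Schwarz[OF sqg(2) sq(2)[OF that]]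
    by (simp add: T_eq[symmetric] T_def)
  show "torsional_rigidity \<Omega> \<le> K"
    if K: "\<And>\<phi>. \<phi> \<in> C1c \<Omega> \<Longrightarrow> (LINT x:\<Omega>|lborel. \<phi> x)\<^sup>2 \<le> K * (LINT x:\<Omega>|lborel. (norm (grad \<phi> x))\<^sup>2)" "0 \<le> K"
  proof -
    obtain g' \<phi> where g': "H1_gradient \<Omega> u g'" and \<phi>: "\<And>n. \<phi> n \<in> C1c \<Omega>"
      and lim: "(\<lambda>n. LINT x:\<Omega>|lborel. (norm (u x - \<phi> n x))\<^sup>2) \<longlonglongrightarrow> 0"
      "(\<lambda>n. LINT x:\<Omega>|lborel. (norm (g' x - grad (\<phi> n) x))\<^sup>2) \<longlonglongrightarrow> 0"
      using H10E[OF u \<Omega>] by blast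
    have sq': "square_integrable_on g' \<Omega>" using g' by (auto simp: H1_gradient_def)
    have "(\<lambda>n. LINT x:\<Omega>|lborel. \<phi> n x) \<longlonglongrightarrow> T"
      using L2_tendsto_inner[OF sqg(1) one sq(1)[OF \<phi>] lim(1)] by (simp add: T)
    then have 1: "(\<lambda>n. (LINT x:\<Omega>|lborel. \<phi> n x)\<^sup>2) \<longlonglongrightarrow> T\<^sup>2" by (rule tendsto_power)
    have "(\<lambda>n. LINT x:\<Omega>|lborel. grad (\<phi> n) x \<bullet> g x) \<longlonglongrightarrow> (LINT x:\<Omega>|lborel. g' x \<bullet> g x)"
      by (rule L2_tendsto_inner[OF sq' sqg(2) sq(2)[OF \<phi>] lim(2)])
    moreover have "(\<lambda>n. LINT x:\<Omega>|lborel. grad (\<phi> n) x \<bullet> g' x) \<longlonglongrightarrow> (LINT x:\<Omega>|lborel. g' x \<bullet> g' x)"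
      by (rule L2_tendsto_inner[OF sq' sq' sq(2)[OF \<phi>] lim(2)])
    moreover have "(LINT x:\<Omega>|lborel. grad (\<phi> n) x \<bullet> g x) = (LINT x:\<Omega>|lborel. grad (\<phi> n) x \<bullet> g' x)" for n
      by (rule H1_gradient_unique_weak[OF assms(1) \<Omega>(2) g g' \<phi>])
    \<comment> \<open>The energies of the approximants converge to that of \<open>g'\<close>, so it
      is the energy of \<open>g'\<close> rather than of g that must be identified with T.\<close>
    ultimately have "(LINT x:\<Omega>|lborel. g' x \<bullet> g' x) = (LINT x:\<Omega>|lborel. g' x \<bullet> g x)"
      using LIMSEQ_unique by fastforce
    also have "\<dots> = T" using eq[OF u g'] by (simp add: inner_commute T)
    finally have "(LINT x:\<Omega>|lborel. (norm (g' x))\<^sup>2) = T" by (simp add: power2_norm_eq_inner)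
    then have "(\<lambda>n. K * (LINT x:\<Omega>|lborel. (norm (grad (\<phi> n) x))\<^sup>2)) \<longlonglongrightarrow> K * T"
      using L2_tendsto_norm[OF sq' sq(2)[OF \<phi>] lim(2)] by (intro tendsto_mult_left) simp
    from LIMSEQ_le[OF 1 this] have "T\<^sup>2 \<le> K * T" using K(1)[OF \<phi>] by blast
    moreover have "0 \<le> T" unfolding T_eq by (rule set_integral_square_nonneg)
    ultimately have "T \<le> K" using K(2) by (cases "T = 0") (auto simp: power2_eq_square)
    then show ?thesis by (simp add: T_def)
  qed
qed

section \<open>The perimeter and soft minima of affine functions\<close>

lemma C1_with_derivative_sum:
  assumes "finite I" "\<And>i. i \<in> I \<Longrightarrow> C1_with_derivative (f i) (D i)"
  shows "C1_with_derivative (\<lambda>x. \<Sum>i\<in>I. f i x) (\<lambda>x v. \<Sum>i\<in>I. D i x v)"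
  using assms unfolding C1_with_derivative_def
  by (auto intro!: has_derivative_sum continuous_on_sum)

definition softmin_weight :: "real \<Rightarrow> ('a::euclidean_space \<times> real) \<Rightarrow> 'a \<Rightarrow> real" where
  "softmin_weight \<beta> p x = exp (- \<beta> * (x \<bullet> fst p - snd p))"

definition softmin_sum :: "('a::euclidean_space \<times> real) set \<Rightarrow> real \<Rightarrow> 'a \<Rightarrow> real" where
  "softmin_sum I \<beta> x = (\<Sum>p\<in>I. softmin_weight \<beta> p x)"

text \<open>A smooth concave approximation, from above, of the minimum of the affine functions
  \<open>x \<mapsto> x \<bullet> \<nu> - c\<close> with \<open>(\<nu>, c) \<in> I\<close>.\<close>

definition softmin :: "('a::euclidean_space \<times> real) set \<Rightarrow> real \<Rightarrow> 'a \<Rightarrow> real" where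
  "softmin I \<beta> x = (ln (card I) - ln (softmin_sum I \<beta> x)) / \<beta>"

text \<open>The Gibbs average of the normals, which turns out to be the gradient of
  \<open>softmin\<close>.\<close>

definition softmin_grad :: "('a::euclidean_space \<times> real) set \<Rightarrow> real \<Rightarrow> 'a \<Rightarrow> 'a" where
  "softmin_grad I \<beta> x = inverse (softmin_sum I \<beta> x) *\<^sub>R (\<Sum>p\<in>I. softmin_weight \<beta> p x *\<^sub>R fst p)"

locale unit_normals =
  fixes I :: "('a::euclidean_space \<times> real) set" and \<beta> :: real
  assumes finite_I: "finite I" and nonempty: "I \<noteq> {}" and unit: "\<And>p. p \<in> I \<Longrightarrow> norm (fst p) = 1"
    and beta_pos: "\<beta> > 0"
begin

lemma softmin_weight_pos: "0 < softmin_weight \<beta> p x"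
  by (simp add: softmin_weight_def)

lemma softmin_sum_pos: "0 < softmin_sum I \<beta> x"
  unfolding softmin_sum_def using finite_I nonempty by (intro sum_pos softmin_weight_pos)

text \<open>The summand \<open>ln (card I)\<close> in the numerator is what puts the soft minimum
  above the true one. It will be nonnegative on \<Omega>, so a cutoff acting only at negative values
  leaves everything on \<Omega> untouched.\<close>

lemma softmin_ge:
  assumes "\<And>p. p \<in> I \<Longrightarrow> t \<le> x \<bullet> fst p - snd p"
  shows "t \<le> softmin I \<beta> x"
proof -
  have "softmin_sum I \<beta> x \<le> (\<Sum>p\<in>I. exp (- \<beta> * t))"
    unfolding softmin_sum_def softmin_weight_def
    using assms beta_pos by (intro sum_mono) simp
  also have "\<dots> = card I * exp (- \<beta> * t)" by simp
  finally have "ln (softmin_sum I \<beta> x) \<le> ln (card I * exp (- \<beta> * t))"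
    using softmin_sum_pos by (intro ln_mono) auto
  also have "\<dots> = ln (card I) - \<beta> * t"
    using finite_I nonempty by (subst ln_mult) (auto simp: card_gt_0_iff)
  finally show ?thesis
    using beta_pos by (simp add: softmin_def pos_le_divide_eq mult.commute)
qed

text \<open>The price of lying above the minimum is an excess of ln (card I) / \<beta>, which a
  large \<beta> makes negligible. This confines the superlevel sets of the soft minimum to slightly
  enlarged polytopes and so provides compact supports.\<close>

lemma softmin_le:
  assumes "p \<in> I"
  shows "softmin I \<beta> x \<le> x \<bullet> fst p - snd p + ln (card I) / \<beta>"
proof -
  have "exp (- \<beta> * (x \<bullet> fst p - snd p)) \<le> softmin_sum I \<beta> x"
    unfolding softmin_sum_def softmin_weight_def[symmetric]
    using assms finite_I softmin_weight_pos by (intro member_le_sum) (auto intro: less_imp_le)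
  then have "- \<beta> * (x \<bullet> fst p - snd p) \<le> ln (softmin_sum I \<beta> x)"
    using softmin_sum_pos by (simp add: ln_ge_iff)
  then have "(ln (card I) - ln (softmin_sum I \<beta> x)) / \<beta> \<le> (\<beta> * (x \<bullet> fst p - snd p) + ln (card I)) / \<beta>"
    using beta_pos by (intro divide_right_mono) auto
  then show ?thesis
    using beta_pos by (simp add: softmin_def add_divide_distrib)
qed

lemma softmin_weight_C1:
  "C1_with_derivative (softmin_weight \<beta> p) (\<lambda>x v. - \<beta> * softmin_weight \<beta> p x * (v \<bullet> fst p))"
proof -
  have "C1_with_derivative (\<lambda>x. exp (- \<beta> * (x \<bullet> fst p - snd p)))
     (\<lambda>x v. (- \<beta> * exp (- \<beta> * (x \<bullet> fst p - snd p))) * (v \<bullet> fst p))"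
    by (rule C1_with_derivative_compose[OF C1_with_derivative_inner_right])
       (auto intro!: derivative_eq_intros continuous_intros)
  then show ?thesis by (simp add: softmin_weight_def[abs_def])
qed

lemma weighted_inner:
  "(\<Sum>p\<in>I. - \<beta> * softmin_weight \<beta> p x * (v \<bullet> fst p)) =
     - \<beta> * (softmin_sum I \<beta> x * (softmin_grad I \<beta> x \<bullet> v))"
proof -
  have "softmin_sum I \<beta> x * (softmin_grad I \<beta> x \<bullet> v) = (\<Sum>p\<in>I. softmin_weight \<beta> p x * (fst p \<bullet> v))"
    using softmin_sum_pos[of x] by (simp add: softmin_grad_def inner_sum_left)
  then show ?thesis by (simp add: sum_distrib_left sum_negf inner_commute mult_ac)
qed

lemma softmin_sum_C1:
  "C1_with_derivative (softmin_sum I \<beta>)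
     (\<lambda>x v. - \<beta> * (softmin_sum I \<beta> x * (softmin_grad I \<beta> x \<bullet> v)))"
  using C1_with_derivative_sum[OF finite_I, of "softmin_weight \<beta>", OF softmin_weight_C1]
  unfolding weighted_inner by (simp only: softmin_sum_def[abs_def])

lemma inverse_softmin_sum_C1:
  "C1_with_derivative (\<lambda>x. inverse (softmin_sum I \<beta> x))
     (\<lambda>x v. \<beta> * (inverse (softmin_sum I \<beta> x) * (softmin_grad I \<beta> x \<bullet> v)))"
proof (rule C1_with_derivativeI)
  show "((\<lambda>x. inverse (softmin_sum I \<beta> x)) has_derivative
      (\<lambda>v. \<beta> * (inverse (softmin_sum I \<beta> x) * (softmin_grad I \<beta> x \<bullet> v)))) (at x)" for x
    using softmin_sum_pos[of x]
    by (auto intro!: derivative_eq_intros C1_with_derivativeD(1)[OF softmin_sum_C1] simp: field_simps)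
  show "continuous_on UNIV (\<lambda>x. \<beta> * (inverse (softmin_sum I \<beta> x) * (softmin_grad I \<beta> x \<bullet> v)))" for v
    unfolding softmin_grad_def
    using softmin_sum_pos
    by (intro continuous_intros C1_with_derivativeD(3)[OF softmin_sum_C1]
        C1_with_derivativeD(3)[OF softmin_weight_C1]) (metis less_irrefl)+
qed

lemma softmin_C1: "C1_with_derivative (softmin I \<beta>) (\<lambda>x v. softmin_grad I \<beta> x \<bullet> v)"
proof (rule C1_with_derivativeI)
  show "(softmin I \<beta> has_derivative (\<lambda>v. softmin_grad I \<beta> x \<bullet> v)) (at x)" for x
    unfolding softmin_def[abs_def] using softmin_sum_pos[of x] beta_pos
    by (auto intro!: derivative_eq_intros C1_with_derivativeD(1)[OF softmin_sum_C1] simp: field_simps)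
  show "continuous_on UNIV (\<lambda>x. softmin_grad I \<beta> x \<bullet> v)" for v
    unfolding softmin_grad_def
    using softmin_sum_pos
    by (intro continuous_intros C1_with_derivativeD(3)[OF softmin_sum_C1]
        C1_with_derivativeD(3)[OF softmin_weight_C1]) (metis less_irrefl)+
qed

text \<open>A convex combination of unit vectors. This meets the constraint on the fields in the
  perimeter and makes the Laplacian of the soft minimum nonpositive.\<close>

lemma norm_softmin_grad: "norm (softmin_grad I \<beta> x) \<le> 1"
proof -
  have "norm (\<Sum>p\<in>I. softmin_weight \<beta> p x *\<^sub>R fst p) \<le> (\<Sum>p\<in>I. softmin_weight \<beta> p x)"
    using unit softmin_weight_pos[THEN less_imp_le] by (intro sum_norm_le) simp
  then have "norm (softmin_grad I \<beta> x) \<le> inverse (softmin_sum I \<beta> x) * softmin_sum I \<beta> x"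
    using softmin_sum_pos[of x]
    by (simp add: softmin_grad_def softmin_sum_def[symmetric] divide_le_eq_1 field_simps)
  then show ?thesis using softmin_sum_pos[of x] by simp
qed

text \<open>Since the normals are unit vectors, the Laplacian of the soft minimum is
  \<open>- \<beta> (1 - |\<nabla>w|\<^sup>2)\<close>.\<close>

lemma softmin_laplacian:
  obtains D where "C1_with_derivative (softmin_grad I \<beta>) D"
    "\<And>x. (\<Sum>b\<in>Basis. D x b \<bullet> b) = - \<beta> * (1 - (norm (softmin_grad I \<beta> x))\<^sup>2)"
proof -
  let ?S = "softmin_sum I \<beta>" and ?G = "softmin_grad I \<beta>" and ?e = "softmin_weight \<beta>"
  let ?M = "\<lambda>x. \<Sum>p\<in>I. ?e p x *\<^sub>R fst p"
  let ?DM = "\<lambda>x v. \<Sum>p\<in>I. (- \<beta> * ?e p x * (v \<bullet> fst p)) *\<^sub>R fst p"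
  let ?D = "\<lambda>x v. inverse (?S x) *\<^sub>R ?DM x v + (\<beta> * (inverse (?S x) * (?G x \<bullet> v))) *\<^sub>R ?M x"
  have "C1_with_derivative (\<lambda>x. ?e p x *\<^sub>R fst p) (\<lambda>x v. (- \<beta> * ?e p x * (v \<bullet> fst p)) *\<^sub>R fst p)" for p
    using C1_with_derivative_scaleR[OF softmin_weight_C1, of "\<lambda>_. fst p" "\<lambda>_ _. 0" p]
    by (simp add: C1_with_derivative_def)
  then have M: "C1_with_derivative ?M ?DM"
    by (intro C1_with_derivative_sum finite_I)
  have "C1_with_derivative ?G ?D"
    unfolding softmin_grad_def[abs_def]
    by (rule C1_with_derivative_scaleR[OF inverse_softmin_sum_C1[unfolded softmin_grad_def[abs_def]] M])
  moreover have "(\<Sum>b\<in>Basis. ?D x b \<bullet> b) = - \<beta> * (1 - (norm (?G x))\<^sup>2)" for x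
  proof -
    have M_eq: "?M x = ?S x *\<^sub>R ?G x" using softmin_sum_pos[of x] by (simp add: softmin_grad_def)
    have "(\<Sum>b\<in>Basis. ?DM x b \<bullet> b) = (\<Sum>b\<in>Basis. \<Sum>p\<in>I. - \<beta> * ?e p x * ((fst p \<bullet> b) * (fst p \<bullet> b)))"
      by (simp add: inner_sum_left inner_sum_right inner_commute mult_ac)
    also have "\<dots> = (\<Sum>p\<in>I. - \<beta> * ?e p x * (\<Sum>b\<in>Basis. (fst p \<bullet> b) * (fst p \<bullet> b)))"
      by (subst sum.swap) (simp add: sum_distrib_left)
    also have "\<dots> = (\<Sum>p\<in>I. - \<beta> * ?e p x)"
      using unit by (intro sum.cong refl) (simp add: euclidean_inner[symmetric] norm_eq_1)
    also have "\<dots> = - \<beta> * ?S x" by (simp add: softmin_sum_def sum_distrib_left sum_negf)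
    finally have 1: "(\<Sum>b\<in>Basis. ?DM x b \<bullet> b) = - \<beta> * ?S x" .
    have "?D x b \<bullet> b = inverse (?S x) * (?DM x b \<bullet> b) + \<beta> * ((?G x \<bullet> b) * (?G x \<bullet> b))" for b
      unfolding M_eq inner_add_left inner_scaleR_left using softmin_sum_pos[of x] by simp
    then have "(\<Sum>b\<in>Basis. ?D x b \<bullet> b) =
        inverse (?S x) * (\<Sum>b\<in>Basis. ?DM x b \<bullet> b) + \<beta> * (\<Sum>b\<in>Basis. (?G x \<bullet> b) * (?G x \<bullet> b))"
      by (simp only: sum.distrib sum_distrib_left)
    then show ?thesis
      unfolding 1 using softmin_sum_pos[of x]
      by (simp add: euclidean_inner[symmetric] power2_norm_eq_inner algebra_simps)
  qed
  ultimately show ?thesis by (rule that)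
qed

end

section \<open>C^1 cutoffs and fields for testing the perimeter\<close>

lemma DERIV_max_zero_square: "((\<lambda>t. (max 0 t)\<^sup>2) has_real_derivative 2 * max 0 t) (at t)" for t :: real
proof -
  consider "t > 0" | "t < 0" | "t = 0" by linarith
  then show ?thesis
  proof cases
    case 1
    have "((\<lambda>t. t\<^sup>2) has_real_derivative 2 * t) (at t)" by (auto intro!: derivative_eq_intros)
    then have "((\<lambda>t. (max 0 t)\<^sup>2) has_real_derivative 2 * t) (at t)"
      by (rule has_field_derivative_transform_within_open[of _ _ _ "{0<..}"]) (use 1 in auto)
    then show ?thesis using 1 by simp
  next
    case 2
    have "((\<lambda>t. 0) has_real_derivative 0) (at t)" by simp
    then have "((\<lambda>t. (max 0 t)\<^sup>2) has_real_derivative 0) (at t)"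
      by (rule has_field_derivative_transform_within_open[of _ _ _ "{..<0}"]) (use 2 in auto)
    then show ?thesis using 2 by simp
  next
    case 3
    have "((\<lambda>h. (max 0 h)\<^sup>2 / h) \<longlongrightarrow> 0) (at (0::real))"
    proof (rule Lim_null_comparison)
      show "\<forall>\<^sub>F h in at 0. norm ((max 0 h)\<^sup>2 / h) \<le> \<bar>h\<bar>" for h :: real
        by (auto simp: max_def power2_eq_square intro!: always_eventually)
      show "((\<lambda>h. \<bar>h\<bar>) \<longlongrightarrow> 0) (at (0::real))"
        by (auto intro!: tendsto_eq_intros)
    qed
    then show ?thesis using 3 by (simp add: DERIV_def)
  qed
qed

lemma C1_cutoff_function:
  fixes \<sigma> :: real
  assumes "\<sigma> > 0"
  obtains c c' where "\<And>t. (c has_real_derivative c' t) (at t)" "continuous_on UNIV c'"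
    "\<And>t. 0 \<le> c t" "\<And>t. c t \<le> 1" "\<And>t. t \<le> - \<sigma> \<Longrightarrow> c t = 0" "\<And>t. t \<ge> 0 \<Longrightarrow> c t = 1" "\<And>t. t \<ge> 0 \<Longrightarrow> c' t = 0"
proof
  \<comment> \<open>Squaring a positive part removes the kink where it vanishes. The inner square
    smooths the junction at 0, the outer one the junction at - \<sigma>.\<close>
  let ?c = "\<lambda>t. (max 0 (1 - (max 0 (- t / \<sigma>))\<^sup>2))\<^sup>2"
  let ?c' = "\<lambda>t. 2 * max 0 (1 - (max 0 (- t / \<sigma>))\<^sup>2) * (2 * max 0 (- t / \<sigma>) * (1 / \<sigma>))"
  show "(?c has_real_derivative ?c' t) (at t)" for t
  proof -
    have lin: "((\<lambda>t. - t / \<sigma>) has_real_derivative - 1 / \<sigma>) (at t)"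
      using assms by (auto intro!: derivative_eq_intros)
    have "((\<lambda>t. 1 - (max 0 (- t / \<sigma>))\<^sup>2) has_real_derivative (2 * max 0 (- t / \<sigma>)) * (1 / \<sigma>)) (at t)"
      using DERIV_diff[OF DERIV_const DERIV_chain2[OF DERIV_max_zero_square lin], of 1] by simp
    from DERIV_chain2[OF DERIV_max_zero_square this] show ?thesis by simp
  qed
  show "continuous_on UNIV ?c'" using assms by (intro continuous_intros) auto
  show "0 \<le> ?c t" "?c t \<le> 1" for t by (auto simp: max_def power_le_one)
  show "?c t = 0" if "t \<le> - \<sigma>" for t
  proof -
    have "1 \<le> max 0 (- t / \<sigma>)" using that assms by (simp add: field_simps)
    then have "1 \<le> (max 0 (- t / \<sigma>))\<^sup>2" by (simp only: one_le_power)
    then show ?thesis by simp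
  qed
  show "?c t = 1" "?c' t = 0" if "t \<ge> 0" for t using that assms by (simp_all add: field_simps)
qed

lemma perimeter_upper:
  assumes "\<phi> \<in> C1c UNIV" "\<And>x. norm (\<phi> x) \<le> 1"
  shows "ereal (LINT x:\<Omega>|lborel. divergence \<phi> x) \<le> perimeter \<Omega>"
  unfolding perimeter_def using assms by (intro SUP_upper) auto

lemma perimeter_nonneg: "0 \<le> perimeter (\<Omega> :: 'a::euclidean_space set)"
proof -
  have D: "C1_with_derivative (\<lambda>x::'a. 0::'a) (\<lambda>_ _. 0)" by (auto intro: C1_with_derivativeI)
  have "(\<lambda>x::'a. 0::'a) \<in> C1c UNIV" by (rule C1cI[OF D, of "{}"]) auto
  from perimeter_upper[OF this, of \<Omega>] show ?thesis
    by (simp add: divergence_def C1_with_derivativeD(5)[OF D] zero_ereal_def)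
qed

lemma divergence_integrable:
  fixes \<phi> :: "'a::euclidean_space \<Rightarrow> 'a"
  assumes "\<phi> \<in> C1c U" "\<Omega> \<in> sets lborel"
  shows "set_integrable lborel \<Omega> (divergence \<phi>)"
proof -
  have "integrable lborel (divergence \<phi>)"
    unfolding divergence_def[abs_def] using C1c_integrable(2)[OF assms(1)] by (intro Bochner_Integration.integrable_sum integrable_inner_left)
  then show ?thesis unfolding set_integrable_def by (intro integrable_mult_indicator assms(2))
qed

text \<open>Testing the perimeter with the field \<open>- h(w) \<nabla>w\<close>, where \<open>w\<close> is the soft minimum. Its divergence
  \<open>k(w) |\<nabla>w|\<^sup>2 + \<beta> h(w) (1 - |\<nabla>w|\<^sup>2)\<close>, with \<open>k = - h'\<close>, is at least \<open>k(w)\<close> because \<open>k \<le> \<beta> h\<close>: the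
  concavity of \<open>w\<close> compensates for the set where \<open>|\<nabla>w| < 1\<close>.\<close>

lemma (in unit_normals) softmin_layer_bound:
  assumes \<Omega>: "\<Omega> \<in> sets lborel" "emeasure lborel \<Omega> < \<infinity>"
    and inside: "\<And>x p. x \<in> \<Omega> \<Longrightarrow> p \<in> I \<Longrightarrow> 0 \<le> x \<bullet> fst p - snd p"
    and bounded: "\<And>t. bounded {x. \<forall>p\<in>I. t \<le> x \<bullet> fst p - snd p}"
    and h: "\<And>t. (h has_real_derivative - k t) (at t)" and k: "continuous_on UNIV k"
    and k_bounds: "\<And>t. 0 \<le> k t" "\<And>t. k t \<le> \<beta> * h t" "\<And>t. k t \<le> B"
    and \<sigma>: "\<sigma> > 0" "h (- \<sigma>) \<le> M" "M > 0"
    and P: "perimeter \<Omega> \<le> ereal P"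
  shows "(LINT x:\<Omega>|lborel. k (softmin I \<beta> x)) \<le> P * M"
proof -
  let ?w = "softmin I \<beta>" and ?G = "softmin_grad I \<beta>"
  obtain c c' where c: "\<And>t. (c has_real_derivative c' t) (at t)" "continuous_on UNIV c'"
    "\<And>t. 0 \<le> c t" "\<And>t. c t \<le> 1" "\<And>t. t \<le> - \<sigma> \<Longrightarrow> c t = 0" "\<And>t. t \<ge> 0 \<Longrightarrow> c t = 1" "\<And>t. t \<ge> 0 \<Longrightarrow> c' t = 0"
    using C1_cutoff_function[OF \<sigma>(1)] by metis
  obtain DG where DG: "C1_with_derivative ?G DG"
    "\<And>x. (\<Sum>b\<in>Basis. DG x b \<bullet> b) = - \<beta> * (1 - (norm (?G x))\<^sup>2)"
    using softmin_laplacian by metis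
  have h_nonneg: "0 \<le> h t" for t
    using k_bounds(1,2)[of t] beta_pos by (metis order_trans zero_le_mult_iff not_less)
  have h_mono: "h t \<le> h s" if "s \<le> t" for s t
    by (rule DERIV_nonpos_imp_nonincreasing[OF that]) (use h k_bounds(1) in force)
  \<comment> \<open>h decreases and the cutoff c vanishes up to - \<sigma>, so h(- \<sigma>), and
    hence M, bounds h wherever c is nonzero. Division by M normalises the field to length at most
    1.\<close>
  define f where "f t = - (h t * c t) / M" for t
  define f' where "f' t = (k t * c t - h t * c' t) / M" for t
  have f: "(f has_real_derivative f' t) (at t)" for t
    unfolding f_def[abs_def] f'_def using \<sigma>(3)
    by (auto intro!: derivative_eq_intros h c(1) simp: field_simps)
  have cont: "continuous_on UNIV h" "continuous_on UNIV c"
    using h c(1) by (auto intro!: DERIV_continuous_on)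
  have "continuous_on UNIV f'"
    unfolding f'_def[abs_def] using \<sigma>(3) cont k c(2) by (intro continuous_intros) auto
  from C1_with_derivative_compose[OF softmin_C1 f this]
  have D: "C1_with_derivative (\<lambda>x. f (?w x) *\<^sub>R ?G x)
      (\<lambda>x v. f (?w x) *\<^sub>R DG x v + (f' (?w x) * (?G x \<bullet> v)) *\<^sub>R ?G x)" (is "C1_with_derivative ?\<phi> ?D")
    by (rule C1_with_derivative_scaleR[OF _ DG(1)])
  \<comment> \<open>Outside K some affine function lies so far below - \<sigma> that the soft
    minimum, even with its excess ln (card I) / \<beta>, is at most - \<sigma>, where the cutoff
    vanishes. The level here is negative, which is why boundedness is asked for at every level
    t.\<close>
  define K where "K = closure {x. \<forall>p\<in>I. - \<sigma> - ln (card I) / \<beta> \<le> x \<bullet> fst p - snd p}"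
  have "f (?w x) = 0" if "x \<notin> K" for x
  proof -
    obtain p where p: "p \<in> I" "x \<bullet> fst p - snd p < - \<sigma> - ln (card I) / \<beta>"
      using \<open>x \<notin> K\<close> closure_subset unfolding K_def by (smt (verit, best) mem_Collect_eq subsetD)
    then have "?w x \<le> - \<sigma>" using softmin_le[OF p(1), of x] by simp
    then show ?thesis by (simp add: f_def c(5))
  qed
  then have \<phi>: "?\<phi> \<in> C1c UNIV"
    using bounded by (intro C1cI[OF D, of K]) (auto simp: K_def compact_closure)
  have "\<bar>f t\<bar> \<le> 1" for t
  proof (cases "t \<le> - \<sigma>")
    case True then show ?thesis by (simp add: f_def c(5))
  next
    case False
    then have "h t * c t \<le> M * 1"
      using h_mono[of "- \<sigma>" t] \<sigma> h_nonneg c(3,4) by (intro mult_mono) auto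
    then show ?thesis using \<sigma>(3) h_nonneg[of t] c(3)[of t] by (simp add: f_def abs_mult)
  qed
  then have norm: "norm (?\<phi> x) \<le> 1" for x
    using mult_mono[of "\<bar>f (?w x)\<bar>" 1 "norm (?G x)" 1] norm_softmin_grad[of x] by simp
  have k_int: "set_integrable lborel \<Omega> (\<lambda>x. k (?w x))"
  proof (rule set_integrable_bounded_measurable[OF \<Omega>, where B = B])
    show "set_borel_measurable lborel \<Omega> (\<lambda>x. k (?w x))"
      using continuous_on_compose2[OF k C1_with_derivativeD(3)[OF softmin_C1]]
      by (intro set_borel_measurable_continuous_UNIV \<Omega>) auto
  qed (use k_bounds in auto)
  have "(LINT x:\<Omega>|lborel. k (?w x)) / M = (LINT x:\<Omega>|lborel. k (?w x) / M)" by simp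
  also have "\<dots> \<le> (LINT x:\<Omega>|lborel. divergence ?\<phi> x)"
  proof (rule set_integral_mono)
    show "set_integrable lborel \<Omega> (\<lambda>x. k (?w x) / M)" using k_int by simp
    show "set_integrable lborel \<Omega> (divergence ?\<phi>)" by (rule divergence_integrable[OF \<phi> \<Omega>(1)])
    fix x assume x: "x \<in> \<Omega>"
    \<comment> \<open>On \<Omega> the cutoff is 1 and its derivative 0, so the divergence below is
      that of the uncut field divided by M.\<close>
    have w: "0 \<le> ?w x" using inside[OF x] by (rule softmin_ge)
    let ?n = "(norm (?G x))\<^sup>2"
    have "divergence ?\<phi> x = f (?w x) * (\<Sum>b\<in>Basis. DG x b \<bullet> b) + f' (?w x) * (\<Sum>b\<in>Basis. (?G x \<bullet> b) * (?G x \<bullet> b))"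
      unfolding divergence_def C1_with_derivativeD(5)[OF D]
      by (simp add: inner_add_left sum.distrib sum_distrib_left mult_ac)
    also have "\<dots> = (\<beta> * h (?w x) * (1 - ?n) + k (?w x) * ?n) / M"
      using \<sigma>(3) by (simp add: DG(2) f_def f'_def c(6,7)[OF w] euclidean_inner[symmetric] power2_norm_eq_inner field_simps)
    finally have div: "divergence ?\<phi> x = (\<beta> * h (?w x) * (1 - ?n) + k (?w x) * ?n) / M" .
    have "?n \<le> 1" using norm_softmin_grad[of x] by (simp add: power_le_one)
    then have "k (?w x) * (1 - ?n) \<le> \<beta> * h (?w x) * (1 - ?n)"
      using k_bounds(2) by (intro mult_right_mono) auto
    then have "k (?w x) \<le> \<beta> * h (?w x) * (1 - ?n) + k (?w x) * ?n" by (simp add: algebra_simps)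
    then show "k (?w x) / M \<le> divergence ?\<phi> x"
      unfolding div using \<sigma>(3) by (simp add: divide_right_mono)
  qed
  also have "\<dots> \<le> P"
    using order_trans[OF perimeter_upper[OF \<phi> norm, of \<Omega>] P] by simp
  finally show ?thesis using \<sigma>(3) by (simp add: field_simps)
qed

section \<open>The inequality \<open>|\<Omega>|\<^sup>3 \<le> 3 P(\<Omega>)\<^sup>2 T(\<Omega>)\<close>\<close>

lemma open_convex_separating_halfspace:
  fixes \<Omega> :: "'a::euclidean_space set"
  assumes "open \<Omega>" "convex \<Omega>" "\<Omega> \<noteq> {}" "z \<notin> \<Omega>"
  obtains \<nu> c where "norm \<nu> = 1" "\<And>x. x \<in> \<Omega> \<Longrightarrow> 0 \<le> x \<bullet> \<nu> - c" "z \<bullet> \<nu> - c \<le> 0"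
proof -
  obtain a b where ab: "a \<noteq> 0" "a \<bullet> z \<le> b" "\<And>x. x \<in> \<Omega> \<Longrightarrow> b \<le> a \<bullet> x"
    using separating_hyperplane_sets[of "{z}" \<Omega>] assms by auto
  show ?thesis
  proof (rule that[of "a /\<^sub>R norm a" "b / norm a"])
    show "norm (a /\<^sub>R norm a) = 1" using ab(1) by simp
    show "0 \<le> x \<bullet> (a /\<^sub>R norm a) - b / norm a" if "x \<in> \<Omega>" for x
      using ab(1) ab(3)[OF that] by (simp add: divide_inverse inner_commute mult_right_mono mult.commute)
    show "z \<bullet> (a /\<^sub>R norm a) - b / norm a \<le> 0"
      using ab(1,2) by (simp add: divide_inverse inner_commute mult_right_mono mult.commute)
  qed
qed

lemma closed_polyhedron: "closed {x. \<forall>p\<in>I. t \<le> x \<bullet> fst p - snd p}"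
proof -
  have "{x. \<forall>p\<in>I. t \<le> x \<bullet> fst p - snd p} = (\<Inter>p\<in>I. {x. t \<le> x \<bullet> fst p - snd p})" by auto
  then show ?thesis by (auto intro!: closed_INT closed_Collect_le continuous_intros)
qed

text \<open>A box makes all level sets bounded. The points outside \<Omega> that have depth at least
  \<eta> in the box then form a compact set, and each has a half-space containing \<Omega> in which
  its own depth is at most 0, hence below \<eta> nearby; finitely many such half-spaces suffice.
  Points of \<Omega> have depth at least 0 and points of depth at least \<eta> lie in \<Omega>, so a
  function of the depth that vanishes up to \<eta> is supported in \<Omega>.\<close>

lemma convex_polyhedral_approximation:
  fixes \<Omega> :: "'a::euclidean_space set"
  assumes "open \<Omega>" "convex \<Omega>" "\<Omega> \<noteq> {}" "bounded \<Omega>" "\<eta> > 0"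
  obtains I :: "('a \<times> real) set" where "finite I" "I \<noteq> {}" "\<And>p. p \<in> I \<Longrightarrow> norm (fst p) = 1"
    "\<And>x p. x \<in> \<Omega> \<Longrightarrow> p \<in> I \<Longrightarrow> 0 \<le> x \<bullet> fst p - snd p"
    "\<And>t. bounded {x. \<forall>p\<in>I. t \<le> x \<bullet> fst p - snd p}"
    "{x. \<forall>p\<in>I. \<eta> \<le> x \<bullet> fst p - snd p} \<subseteq> \<Omega>"
proof -
  obtain R where R: "\<And>x. x \<in> \<Omega> \<Longrightarrow> norm x \<le> R"
    using assms(4) by (auto simp: bounded_iff)
  \<comment> \<open>The inward normals and offsets of the faces of a cube of half-width R around 0,
    which contains \<Omega>.\<close>
  define I0 :: "('a \<times> real) set" where "I0 = (\<lambda>b. (b, - R)) ` Basis \<union> (\<lambda>b. (- b, - R)) ` Basis"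
  have I0: "finite I0" "I0 \<noteq> {}" "\<And>p. p \<in> I0 \<Longrightarrow> norm (fst p) = 1"
    by (auto simp: I0_def)
  have I0_pos: "0 \<le> x \<bullet> fst p - snd p" if "x \<in> \<Omega>" "p \<in> I0" for x p
  proof -
    have "\<bar>x \<bullet> b\<bar> \<le> R" if "b \<in> Basis" for b
      using Basis_le_norm[OF that, of x] R[OF \<open>x \<in> \<Omega>\<close>] by simp
    then show ?thesis using that(2) by (force simp: I0_def abs_le_iff)
  qed
  have I0_bounded: "bounded {x. \<forall>p\<in>I0. t \<le> x \<bullet> fst p - snd p}" for t
  proof (rule boundedI)
    fix x assume "x \<in> {x. \<forall>p\<in>I0. t \<le> x \<bullet> fst p - snd p}"
    then have "\<bar>x \<bullet> b\<bar> \<le> R - t" if "b \<in> Basis" for b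
      using that unfolding I0_def by (force simp: abs_le_iff)
    then have "(\<Sum>b\<in>Basis. \<bar>x \<bullet> b\<bar>) \<le> (\<Sum>b\<in>(Basis::'a set). R - t)"
      by (intro sum_mono)
    then show "norm x \<le> DIM('a) * (R - t)"
      using norm_le_l1[of x] by simp
  qed
  let ?S = "{x. \<forall>p\<in>I0. \<eta> \<le> x \<bullet> fst p - snd p}"
  have "compact ?S" using closed_polyhedron I0_bounded compact_eq_bounded_closed by blast
  then have compact: "compact (?S - \<Omega>)" using assms(1) by (rule compact_diff)
  have "\<forall>z\<in>?S - \<Omega>. \<exists>p. norm (fst p) = 1 \<and> (\<forall>x\<in>\<Omega>. 0 \<le> x \<bullet> fst p - snd p) \<and> z \<bullet> fst p - snd p \<le> 0"
  proof
    fix z assume "z \<in> ?S - \<Omega>"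
    then have "z \<notin> \<Omega>" by blast
    then obtain \<nu> c where "norm \<nu> = 1" "\<And>x. x \<in> \<Omega> \<Longrightarrow> 0 \<le> x \<bullet> \<nu> - c" "z \<bullet> \<nu> - c \<le> 0"
      using open_convex_separating_halfspace[OF assms(1-3)] by blast
    then show "\<exists>p. norm (fst p) = 1 \<and> (\<forall>x\<in>\<Omega>. 0 \<le> x \<bullet> fst p - snd p) \<and> z \<bullet> fst p - snd p \<le> 0"
      by (intro exI[of _ "(\<nu>, c)"]) auto
  qed
  from bchoice[OF this] obtain N where N: "\<forall>z\<in>?S - \<Omega>. norm (fst (N z)) = 1 \<and>
      (\<forall>x\<in>\<Omega>. 0 \<le> x \<bullet> fst (N z) - snd (N z)) \<and> z \<bullet> fst (N z) - snd (N z) \<le> 0"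
    by blast
  obtain C where C: "C \<subseteq> ?S - \<Omega>" "finite C" "?S - \<Omega> \<subseteq> (\<Union>z\<in>C. {x. x \<bullet> fst (N z) - snd (N z) < \<eta>})"
  proof (rule compactE_image[OF compact, of "?S - \<Omega>" "\<lambda>z. {x. x \<bullet> fst (N z) - snd (N z) < \<eta>}"])
    show "open {x. x \<bullet> fst (N z) - snd (N z) < \<eta>}" for z
      by (intro open_Collect_less continuous_intros)
    show "?S - \<Omega> \<subseteq> (\<Union>z\<in>?S - \<Omega>. {x. x \<bullet> fst (N z) - snd (N z) < \<eta>})"
    proof
      fix z assume "z \<in> ?S - \<Omega>"
      moreover from this have "z \<bullet> fst (N z) - snd (N z) < \<eta>"
        using N assms(5) by (meson le_less_trans)
      ultimately show "z \<in> (\<Union>z\<in>?S - \<Omega>. {x. x \<bullet> fst (N z) - snd (N z) < \<eta>})" by blast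
    qed
  qed blast
  have N': "norm (fst (N z)) = 1" "\<And>x. x \<in> \<Omega> \<Longrightarrow> 0 \<le> x \<bullet> fst (N z) - snd (N z)" if "z \<in> C" for z
    using N C(1) that by blast+
  show ?thesis
  proof (rule that[of "I0 \<union> N ` C"])
    show "bounded {x. \<forall>p\<in>I0 \<union> N ` C. t \<le> x \<bullet> fst p - snd p}" for t
      by (rule bounded_subset[OF I0_bounded[of t]]) auto
    show "{x. \<forall>p\<in>I0 \<union> N ` C. \<eta> \<le> x \<bullet> fst p - snd p} \<subseteq> \<Omega>"
    proof
      fix x assume x: "x \<in> {x. \<forall>p\<in>I0 \<union> N ` C. \<eta> \<le> x \<bullet> fst p - snd p}"
      show "x \<in> \<Omega>"
      proof (rule ccontr)
        assume "x \<notin> \<Omega>"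
        then obtain z where "z \<in> C" "x \<bullet> fst (N z) - snd (N z) < \<eta>" using x C(3) by auto
        then show False using x by force
      qed
    qed
  qed (use I0 I0_pos N' C(2) in auto)
qed

section \<open>The one-dimensional profile\<close>

lemma continuous_antiderivative:
  fixes f :: "real \<Rightarrow> real"
  assumes "continuous_on UNIV f"
  obtains F where "\<And>t. (F has_real_derivative f t) (at t)" "F 0 = 0"
proof -
  let ?F = "\<lambda>u::real. LBINT y=0..ereal u. f y"
  have "(?F has_real_derivative f t) (at t)" for t
  proof -
    let ?a = "min 0 t - 1" and ?b = "max 0 t + 1"
    have "(?F has_vector_derivative f t) (at t within {?a..?b})"
      using interval_integral_FTC2[of ?a 0 ?b f t] continuous_on_subset[OF assms] by (auto simp: zero_ereal_def)
    moreover have "at t within {?a..?b} = at t"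
      by (rule at_within_interior) auto
    ultimately show ?thesis by (simp add: has_real_derivative_iff_has_vector_derivative)
  qed
  moreover have "?F 0 = 0" by (simp add: zero_ereal_def[symmetric])
  ultimately show ?thesis by (rule that[of ?F])
qed

lemma has_derivative_le_imp_diff_le:
  fixes f g :: "real \<Rightarrow> real"
  assumes "a \<le> b" "\<And>t. a \<le> t \<Longrightarrow> t \<le> b \<Longrightarrow> (f has_real_derivative f' t) (at t)"
    "\<And>t. a \<le> t \<Longrightarrow> t \<le> b \<Longrightarrow> (g has_real_derivative g' t) (at t)"
    "\<And>t. a \<le> t \<Longrightarrow> t \<le> b \<Longrightarrow> f' t \<le> g' t"
  shows "f b - f a \<le> g b - g a"
proof -
  have "(\<lambda>t. g t - f t) a \<le> (\<lambda>t. g t - f t) b"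
    by (rule DERIV_nonneg_imp_nondecreasing[OF assms(1)])
       (use assms(2-4) in \<open>force intro!: derivative_intros exI\<close>)
  then show ?thesis by simp
qed

text \<open>The optimal profile \<open>f(t) = (a - t)\<^sup>+\<close>, cut off near \<open>0\<close> so that \<open>F(w)\<close> has compact support.\<close>

lemma test_profile:
  fixes a \<eta> :: real
  assumes "\<eta> > 0" "3 * \<eta> < a"
  obtains f F \<Phi> B where "continuous_on UNIV f"
    "\<And>t. (F has_real_derivative f t) (at t)" "\<And>t. (\<Phi> has_real_derivative F t) (at t)"
    "\<And>t. (B has_real_derivative (f t)\<^sup>2) (at t)"
    "\<And>t. 0 \<le> f t" "\<And>t. f t \<le> a" "\<And>t. t \<le> 2 * \<eta> \<Longrightarrow> f t = 0" "\<And>t. t \<ge> a \<Longrightarrow> f t = 0"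
    "\<And>t. t \<le> 2 * \<eta> \<Longrightarrow> F t = 0" "\<And>t. t \<ge> a \<Longrightarrow> F t = F a" "\<And>t. 0 \<le> F t" "\<And>t. F t \<le> F a" "F a \<le> a\<^sup>2"
    "B a - B 0 \<le> \<Phi> a - \<Phi> 0" "(a - 3 * \<eta>) ^ 3 / 3 \<le> \<Phi> a - \<Phi> 0" "\<Phi> a - \<Phi> 0 \<le> a ^ 3 / 3"
proof -
  \<comment> \<open>The ramp starts at 2 \<eta>, and its slope a / \<eta> takes it to a at 3 \<eta>,
    so from there up to a the value is a - t.\<close>
  define f where "f t = max 0 (min (a - t) ((a / \<eta>) * (t - 2 * \<eta>)))" for t
  have a: "a > 0" using assms by simp
  have cont: "continuous_on UNIV f" unfolding f_def[abs_def] by (intro continuous_intros)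
  obtain F where F: "\<And>t. (F has_real_derivative f t) (at t)" "F 0 = 0"
    using continuous_antiderivative[OF cont] by metis
  have "continuous_on UNIV F" using F(1) by (auto intro!: DERIV_continuous_on)
  then obtain \<Phi> where \<Phi>: "\<And>t. (\<Phi> has_real_derivative F t) (at t)"
    using continuous_antiderivative by metis
  have "continuous_on UNIV (\<lambda>t. (f t)\<^sup>2)" using cont by (intro continuous_intros)
  then obtain B where B: "\<And>t. (B has_real_derivative (f t)\<^sup>2) (at t)"
    using continuous_antiderivative by metis
  have f_nonneg: "0 \<le> f t" for t by (simp add: f_def)
  have f_le: "f t \<le> a - t" if "t \<le> a" for t using that by (simp add: f_def)
  have f_0: "f t = 0" if "t \<le> 2 * \<eta>" for t
  proof -
    have "(a / \<eta>) * (t - 2 * \<eta>) \<le> 0"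
      using that a assms(1) by (intro mult_nonneg_nonpos) auto
    then show ?thesis by (simp add: f_def min.coboundedI2 max_absorb1)
  qed
  have f_a: "f t = 0" if "t \<ge> a" for t
    using that by (simp add: f_def)
  have f_eq: "f t = a - t" if "3 * \<eta> \<le> t" "t \<le> a" for t
  proof -
    have "a / \<eta> * \<eta> \<le> a / \<eta> * (t - 2 * \<eta>)"
      using that assms(1) a by (intro mult_left_mono) auto
    then have "a - t \<le> a / \<eta> * (t - 2 * \<eta>)" using that assms(1) by simp
    then show ?thesis using that by (simp add: f_def)
  qed
  have f_le_a: "f t \<le> a" for t
    using f_0[of t] f_a[of t] f_le[of t] assms a by (cases "t \<le> 0"; cases "t \<ge> a") auto
  have F_mono: "F s \<le> F t" if "s \<le> t" for s t
    by (rule DERIV_nonneg_imp_nondecreasing[OF that]) (use F(1) f_nonneg in blast)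
  have const: "F s = F t" if "\<And>r. s \<le> r \<Longrightarrow> r \<le> t \<Longrightarrow> f r = 0" "s \<le> t" for s t
    by (rule antisym[OF F_mono[OF that(2)] DERIV_nonpos_imp_nonincreasing[OF that(2)]])
       (use F(1) that(1) in force)
  have F_0: "F t = 0" if "t \<le> 2 * \<eta>" for t
  proof (cases "t \<le> 0")
    case True
    have "F t = F 0" by (rule const) (use True f_0 assms in auto)
    then show ?thesis using F(2) by simp
  next
    case False
    have "F 0 = F t" by (rule const) (use False f_0 that in auto)
    then show ?thesis using F(2) by simp
  qed
  have F_a: "F t = F a" if "t \<ge> a" for t
    using const[of a t] that f_a by simp
  have F_nonneg: "0 \<le> F t" for t
    using F_mono[of 0 t] F(2) F_0[of t] assms by (cases "t \<ge> 0") auto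
  have F_le: "F t \<le> F a" for t
    using F_mono[of t a] F_a[of t] by (cases "t \<le> a") auto
  have "F a - F 0 \<le> a * a - a * 0"
    by (rule has_derivative_le_imp_diff_le[where f' = f and g' = "\<lambda>_. a"])
       (use a F(1) f_le_a in \<open>auto intro!: derivative_eq_intros\<close>)
  then have F_a2: "F a \<le> a\<^sup>2" using F(2) by (simp add: power2_eq_square)
  \<comment> \<open>Integration by parts: X is a primitive of (a - t) f(t) with the same increment
    over [0, a] as \<Phi>. Since f lies between 0 and a - t there, the integrand lies between f^2
    and (a - t)^2 and equals the latter from 3 \<eta> on, which gives all three estimates.\<close>
  define X where "X t = \<Phi> t + (a - t) * F t" for t
  have X: "(X has_real_derivative (a - t) * f t) (at t)" for t
    unfolding X_def[abs_def] by (auto intro!: derivative_eq_intros \<Phi> F)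
  have X_eq: "X a - X 0 = \<Phi> a - \<Phi> 0" by (simp add: X_def F(2))
  have cubic: "((\<lambda>t. - ((a - t) ^ 3) / 3) has_real_derivative (a - t)\<^sup>2) (at t)" for t
    by (auto intro!: derivative_eq_intros simp: power2_eq_square)
  have BX: "B a - B 0 \<le> X a - X 0"
  proof (rule has_derivative_le_imp_diff_le[OF _ B X])
    show "(f t)\<^sup>2 \<le> (a - t) * f t" if "t \<le> a" for t
      using f_le[OF that] f_nonneg[of t] by (simp add: power2_eq_square mult_right_mono)
  qed (use a in auto)
  have "X (3 * \<eta>) - X 0 \<ge> 0 - 0"
    by (rule has_derivative_le_imp_diff_le[where f = "\<lambda>_. 0" and f' = "\<lambda>_. 0", OF _ _ X])
       (use assms f_nonneg in auto)
  moreover have "X a - X (3 * \<eta>) \<ge> - ((a - a) ^ 3) / 3 - (- ((a - 3 * \<eta>) ^ 3) / 3)"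
    by (rule has_derivative_le_imp_diff_le[OF _ cubic X]) (use assms f_eq in \<open>auto simp: power2_eq_square\<close>)
  ultimately have lower: "(a - 3 * \<eta>) ^ 3 / 3 \<le> X a - X 0" by simp
  have "X a - X 0 \<le> - ((a - a) ^ 3) / 3 - (- ((a - 0) ^ 3) / 3)"
  proof (rule has_derivative_le_imp_diff_le[OF _ X cubic])
    show "(a - t) * f t \<le> (a - t)\<^sup>2" if "t \<le> a" for t
      using f_le[OF that] that by (simp add: power2_eq_square mult_left_mono)
  qed (use a in auto)
  then have upper: "X a - X 0 \<le> a ^ 3 / 3" by simp
  show ?thesis
    by (rule that[OF cont F(1) \<Phi> B f_nonneg f_le_a f_0 f_a F_0 F_a F_nonneg F_le F_a2])
       (use BX lower upper X_eq in simp_all)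
qed

text \<open>One parameter \<eta> controls every error: the gap between polytope and \<Omega>, the
  excess of the soft minimum, the width of the cutoff and the amount added to h. As \<eta> tends to
  0 this becomes P (a^3 / 3)^2 \<le> T a^3 / 3, the quotient bound with integral and energy both
  equal to P a^3 / 3, divided by P.\<close>

lemma torsion_perimeter_volume_step:
  fixes \<Omega> :: "'a::euclidean_space set"
  assumes \<Omega>: "open \<Omega>" "convex \<Omega>" "\<Omega> \<noteq> {}" "bounded \<Omega>"
    and P: "perimeter \<Omega> \<le> ereal P" "P > 0"
    and a: "measure lborel \<Omega> = P * a" and \<eta>: "\<eta> > 0" "3 * \<eta> < a"
    and large: "\<eta> * (1 + a\<^sup>2) \<le> (a - 3 * \<eta>) ^ 3 / 3"
  shows "P * ((a - 3 * \<eta>) ^ 3 / 3 - \<eta> * (1 + a\<^sup>2))\<^sup>2 \<le> torsional_rigidity \<Omega> * (a ^ 3 / 3 + \<eta>)"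
proof (rule test_profile[OF \<eta>])
  fix f F \<Phi> B
  assume f: "continuous_on UNIV f" "\<And>t. (F has_real_derivative f t) (at t)"
      "\<And>t. (\<Phi> has_real_derivative F t) (at t)" "\<And>t. (B has_real_derivative (f t)\<^sup>2) (at t)"
      "\<And>t. 0 \<le> f t" "\<And>t. f t \<le> a" "\<And>t. t \<le> 2 * \<eta> \<Longrightarrow> f t = 0" "\<And>t. t \<ge> a \<Longrightarrow> f t = 0"
    and F: "\<And>t. t \<le> 2 * \<eta> \<Longrightarrow> F t = 0" "\<And>t. t \<ge> a \<Longrightarrow> F t = F a" "\<And>t. 0 \<le> F t" "\<And>t. F t \<le> F a" "F a \<le> a\<^sup>2"
    and Y: "B a - B 0 \<le> \<Phi> a - \<Phi> 0" "(a - 3 * \<eta>) ^ 3 / 3 \<le> \<Phi> a - \<Phi> 0" "\<Phi> a - \<Phi> 0 \<le> a ^ 3 / 3"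
  have \<Omega>': "\<Omega> \<in> sets lborel" "emeasure lborel \<Omega> < \<infinity>"
    using \<Omega>(1) emeasure_bounded_finite[OF \<Omega>(4)] by auto
  define T where "T = torsional_rigidity \<Omega>"
  have T: "0 \<le> T" unfolding T_def by (rule torsional_rigidity_bounds(3)[OF \<Omega>(1,4)])
  define Y where "Y = \<Phi> a - \<Phi> 0"
  obtain I where I: "finite I" "I \<noteq> {}" "\<And>p. p \<in> I \<Longrightarrow> norm (fst p) = 1"
    "\<And>x p. x \<in> \<Omega> \<Longrightarrow> p \<in> I \<Longrightarrow> 0 \<le> x \<bullet> fst p - snd p"
    "\<And>t. bounded {x. \<forall>p\<in>I. t \<le> x \<bullet> fst p - snd p}"
    "{x. \<forall>p\<in>I. \<eta> \<le> x \<bullet> fst p - snd p} \<subseteq> \<Omega>"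
    by (rule convex_polyhedral_approximation[OF \<Omega> \<eta>(1)]) (rule that)
  \<comment> \<open>Large enough for ln (card I) / \<beta> \<le> \<eta> and for a^2 \<le> \<beta>
    \<eta>. The latter yields k \<le> \<beta> h in both applications of the layer bound, where k
    \<le> a^2 and h \<ge> \<eta>.\<close>
  define \<beta> where "\<beta> = (ln (card I) + a\<^sup>2 + 1) / \<eta>"
  have ln_card: "0 \<le> ln (card I)" using I(1,2) by (simp add: Suc_leI card_gt_0_iff)
  have \<beta>: "\<beta> > 0" "a\<^sup>2 \<le> \<beta> * \<eta>" "ln (card I) / \<beta> \<le> \<eta>"
  proof -
    show pos: "\<beta> > 0" using ln_card \<eta>(1) by (simp add: \<beta>_def add_nonneg_pos)
    have eq: "\<beta> * \<eta> = ln (card I) + a\<^sup>2 + 1" using \<eta>(1) by (simp add: \<beta>_def)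
    show "a\<^sup>2 \<le> \<beta> * \<eta>" using eq ln_card by simp
    have "ln (card I) \<le> \<beta> * \<eta>" using eq by simp
    then show "ln (card I) / \<beta> \<le> \<eta>" using pos by (simp add: pos_divide_le_eq mult.commute)
  qed
  interpret unit_normals I \<beta> using I \<beta> by unfold_locales auto
  let ?w = "softmin I \<beta>"
  have contF: "continuous_on UNIV F" using f(2) by (auto intro!: DERIV_continuous_on)
  have contw: "continuous_on UNIV ?w" by (rule C1_with_derivativeD(3)[OF softmin_C1])
  \<comment> \<open>The primitives \<Phi> and B do not change between - \<eta> and 0, so evaluating
    h at the edge - \<eta> of the cutoff instead of at 0 costs only terms of order \<eta>.\<close>
  have flat: "k (- \<eta>) = k 0" if "\<And>t. (k has_real_derivative k' t) (at t)" "\<And>t. t \<le> 0 \<Longrightarrow> k' t = 0" for k k'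
  proof (rule antisym)
    show "k (- \<eta>) \<le> k 0"
      by (rule DERIV_nonneg_imp_nondecreasing) (use \<eta>(1) that in force)+
    show "k 0 \<le> k (- \<eta>)"
      by (rule DERIV_nonpos_imp_nonincreasing) (use \<eta>(1) that in force)+
  qed
  have \<Phi>_0: "\<Phi> (- \<eta>) = \<Phi> 0"
    by (rule flat[OF f(3)]) (use F(1) \<eta>(1) in auto)
  have B_0: "B (- \<eta>) = B 0"
    by (rule flat[OF f(4)]) (use f(7) \<eta>(1) in auto)
  have *: "\<eta> \<le> h t" if "\<And>t. (h has_real_derivative - k t) (at t)" "\<And>t. 0 \<le> k t" "\<And>t. t \<ge> a \<Longrightarrow> k t = 0" "h a = \<eta>"
    for h k t
  proof (cases "t \<le> a")
    case True
    have "h a \<le> h t"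
      by (rule DERIV_nonpos_imp_nonincreasing[OF True]) (use that(1,2) in force)
    then show ?thesis using that(4) by simp
  next
    case False
    have "h a \<le> h t"
      by (rule DERIV_nonneg_imp_nondecreasing) (use False that(1,3) in force)+
    then show ?thesis using that(4) by simp
  qed
  \<comment> \<open>\<eta> plus the integral of F(a) - F over [t, a]. The summand \<eta> keeps h
    away from 0, as k \<le> \<beta> h requires.\<close>
  define h1 where "h1 t = \<eta> + (a - t) * F a - (\<Phi> a - \<Phi> t)" for t
  have h1: "(h1 has_real_derivative - (F a - F t)) (at t)" for t
    unfolding h1_def[abs_def] by (auto intro!: derivative_eq_intros f(3))
  have h1_ge: "\<eta> \<le> h1 t" for t
  proof (rule *[OF h1])
    show "F a - F s = 0" if "s \<ge> a" for s using F(2)[OF that] by simp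
  qed (use F(4) in \<open>auto simp: h1_def\<close>)
  \<comment> \<open>The layer bound estimates integrals only from above, so it is applied to F(a) -
    F(w). Because |\<Omega>| = P a, subtraction from |\<Omega>| F(a) turns it into the lower bound P
    (Y - \<eta> (1 + F(a))) for the integral of F(w).\<close>
  have "(LINT x:\<Omega>|lborel. F a - F (?w x)) \<le> P * (\<eta> + (a + \<eta>) * F a - Y)"
  proof (rule softmin_layer_bound[OF \<Omega>' I(4,5) h1 _ _ _ _ \<eta>(1) _ _ P(1), where B = "F a"])
    show "continuous_on UNIV (\<lambda>t. F a - F t)" by (intro continuous_intros contF)
    show "F a - F t \<le> \<beta> * h1 t" for t
      using F(3)[of t] F(5) \<beta>(2) mult_left_mono[OF h1_ge[of t] less_imp_le[OF \<beta>(1)]] by linarith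
    show "h1 (- \<eta>) \<le> \<eta> + (a + \<eta>) * F a - Y" using \<Phi>_0 by (simp add: h1_def Y_def)
    then show "0 < \<eta> + (a + \<eta>) * F a - Y" using h1_ge[of "- \<eta>"] \<eta>(1) by simp
  qed (use F(3,4) in auto)
  moreover have "set_integrable lborel \<Omega> (\<lambda>x. F (?w x))"
  proof (rule set_integrable_bounded_measurable[OF \<Omega>', where B = "F a"])
    show "set_borel_measurable lborel \<Omega> (\<lambda>x. F (?w x))"
      using continuous_on_compose2[OF contF contw] by (intro set_borel_measurable_continuous_UNIV \<Omega>'(1)) auto
  qed (use F(3,4) in auto)
  moreover have "set_integrable lborel \<Omega> (\<lambda>x. F a)" "(LINT x:\<Omega>|lborel. F a) = measure lborel \<Omega> * F a"
    using \<Omega>' by (simp_all add: set_integrable_def set_lebesgue_integral_def)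
  ultimately have "P * a * F a - (LINT x:\<Omega>|lborel. F (?w x)) \<le> P * (\<eta> + (a + \<eta>) * F a - Y)"
    by (simp add: set_integral_diff a)
  then have int_u: "P * (Y - \<eta> * (1 + F a)) \<le> (LINT x:\<Omega>|lborel. F (?w x))"
    by (simp add: algebra_simps)
  define h2 where "h2 t = \<eta> + (B a - B t)" for t
  have h2: "(h2 has_real_derivative - (f t)\<^sup>2) (at t)" for t
    unfolding h2_def[abs_def] by (auto intro!: derivative_eq_intros f(4))
  have h2_ge: "\<eta> \<le> h2 t" for t
    by (rule *[OF h2]) (use f(8) in \<open>auto simp: h2_def\<close>)
  have f2: "(f t)\<^sup>2 \<le> a\<^sup>2" for t using f(5,6)[of t] by (intro power_mono)
  have energy: "(LINT x:\<Omega>|lborel. (f (?w x))\<^sup>2) \<le> P * (\<eta> + Y)"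
  proof (rule softmin_layer_bound[OF \<Omega>' I(4,5) h2 _ _ _ _ \<eta>(1) _ _ P(1), where B = "a\<^sup>2"])
    show "continuous_on UNIV (\<lambda>t. (f t)\<^sup>2)" by (intro continuous_intros f(1))
    show "(f t)\<^sup>2 \<le> \<beta> * h2 t" for t
      using f2[of t] \<beta>(2) mult_left_mono[OF h2_ge[of t] less_imp_le[OF \<beta>(1)]] by linarith
    show "h2 (- \<eta>) \<le> \<eta> + Y" using B_0 Y(1) by (simp add: h2_def Y_def)
    then show "0 < \<eta> + Y" using h2_ge[of "- \<eta>"] \<eta>(1) by simp
  qed (use f2 in auto)
  let ?K = "{x. \<forall>p\<in>I. \<eta> \<le> x \<bullet> fst p - snd p}"
  have "compact ?K" using closed_polyhedron I(5) compact_eq_bounded_closed by blast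
  note D = C1_with_derivative_compose[OF softmin_C1 f(2,1)]
  have u: "(\<lambda>x. F (?w x)) \<in> C1c \<Omega>"
  proof (rule C1cI[OF D \<open>compact ?K\<close> I(6)])
    fix x assume "x \<notin> ?K"
    then obtain p where p: "p \<in> I" "x \<bullet> fst p - snd p < \<eta>" by force
    \<comment> \<open>A depth below \<eta> and an excess of at most \<eta> add up to 2 \<eta>, the
      point up to which F was made to vanish.\<close>
    then have "?w x \<le> 2 * \<eta>" using softmin_le[OF p(1), of x] \<beta>(3) by simp
    then show "F (?w x) = 0" by (rule F(1))
  qed
  have grad_u: "grad (\<lambda>x. F (?w x)) x = f (?w x) *\<^sub>R softmin_grad I \<beta> x" for x
    by (rule grad_eqI[OF D]) simp
  have "(LINT x:\<Omega>|lborel. (norm (grad (\<lambda>x. F (?w x)) x))\<^sup>2) \<le> (LINT x:\<Omega>|lborel. (f (?w x))\<^sup>2)"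
  proof (rule set_integral_mono)
    show "set_integrable lborel \<Omega> (\<lambda>x. (norm (grad (\<lambda>x. F (?w x)) x))\<^sup>2)"
      by (rule square_integrable_on_norm[OF C1c_square_integrable(2)[OF \<Omega>' u]])
    show "set_integrable lborel \<Omega> (\<lambda>x. (f (?w x))\<^sup>2)"
    proof (rule set_integrable_bounded_measurable[OF \<Omega>', where B = "a\<^sup>2"])
      show "set_borel_measurable lborel \<Omega> (\<lambda>x. (f (?w x))\<^sup>2)"
        using continuous_on_compose2[OF f(1) contw]
        by (intro set_borel_measurable_continuous_UNIV \<Omega>'(1) continuous_intros) auto
    qed (use f2 in auto)
    show "(norm (grad (\<lambda>x. F (?w x)) x))\<^sup>2 \<le> (f (?w x))\<^sup>2" for x
      using mult_left_mono[OF power_le_one[OF norm_ge_zero norm_softmin_grad[of x]], of "(f (?w x))\<^sup>2" 2]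
      by (simp add: grad_u power_mult_distrib)
  qed
  then have E: "(LINT x:\<Omega>|lborel. (norm (grad (\<lambda>x. F (?w x)) x))\<^sup>2) \<le> P * (\<eta> + Y)"
    using energy by simp
  have Y': "(a - 3 * \<eta>) ^ 3 / 3 \<le> Y" "Y \<le> a ^ 3 / 3" using Y by (simp_all add: Y_def)
  let ?c = "(a - 3 * \<eta>) ^ 3 / 3 - \<eta> * (1 + a\<^sup>2)"
  have "\<eta> * (1 + F a) \<le> \<eta> * (1 + a\<^sup>2)"
    using F(5) \<eta>(1) by (intro mult_left_mono) auto
  then have "?c \<le> Y - \<eta> * (1 + F a)" using Y'(1) by linarith
  then have "P * ?c \<le> (LINT x:\<Omega>|lborel. F (?w x))"
    using int_u P(2) by (meson less_imp_le mult_left_mono order_trans)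
  then have "(P * ?c)\<^sup>2 \<le> (LINT x:\<Omega>|lborel. F (?w x))\<^sup>2"
    using large P(2) by (intro power_mono) auto
  also have "\<dots> \<le> T * (LINT x:\<Omega>|lborel. (norm (grad (\<lambda>x. F (?w x)) x))\<^sup>2)"
    unfolding T_def by (rule torsional_rigidity_bounds(1)[OF \<Omega>(1,4) u])
  also have "\<dots> \<le> T * (P * (\<eta> + Y))" by (rule mult_left_mono[OF E T])
  also have "\<dots> \<le> T * (P * (a ^ 3 / 3 + \<eta>))"
    using Y'(2) T P(2) by (intro mult_left_mono) auto
  finally have "P * (P * ?c\<^sup>2) \<le> P * (T * (a ^ 3 / 3 + \<eta>))"
    by (simp add: power_mult_distrib power2_eq_square mult_ac)
  then show ?thesis using P(2) by (simp add: T_def)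
qed

text \<open>P is a positive upper bound for the perimeter rather than the perimeter itself, so that
  a = |\<Omega>| / P makes sense before the perimeter is known to be positive.\<close>

theorem torsion_perimeter_volume_inequality:
  fixes \<Omega> :: "'a::euclidean_space set"
  assumes \<Omega>: "open \<Omega>" "convex \<Omega>" "\<Omega> \<noteq> {}" "bounded \<Omega>"
    and P: "perimeter \<Omega> \<le> ereal P" "P > 0"
  shows "(measure lborel \<Omega>) ^ 3 / 3 \<le> P\<^sup>2 * torsional_rigidity \<Omega>"
proof (cases "measure lborel \<Omega> = 0")
  case True
  then show ?thesis using torsional_rigidity_bounds(3)[OF \<Omega>(1,4)] by simp
next
  case False
  define a where "a = measure lborel \<Omega> / P"
  have a: "a > 0" "measure lborel \<Omega> = P * a" using False P(2) by (simp_all add: a_def zero_less_measure_iff)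
  let ?c = "\<lambda>\<eta>. (a - 3 * \<eta>) ^ 3 / 3 - \<eta> * (1 + a\<^sup>2)"
  have c: "(?c \<longlongrightarrow> (a - 3 * 0) ^ 3 / 3 - 0 * (1 + a\<^sup>2)) (at_right 0)"
    by (intro tendsto_intros) simp_all
  then have "\<forall>\<^sub>F \<eta> in at_right 0. ?c \<eta> > 0"
    by (rule order_tendstoD) (use a in simp)
  moreover have "\<forall>\<^sub>F \<eta> in at_right 0. \<eta> \<in> {0<..<a / 3}"
    using a by (intro eventually_at_right_real) simp
  ultimately have ev: "\<forall>\<^sub>F \<eta> in at_right 0. P * (?c \<eta>)\<^sup>2 \<le> torsional_rigidity \<Omega> * (a ^ 3 / 3 + \<eta>)"
    by eventually_elim (rule torsion_perimeter_volume_step[OF \<Omega> P a(2)]; simp)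
  have "((\<lambda>\<eta>. P * (?c \<eta>)\<^sup>2) \<longlongrightarrow> P * ((a - 3 * 0) ^ 3 / 3 - 0 * (1 + a\<^sup>2))\<^sup>2) (at_right 0)"
    by (intro tendsto_intros) simp_all
  moreover have "((\<lambda>\<eta>. torsional_rigidity \<Omega> * (a ^ 3 / 3 + \<eta>)) \<longlongrightarrow> torsional_rigidity \<Omega> * (a ^ 3 / 3 + 0)) (at_right 0)"
    by (intro tendsto_intros) simp_all
  ultimately have "P * ((a - 3 * 0) ^ 3 / 3 - 0 * (1 + a\<^sup>2))\<^sup>2 \<le> torsional_rigidity \<Omega> * (a ^ 3 / 3 + 0)"
    using ev by (intro tendsto_le[OF trivial_limit_at_right_real])
  then have "(a ^ 3 / 3) * (P * (a ^ 3 / 3)) \<le> (a ^ 3 / 3) * torsional_rigidity \<Omega>"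
    by (simp add: power2_eq_square mult_ac)
  then have "P * (a ^ 3 / 3) \<le> torsional_rigidity \<Omega>"
    using a(1) by (subst (asm) mult_le_cancel_left_pos) auto
  then have "P\<^sup>2 * (P * (a ^ 3 / 3)) \<le> P\<^sup>2 * torsional_rigidity \<Omega>"
    by (rule mult_left_mono) simp
  then show ?thesis unfolding a(2) by (simp add: power_mult_distrib power2_eq_square power3_eq_cube mult_ac)
qed

section \<open>Upper bounds for the perimeter\<close>

lemma lborel_integrable_translate:
  fixes f :: "'a::euclidean_space \<Rightarrow> 'b::{banach, second_countable_topology}"
  assumes "integrable lborel f"
  shows "integrable lborel (\<lambda>x. f (x + c))"
proof -
  have "integrable (distr lborel borel ((+) c)) f"
    using assms by (simp add: lborel_distr_plus)
  then have "integrable lborel (\<lambda>x. f (c + x))"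
    by (rule integrable_distr[rotated]) simp
  then show ?thesis by (simp add: add.commute)
qed

text \<open>For each axis, the integral of the derivative over \<Omega> is a limit of difference
  quotients; moving the shift from the field to the indicator leaves the measure of the symmetric
  difference of \<Omega> and its shift, divided by the step. Summing over the axes is crude in
  general but asymptotically exact for thin slabs, whose boundary is almost entirely orthogonal to
  one axis.\<close>

lemma perimeter_le_shift_overlap:
  fixes \<Omega> :: "'a::euclidean_space set"
  assumes \<Omega>: "\<Omega> \<in> sets lborel" "emeasure lborel \<Omega> < \<infinity>"
    and overlap: "\<And>b. b \<in> Basis \<Longrightarrow> \<forall>\<^sub>F n in sequentially.
      measure lborel \<Omega> - C b * (1 / Suc n) \<le> measure lborel (\<Omega> \<inter> {x. x + (1 / Suc n) *\<^sub>R b \<in> \<Omega>})"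
  shows "perimeter \<Omega> \<le> ereal (\<Sum>b\<in>Basis. 2 * C b)"
  unfolding perimeter_def
proof (rule SUP_least)
  fix \<phi> :: "'a \<Rightarrow> 'a" assume "\<phi> \<in> {\<phi> \<in> C1c UNIV. \<forall>x. norm (\<phi> x) \<le> 1}"
  then have \<phi>: "\<phi> \<in> C1c UNIV" "\<And>x. norm (\<phi> x) \<le> 1" by auto
  note D = C1c_derivative[OF \<phi>(1)]
  let ?s = "indicator \<Omega> :: 'a \<Rightarrow> real"
  have s: "integrable lborel ?s"
    using \<Omega> by (intro integrable_real_indicator) auto
  have bound: "(LINT x|lborel. ?s x * (frechet_derivative \<phi> (at x) b \<bullet> b)) \<le> 2 * C b" if b: "b \<in> Basis" for b
  proof -
    let ?\<phi> = "\<lambda>x. \<phi> x \<bullet> b"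
    have \<phi>b: "?\<phi> \<in> C1c UNIV" by (rule C1c_inner[OF \<phi>(1)])
    have \<phi>b_le: "\<bar>?\<phi> x\<bar> \<le> 1" for x
      using Basis_le_norm[OF b, of "\<phi> x"] \<phi>(2)[of x] by simp
    have [measurable]: "?\<phi> \<in> borel_measurable borel"
      using C1_with_derivativeD(3)[OF C1c_derivative[OF \<phi>b]] by (rule borel_measurable_continuous_onI)
    have "\<forall>\<^sub>F n in sequentially. (LINT x|lborel. ?s x * ((?\<phi> (x + (1 / Suc n) *\<^sub>R b) - ?\<phi> x) / (1 / Suc n))) \<le> 2 * C b"
      using overlap[OF b]
    proof eventually_elim
      case (elim n)
      define t where "t = 1 / real (Suc n)"
      have t: "t > 0" by (simp add: t_def)
      let ?s' = "\<lambda>x. ?s (x + t *\<^sub>R b)" and ?p = "\<lambda>x. ?\<phi> (x + t *\<^sub>R b)"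
      have s': "integrable lborel ?s'" by (rule lborel_integrable_translate[OF s])
      have times: "integrable lborel (\<lambda>x. g x * p x)"
        if "integrable lborel g" "p \<in> borel_measurable borel" "\<And>x. \<bar>p x\<bar> \<le> 1" for g p :: "'a \<Rightarrow> real"
        by (rule Bochner_Integration.integrable_bound[OF that(1)])
           (use that in \<open>auto simp: abs_mult mult_left_le intro!: borel_measurable_times\<close>)
      have [measurable]: "?p \<in> borel_measurable borel" by measurable
      have i: "integrable lborel (\<lambda>x. ?s x * ?p x)" "integrable lborel (\<lambda>x. ?s x * ?\<phi> x)"
          "integrable lborel (\<lambda>x. ?s' x * ?p x)"
        using \<phi>b_le by (auto intro!: times s s')
      have ss': "integrable lborel (\<lambda>x. ?s x * ?s' x)"
        by (rule times[OF s]) (use borel_measurable_integrable[OF s'] in \<open>auto simp: indicator_def\<close>)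
      have tr: "(LINT x|lborel. ?s' x * ?p x) = (LINT x|lborel. ?s x * ?\<phi> x)"
        by (rule lborel_integral_translate) (use \<Omega> in measurable)
      have "(LINT x|lborel. ?s x * ((?p x - ?\<phi> x) / t)) = (LINT x|lborel. (?s x * ?p x - ?s x * ?\<phi> x) / t)"
        by (rule Bochner_Integration.integral_cong) (auto simp: right_diff_distrib)
      also have "\<dots> = (LINT x|lborel. ?s x * ?p x - ?s' x * ?p x) / t"
        unfolding integral_divide_zero Bochner_Integration.integral_diff[OF i(1,2)]
          Bochner_Integration.integral_diff[OF i(1,3)] tr ..
      finally have 1: "(LINT x|lborel. ?s x * ((?p x - ?\<phi> x) / t)) = (LINT x|lborel. ?s x * ?p x - ?s' x * ?p x) / t" .
      \<comment> \<open>The right-hand integrand is the indicator of the symmetric difference,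
        written so that its integral splits into two volumes and the overlap.\<close>
      have 2: "(LINT x|lborel. ?s x * ?p x - ?s' x * ?p x) \<le> (LINT x|lborel. ?s x + ?s' x - 2 * (?s x * ?s' x))"
      proof (rule integral_mono)
        fix x
        show "?s x * ?p x - ?s' x * ?p x \<le> ?s x + ?s' x - 2 * (?s x * ?s' x)"
          using \<phi>b_le[of "x + t *\<^sub>R b"] by (auto simp: indicator_def abs_le_iff)
      qed (use i s s' ss' in auto)
      have 3: "(LINT x|lborel. ?s' x) = measure lborel \<Omega>"
        using lborel_integral_translate[of ?s "t *\<^sub>R b"] \<Omega> by simp
      have "(\<lambda>x. ?s x * ?s' x) = indicator (\<Omega> \<inter> {x. x + t *\<^sub>R b \<in> \<Omega>})"
        by (auto simp: indicator_def)
      then have 4: "(LINT x|lborel. ?s x * ?s' x) = measure lborel (\<Omega> \<inter> {x. x + t *\<^sub>R b \<in> \<Omega>})"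
        by simp
      have 5: "(LINT x|lborel. ?s x + ?s' x - 2 * (?s x * ?s' x)) =
          2 * measure lborel \<Omega> - 2 * measure lborel (\<Omega> \<inter> {x. x + t *\<^sub>R b \<in> \<Omega>})"
        using s s' ss' by (simp add: 3 4)
      have "(LINT x|lborel. ?s x * ?p x - ?s' x * ?p x) \<le> 2 * C b * t"
        using 2 elim unfolding 5 t_def[symmetric] by simp
      then show ?case
        unfolding t_def[symmetric] 1 using t by (simp add: pos_divide_le_eq)
    qed
    then have "(LINT x|lborel. ?s x * frechet_derivative ?\<phi> (at x) b) \<le> 2 * C b"
      using tendsto_upperbound[OF integral_difference_quotient_limit[OF \<phi>b s, of b]] by simp
    then show ?thesis unfolding C1_with_derivativeD(5)[OF C1_with_derivative_inner[OF D]] .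
  qed
  have "(LINT x:\<Omega>|lborel. divergence \<phi> x) =
      (LINT x|lborel. (\<Sum>b\<in>Basis. ?s x * (frechet_derivative \<phi> (at x) b \<bullet> b)))"
    unfolding set_lebesgue_integral_def divergence_def real_scaleR_def sum_distrib_left ..
  also have "\<dots> = (\<Sum>b\<in>Basis. LINT x|lborel. ?s x * (frechet_derivative \<phi> (at x) b \<bullet> b))"
  proof (rule Bochner_Integration.integral_sum)
    show "integrable lborel (\<lambda>x. ?s x * (frechet_derivative \<phi> (at x) b \<bullet> b))" for b
      using integrable_mult_indicator[OF \<Omega>(1) integrable_inner_left[OF C1c_integrable(2)[OF \<phi>(1), of b], of b]]
      by simp
  qed
  also have "\<dots> \<le> (\<Sum>b\<in>Basis. 2 * C b)" using bound by (rule sum_mono)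
  finally show "ereal (LINT x:\<Omega>|lborel. divergence \<phi> x) \<le> ereal (\<Sum>b\<in>Basis. 2 * C b)" by simp
qed

text \<open>A convex set containing the ball of radius \<open>r\<close> around \<open>z\<close> contains its own contraction
  by the factor \<open>1 - h / r\<close> towards \<open>z\<close>, together with the translates of the latter by at most \<open>h\<close>.\<close>

lemma convex_shift_overlap:
  fixes A :: "'a::euclidean_space set"
  assumes "convex A" "open A" "emeasure lborel A < \<infinity>" "cball z r \<subseteq> A" "norm e \<le> 1" "0 < h" "h < r"
  shows "measure lborel A - DIM('a) / r * measure lborel A * h \<le> measure lborel (A \<inter> {x. x + h *\<^sub>R e \<in> A})"
proof -
  define s where "s = h / r"
  have s: "0 < s" "s < 1" using assms(6,7) by (simp_all add: s_def)
  let ?T = "\<lambda>x. (1 - s) *\<^sub>R x + s *\<^sub>R z"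
  have sub: "?T ` A \<subseteq> A \<inter> {x. x + h *\<^sub>R e \<in> A}"
  proof (rule image_subsetI)
    fix x assume x: "x \<in> A"
    have "z + r *\<^sub>R e \<in> cball z r"
      using assms(5-7) by (simp add: dist_norm mult_left_le)
    then have "(1 - s) *\<^sub>R x + s *\<^sub>R (z + r *\<^sub>R e) \<in> A"
      using s x assms(4) by (intro convexD[OF assms(1)]) auto
    moreover have "s *\<^sub>R (z + r *\<^sub>R e) = s *\<^sub>R z + h *\<^sub>R e"
      using assms(6,7) by (simp add: s_def scaleR_add_right)
    moreover have "z \<in> A" using assms(4,6,7) by auto
    then have "(1 - s) *\<^sub>R x + s *\<^sub>R z \<in> A"
      using s x by (intro convexD[OF assms(1)]) auto
    ultimately show "?T x \<in> A \<inter> {x. x + h *\<^sub>R e \<in> A}"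
      by (simp add: add.assoc)
  qed
  have "open (?T ` A)"
    using open_affinity[OF assms(2), of "1 - s" "s *\<^sub>R z"] s by (simp add: add.commute)
  \<comment> \<open>The contraction scales volume by (1 - s)^d \<ge> 1 - d s, which is linear in the
    shift h = s r.\<close>
  have "1 + DIM('a) * (- s) \<le> (1 + - s) ^ DIM('a)"
    by (rule Bernoulli_inequality) (use s in simp)
  then have "(1 - DIM('a) * s) * measure lborel A \<le> (1 - s) ^ DIM('a) * measure lborel A"
    by (intro mult_right_mono) auto
  also have "\<dots> = measure lebesgue (?T ` A)"
    using measure_lebesgue_affine[of "1 - s" "s *\<^sub>R z" A] s assms(2) by simp
  also have "\<dots> = measure lborel (?T ` A)"
    using \<open>open (?T ` A)\<close> by simp
  also have "\<dots> \<le> measure lborel (A \<inter> {x. x + h *\<^sub>R e \<in> A})"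
  proof (rule measure_mono_fmeasurable[OF sub])
    have "open {x. x + h *\<^sub>R e \<in> A}"
      using open_vimage[OF assms(2), of "\<lambda>x. x + h *\<^sub>R e"] by (simp add: vimage_def continuous_intros)
    then have o: "open (A \<inter> {x. x + h *\<^sub>R e \<in> A})" using assms(2) by blast
    have "emeasure lborel (A \<inter> {x. x + h *\<^sub>R e \<in> A}) \<le> emeasure lborel A"
      using assms(2) by (intro emeasure_mono) auto
    then show "A \<inter> {x. x + h *\<^sub>R e \<in> A} \<in> fmeasurable lborel"
      using o assms(3) by (intro fmeasurableI) auto
  qed (use \<open>open (?T ` A)\<close> in auto)
  finally show ?thesis by (simp add: s_def algebra_simps)
qed

lemma eventually_inverse_Suc_less:
  assumes "r > 0"
  shows "\<forall>\<^sub>F n in sequentially. 1 / real (Suc n) < r"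
  using order_tendstoD(2)[OF LIMSEQ_inverse_real_of_nat assms] by (simp add: inverse_eq_divide)

text \<open>The bound 2 d^2 |\<Omega>| / r obtained here is crude; its purpose is to exclude the
  value \<infinity>, so that \<open>F_half\<close> becomes a real quotient.\<close>

lemma convex_perimeter_finite:
  fixes \<Omega> :: "'a::euclidean_space set"
  assumes "open \<Omega>" "convex \<Omega>" "\<Omega> \<noteq> {}" "bounded \<Omega>"
  obtains p where "perimeter \<Omega> = ereal p" "0 \<le> p"
proof -
  obtain z r where r: "r > 0" "cball z r \<subseteq> \<Omega>"
    using assms(1,3) open_contains_cball by blast
  have fin: "emeasure lborel \<Omega> < \<infinity>" by (rule emeasure_bounded_finite[OF assms(4)])
  have "perimeter \<Omega> \<le> ereal (\<Sum>b\<in>(Basis::'a set). 2 * (DIM('a) / r * measure lborel \<Omega>))"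
  proof (rule perimeter_le_shift_overlap[OF _ fin])
    fix b :: 'a assume "b \<in> Basis"
    then show "\<forall>\<^sub>F n in sequentially. measure lborel \<Omega> - DIM('a) / r * measure lborel \<Omega> * (1 / Suc n) \<le>
        measure lborel (\<Omega> \<inter> {x. x + (1 / Suc n) *\<^sub>R b \<in> \<Omega>})"
      by (intro eventually_mono[OF eventually_inverse_Suc_less[OF r(1)]]
          convex_shift_overlap[OF assms(2,1) fin r(2)]) auto
  qed (use assms(1) in simp)
  then show ?thesis
    using that perimeter_nonneg[of \<Omega>] by (cases "perimeter \<Omega>") auto
qed

text \<open>Convexity carries a ball around z, shrunk by at most half, along the first half of a
  segment to a far point y. If |y - z| \<ge> 2 N r, then N disjoint balls of radius r / 2 fit, and N
  is arbitrary.\<close>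

lemma finite_measure_convex_imp_bounded:
  fixes \<Omega> :: "'a::euclidean_space set"
  assumes "open \<Omega>" "convex \<Omega>" "emeasure lborel \<Omega> < \<infinity>"
  shows "bounded \<Omega>"
proof (rule ccontr)
  assume unbounded: "\<not> bounded \<Omega>"
  then obtain z where "z \<in> \<Omega>" by (metis bounded_empty ex_in_conv)
  then obtain r where r: "r > 0" "ball z r \<subseteq> \<Omega>"
    using assms(1) open_contains_ball by blast
  define v where "v = measure lborel (ball (0::'a) (r / 2))"
  have v: "v > 0" unfolding v_def using r(1) by (simp add: content_ball)
  have "real N * v \<le> measure lborel \<Omega>" if "N > 0" for N :: nat
  proof -
    have "\<exists>y\<in>\<Omega>. 2 * N * r \<le> norm (y - z)"
    proof (rule ccontr)
      assume "\<not> ?thesis"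
      then have "\<Omega> \<subseteq> ball z (2 * N * r)" by (force simp: dist_norm norm_minus_commute)
      then show False using unbounded bounded_subset bounded_ball by blast
    qed
    then obtain y where y: "y \<in> \<Omega>" "2 * N * r \<le> norm (y - z)" by blast
    define c where "c k = z + (real k / (2 * N)) *\<^sub>R (y - z)" for k :: nat
    have sub: "ball (c k) (r / 2) \<subseteq> \<Omega>" if "k < N" for k
    proof
      fix x assume x: "x \<in> ball (c k) (r / 2)"
      define \<tau> where "\<tau> = real k / (2 * N)"
      have ck: "c k = z + \<tau> *\<^sub>R (y - z)" unfolding c_def \<tau>_def ..
      have \<tau>: "0 \<le> \<tau>" "\<tau> \<le> 1 / 2" using that by (simp_all add: \<tau>_def field_simps)
      \<comment> \<open>Chosen so that x = (1 - \<tau>) (z + w) + \<tau> y. Since 1 - \<tau> \<ge>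
        1/2, the length of w is at most twice the distance from x to \<open>c k\<close>, hence less
        than r.\<close>
      define w where "w = (1 / (1 - \<tau>)) *\<^sub>R (x - c k)"
      have "norm w \<le> 2 * norm (x - c k)"
      proof -
        have "\<bar>1 / (1 - \<tau>)\<bar> \<le> 2" using \<tau> by (simp add: divide_simps)
        from mult_right_mono[OF this norm_ge_zero] show ?thesis unfolding w_def norm_scaleR .
      qed
      then have "z + w \<in> ball z r" using x by (simp add: dist_norm norm_minus_commute)
      then have "(1 - \<tau>) *\<^sub>R (z + w) + \<tau> *\<^sub>R y \<in> \<Omega>"
        using \<tau> y(1) r(2) by (intro convexD[OF assms(2)]) auto
      moreover have "(1 - \<tau>) *\<^sub>R w = x - c k" using \<tau> by (simp add: w_def)
      then have "(1 - \<tau>) *\<^sub>R (z + w) + \<tau> *\<^sub>R y = x"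
        unfolding ck by (simp add: algebra_simps)
      ultimately show "x \<in> \<Omega>" by simp
    qed
    have disj: "disjoint_family_on (\<lambda>k. ball (c k) (r / 2)) {..<N}"
      unfolding disjoint_family_on_def
    proof (intro ballI impI)
      fix i j :: nat assume "i \<noteq> j"
      have "c i - c j = ((real i - real j) / (2 * N)) *\<^sub>R (y - z)"
        by (simp add: c_def scaleR_left_diff_distrib[symmetric] diff_divide_distrib)
      then have "norm (c i - c j) = \<bar>real i - real j\<bar> * (norm (y - z) / (2 * N))"
        by (simp add: abs_divide)
      moreover have "1 \<le> \<bar>real i - real j\<bar>" using \<open>i \<noteq> j\<close> by linarith
      moreover have "r \<le> norm (y - z) / (2 * N)"
        using y(2) \<open>N > 0\<close> by (simp add: field_simps)
      ultimately have "r \<le> dist (c i) (c j)"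
        using mult_mono[of 1 "\<bar>real i - real j\<bar>" r "norm (y - z) / (2 * N)"] r(1) by (simp add: dist_norm)
      then show "ball (c i) (r / 2) \<inter> ball (c j) (r / 2) = {}"
        by (intro disjoint_ballI) simp
    qed
    have "real N * v = (\<Sum>k<N. measure lborel (ball (c k) (r / 2)))"
      using r(1) by (simp add: v_def content_ball)
    also have "\<dots> = measure lborel (\<Union>k<N. ball (c k) (r / 2))"
    proof (rule measure_finite_Union[symmetric])
      show "emeasure lborel (ball (c k) (r / 2)) \<noteq> \<infinity>" for k
        using emeasure_lborel_ball_finite by (rule less_imp_neq)
    qed (use disj in auto)
    also have "\<dots> \<le> measure lborel \<Omega>"
    proof (rule measure_mono_fmeasurable)
      show "(\<Union>k<N. ball (c k) (r / 2)) \<subseteq> \<Omega>" using sub by blast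
      show "\<Omega> \<in> fmeasurable lborel" using assms(1,3) by (intro fmeasurableI) simp_all
    qed (simp add: open_UN)
    finally show ?thesis .
  qed
  moreover obtain N :: nat where "measure lborel \<Omega> < real N * v"
    using reals_Archimedean3[OF v] by blast
  moreover from this have "N > 0" by (cases N) (auto simp: not_less)
  ultimately show False by (meson not_le)
qed

section \<open>Thin slabs\<close>

lemma measure_lborel_Times:
  fixes A :: "'a::euclidean_space set" and B :: "'b::euclidean_space set"
  assumes "A \<in> sets borel" "B \<in> sets borel"
  shows "measure lborel (A \<times> B) = measure lborel A * measure lborel B"
proof -
  have "emeasure lborel (A \<times> B) = emeasure lborel A * emeasure lborel B"
    unfolding lborel_prod[symmetric] using assms by (intro lborel.emeasure_pair_measure_Times) auto
  then show ?thesis by (simp add: measure_def enn2real_mult)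
qed

lemma sum_Basis_prod_real:
  fixes f :: "'a::euclidean_space \<times> real \<Rightarrow> real"
  shows "sum f Basis = (\<Sum>u\<in>Basis. f (u, 0)) + f (0, 1)"
proof -
  have "inj_on (\<lambda>u::'a. (u, 0::real)) Basis" by (auto intro!: inj_onI)
  then show ?thesis
    unfolding Basis_prod_def
    by (subst sum.union_disjoint) (auto simp: sum.reindex)
qed

abbreviation slab :: "'a::euclidean_space set \<Rightarrow> real \<Rightarrow> ('a \<times> real) set" where
  "slab A \<epsilon> \<equiv> A \<times> {- \<epsilon> / 2 <..< \<epsilon> / 2}"

lemma slab_properties:
  fixes A :: "'a::euclidean_space set"
  assumes "open A" "convex A" "A \<noteq> {}" "bounded A" "\<epsilon> > 0"
  shows "open (slab A \<epsilon>)" "convex (slab A \<epsilon>)" "slab A \<epsilon> \<noteq> {}" "bounded (slab A \<epsilon>)"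
    "measure lborel (slab A \<epsilon>) = measure lborel A * \<epsilon>"
  using assms by (auto intro!: open_Times convex_Times bounded_Times simp: measure_lborel_Times)

lemma open_measure_pos:
  fixes \<Omega> :: "'a::euclidean_space set"
  assumes "open \<Omega>" "\<Omega> \<noteq> {}" "emeasure lborel \<Omega> < \<infinity>"
  shows "0 < measure lborel \<Omega>"
proof -
  obtain z r where r: "r > 0" "ball z r \<subseteq> \<Omega>"
    using assms(1,2) open_contains_ball by blast
  have "0 < measure lborel (ball z r)" using r(1) by simp
  also have "\<dots> \<le> measure lborel \<Omega>"
    using r(2) assms by (intro measure_mono_fmeasurable fmeasurableI) auto
  finally show ?thesis .
qed

text \<open>A shift along A loses \<epsilon> times the volume that A loses, a shift by t across the
  slab loses exactly |A| t. The constant K is uniform in \<epsilon> because the inner ball is taken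
  in A; a ball inside the slab would have radius at most \<epsilon> / 2 and spoil the bound.\<close>

lemma slab_perimeter:
  fixes A :: "'a::euclidean_space set"
  assumes A: "open A" "convex A" "A \<noteq> {}" "bounded A"
  obtains K where "\<And>\<epsilon>. \<epsilon> > 0 \<Longrightarrow> perimeter (slab A \<epsilon>) \<le> ereal (2 * measure lborel A + \<epsilon> * K)"
proof -
  obtain z r where r: "r > 0" "cball z r \<subseteq> A"
    using A(1,3) open_contains_cball by blast
  have fin: "emeasure lborel A < \<infinity>" by (rule emeasure_bounded_finite[OF A(4)])
  define c where "c = DIM('a) / r * measure lborel A"
  have "perimeter (slab A \<epsilon>) \<le> ereal (2 * measure lborel A + \<epsilon> * (DIM('a) * (2 * c)))" if \<epsilon>: "\<epsilon> > 0" for \<epsilon>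
  proof -
    note S = slab_properties[OF A \<epsilon>]
    define C :: "'a \<times> real \<Rightarrow> real" where "C p = (if snd p = 0 then \<epsilon> * c else measure lborel A)" for p
    have "perimeter (slab A \<epsilon>) \<le> ereal (\<Sum>b\<in>Basis. 2 * C b)"
    proof (rule perimeter_le_shift_overlap[OF _ emeasure_bounded_finite[OF S(4)]])
      show "slab A \<epsilon> \<in> sets lborel" using S(1) by simp
      fix b :: "'a \<times> real" assume "b \<in> Basis"
      then consider u where "u \<in> Basis" "b = (u, 0)" | "b = (0, 1)"
        by (auto simp: Basis_prod_def)
      then show "\<forall>\<^sub>F n in sequentially. measure lborel (slab A \<epsilon>) - C b * (1 / Suc n) \<le>
          measure lborel (slab A \<epsilon> \<inter> {x. x + (1 / Suc n) *\<^sub>R b \<in> slab A \<epsilon>})"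
      proof cases
        case 1
        show ?thesis
          using eventually_inverse_Suc_less[OF r(1)]
        proof eventually_elim
          case (elim n)
          define t where "t = 1 / real (Suc n)"
          have t: "0 < t" "t < r" using elim by (simp_all add: t_def)
          have "open {x. x + t *\<^sub>R u \<in> A}"
            using open_vimage[OF A(1), of "\<lambda>x. x + t *\<^sub>R u"] by (simp add: vimage_def continuous_intros)
          then have "open (A \<inter> {x. x + t *\<^sub>R u \<in> A})" using A(1) by blast
          moreover have "slab A \<epsilon> \<inter> {x. x + t *\<^sub>R b \<in> slab A \<epsilon>} = slab (A \<inter> {x. x + t *\<^sub>R u \<in> A}) \<epsilon>"
            using 1 by auto
          ultimately have "measure lborel (slab A \<epsilon> \<inter> {x. x + t *\<^sub>R b \<in> slab A \<epsilon>}) =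
              measure lborel (A \<inter> {x. x + t *\<^sub>R u \<in> A}) * \<epsilon>"
            using \<epsilon> by (simp add: measure_lborel_Times)
          moreover have "measure lborel A - c * t \<le> measure lborel (A \<inter> {x. x + t *\<^sub>R u \<in> A})"
            unfolding c_def using 1 by (intro convex_shift_overlap[OF A(2,1) fin r(2) _ t]) simp
          then have "(measure lborel A - c * t) * \<epsilon> \<le> measure lborel (A \<inter> {x. x + t *\<^sub>R u \<in> A}) * \<epsilon>"
            using \<epsilon> by (intro mult_right_mono) auto
          ultimately show ?case
            unfolding t_def[symmetric] using 1 S(5) by (simp add: C_def algebra_simps)
        qed
      next
        case 2
        show ?thesis
          using eventually_inverse_Suc_less[OF \<epsilon>]
        proof eventually_elim
          case (elim n)
          define t where "t = 1 / real (Suc n)"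
          have t: "0 < t" "t < \<epsilon>" using elim by (simp_all add: t_def)
          have "slab A \<epsilon> \<inter> {x. x + t *\<^sub>R b \<in> slab A \<epsilon>} = A \<times> {- \<epsilon> / 2 <..< \<epsilon> / 2 - t}"
            using 2 t by auto
          then have "measure lborel (slab A \<epsilon> \<inter> {x. x + t *\<^sub>R b \<in> slab A \<epsilon>}) = measure lborel A * (\<epsilon> - t)"
            using t A(1) by (simp add: measure_lborel_Times)
          then show ?case
            unfolding t_def[symmetric] using 2 S(5) by (simp add: C_def algebra_simps)
        qed
      qed
    qed
    also have "(\<Sum>b\<in>Basis. 2 * C b) = 2 * measure lborel A + \<epsilon> * (DIM('a) * (2 * c))"
      unfolding sum_Basis_prod_real by (simp add: C_def)
    finally show ?thesis .
  qed
  then show ?thesis by (rule that)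
qed

text \<open>The constant is the second moment of the thin coordinate t. Nothing is lost to leading
  order, because - t is the derivative of the one-dimensional torsion function of the interval, so
  Cauchy-Schwarz is nearly an equality.\<close>

lemma slab_torsional_rigidity:
  fixes A :: "'a::euclidean_space set"
  assumes A: "open A" "convex A" "A \<noteq> {}" "bounded A" and \<epsilon>: "\<epsilon> > 0"
  shows "torsional_rigidity (slab A \<epsilon>) \<le> measure lborel A * \<epsilon> ^ 3 / 12"
proof -
  note S = slab_properties[OF A \<epsilon>]
  have sets: "slab A \<epsilon> \<in> sets lborel" using S(1) by simp
  have fin: "emeasure lborel (slab A \<epsilon>) < \<infinity>" by (rule emeasure_bounded_finite[OF S(4)])
  let ?J = "{- \<epsilon> / 2 <..< \<epsilon> / 2}"
  have interval: "(LINT y|lborel. indicator ?J y * y\<^sup>2) = \<epsilon> ^ 3 / 12"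
  proof -
    have "(LBINT y=- \<epsilon> / 2..\<epsilon> / 2. y\<^sup>2) = (\<epsilon> / 2) ^ 3 / 3 - (- \<epsilon> / 2) ^ 3 / 3"
      by (rule interval_integral_FTC_finite)
         (auto intro!: continuous_intros derivative_eq_intros
           simp: has_real_derivative_iff_has_vector_derivative[symmetric] power2_eq_square)
    then show ?thesis
      using \<epsilon> by (simp add: interval_lebesgue_integral_def set_lebesgue_integral_def field_simps power3_eq_cube)
  qed
  have eq: "(LINT x:slab A \<epsilon>|lborel. (x \<bullet> (0, 1))\<^sup>2) = measure lborel A * (\<epsilon> ^ 3 / 12)"
  proof -
    have "set_integrable lborel (slab A \<epsilon>) (\<lambda>x. (x \<bullet> (0, 1))\<^sup>2)"
    proof (rule set_integrable_bounded_measurable[OF sets fin, where B = "\<epsilon>\<^sup>2"])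
      show "set_borel_measurable lborel (slab A \<epsilon>) (\<lambda>x. (x \<bullet> (0, 1))\<^sup>2)"
        by (intro set_borel_measurable_continuous_UNIV[OF sets] continuous_intros)
      show "norm ((x \<bullet> (0, 1))\<^sup>2) \<le> \<epsilon>\<^sup>2" if "x \<in> slab A \<epsilon>" for x
        using that power_mono[of "\<bar>snd x\<bar>" \<epsilon> 2] \<epsilon> by (auto simp: inner_prod_def)
    qed
    then have i: "integrable (lborel \<Otimes>\<^sub>M lborel) (\<lambda>x. indicator (slab A \<epsilon>) x *\<^sub>R (x \<bullet> (0, 1))\<^sup>2)"
      by (simp add: set_integrable_def lborel_prod)
    have "(LINT x:slab A \<epsilon>|lborel. (x \<bullet> (0, 1))\<^sup>2) =
        (LINT x|lborel. (LINT y|lborel. indicator (slab A \<epsilon>) (x, y) *\<^sub>R ((x, y) \<bullet> (0, 1))\<^sup>2))"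
      unfolding lborel_pair.integral_fst'[OF i] by (simp add: set_lebesgue_integral_def lborel_prod)
    also have "\<dots> = (LINT x|lborel. indicator A x * (\<epsilon> ^ 3 / 12))"
      unfolding interval[symmetric] by (simp add: indicator_times inner_prod_def mult.assoc)
    also have "\<dots> = measure lborel A * (\<epsilon> ^ 3 / 12)" by simp
    finally show ?thesis .
  qed
  have "(0, 1) \<in> (Basis :: ('a \<times> real) set)" by (simp add: Basis_prod_def)
  note bound = C1c_integral_via_coordinate[OF sets fin S(4) this]
  have "torsional_rigidity (slab A \<epsilon>) \<le> measure lborel A * (\<epsilon> ^ 3 / 12)"
  proof (rule torsional_rigidity_bounds(2)[OF S(1,4)])
    show "(LINT x:slab A \<epsilon>|lborel. \<phi> x)\<^sup>2 \<le>
        measure lborel A * (\<epsilon> ^ 3 / 12) * (LINT x:slab A \<epsilon>|lborel. (norm (grad \<phi> x))\<^sup>2)"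
      if "\<phi> \<in> C1c (slab A \<epsilon>)" for \<phi>
      using bound[OF that] unfolding eq .
    show "0 \<le> measure lborel A * (\<epsilon> ^ 3 / 12)" using \<epsilon> by simp
  qed
  then show ?thesis by simp
qed

section \<open>The functional \<open>F_half\<close>: lower bound, slabs and the infimum\<close>

lemma F_half_eq:
  fixes \<Omega> :: "'a::euclidean_space set"
  assumes "open \<Omega>" "bounded \<Omega>" "perimeter \<Omega> = ereal p" "0 < measure lborel \<Omega>"
  shows "F_half \<Omega> = ereal (p * sqrt (torsional_rigidity \<Omega>) / sqrt (measure lborel \<Omega> ^ 3))"
proof -
  let ?V = "measure lborel \<Omega>"
  have "?V powr (3 / 2) = (?V powr 3) powr (1 / 2)" by (simp only: powr_powr) simp
  also have "\<dots> = sqrt (?V ^ 3)" using assms(4) by (simp add: powr_half_sqrt powr_numeral)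
  finally have "?V powr (3 / 2) = sqrt (?V ^ 3)" .
  then show ?thesis
    using torsional_rigidity_bounds(3)[OF assms(1,2)] assms(4) by (simp add: F_half_def assms(3) powr_half_sqrt)
qed

lemma three_powr_minus_half: "3 powr (- 1 / 2) = 1 / sqrt (3::real)"
  using powr_minus[of "3::real" "1 / 2"] by (simp add: powr_half_sqrt inverse_eq_divide)

lemma F_half_lower_bound:
  fixes \<Omega> :: "'a::euclidean_space set"
  assumes \<Omega>: "open \<Omega>" "convex \<Omega>" "\<Omega> \<noteq> {}" "bounded \<Omega>"
  shows "ereal (3 powr (- 1 / 2)) \<le> F_half \<Omega>"
proof -
  let ?V = "measure lborel \<Omega>" and ?T = "torsional_rigidity \<Omega>"
  obtain p where p: "perimeter \<Omega> = ereal p" "0 \<le> p"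
    using convex_perimeter_finite[OF \<Omega>] by metis
  have V: "0 < ?V" by (rule open_measure_pos[OF \<Omega>(1,3) emeasure_bounded_finite[OF \<Omega>(4)]])
  have T: "0 \<le> ?T" by (rule torsional_rigidity_bounds(3)[OF \<Omega>(1,4)])
  \<comment> \<open>The inequality is available for positive P, and p is only known to be
    nonnegative, so it is applied to q > p and q decreases to p.\<close>
  have "?V ^ 3 / 3 \<le> p\<^sup>2 * ?T"
  proof (rule tendsto_lowerbound)
    show "((\<lambda>q. q\<^sup>2 * ?T) \<longlongrightarrow> p\<^sup>2 * ?T) (at_right p)" by (intro tendsto_intros)
    show "\<forall>\<^sub>F q in at_right p. ?V ^ 3 / 3 \<le> q\<^sup>2 * ?T"
      using eventually_at_right_less[of p]
    proof eventually_elim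
      case (elim q)
      then show ?case
        using p by (intro torsion_perimeter_volume_inequality[OF \<Omega>]) auto
    qed
  qed simp
  then have "sqrt (?V ^ 3 / 3) \<le> sqrt (p\<^sup>2 * ?T)" by (rule real_sqrt_le_mono)
  then have "sqrt (?V ^ 3) / sqrt 3 \<le> p * sqrt ?T"
    using p(2) by (simp add: real_sqrt_mult real_sqrt_divide)
  then have "1 / sqrt 3 \<le> p * sqrt ?T / sqrt (?V ^ 3)"
    using V by (simp add: field_simps)
  then show ?thesis
    unfolding F_half_eq[OF \<Omega>(1,4) p(1) V] three_powr_minus_half by simp
qed

lemma F_half_slab_upper_bound:
  fixes A :: "'a::euclidean_space set"
  assumes A: "open A" "convex A" "A \<noteq> {}" "bounded A" and \<epsilon>: "\<epsilon> > 0"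
    and K: "perimeter (slab A \<epsilon>) \<le> ereal (2 * measure lborel A + \<epsilon> * K)"
  shows "F_half (slab A \<epsilon>) \<le> ereal ((2 * measure lborel A + \<epsilon> * K) / (measure lborel A * sqrt 12))"
proof -
  note S = slab_properties[OF A \<epsilon>]
  define a where "a = measure lborel A"
  have a: "a > 0"
    unfolding a_def by (rule open_measure_pos[OF A(1,3) emeasure_bounded_finite[OF A(4)]])
  obtain p where p: "perimeter (slab A \<epsilon>) = ereal p" "0 \<le> p"
    using convex_perimeter_finite[OF S(1-4)] by metis
  have V: "measure lborel (slab A \<epsilon>) = a * \<epsilon>" using S(5) by (simp add: a_def)
  have p_le: "p \<le> 2 * a + \<epsilon> * K" using K p(1) by (simp add: a_def)
  \<comment> \<open>The bound a \<epsilon>^3 / 12 rewritten through the slab volume a \<epsilon>, so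
    that the volume cancels in the quotient and the leading value is 2 a / (a sqrt 12) = 1 / sqrt
    3.\<close>
  have "torsional_rigidity (slab A \<epsilon>) \<le> (a * \<epsilon>) ^ 3 / (a\<^sup>2 * 12)"
    using slab_torsional_rigidity[OF A \<epsilon>] a by (simp add: a_def field_simps power2_eq_square power3_eq_cube)
  then have "sqrt (torsional_rigidity (slab A \<epsilon>)) \<le> sqrt ((a * \<epsilon>) ^ 3 / (a\<^sup>2 * 12))"
    by (rule real_sqrt_le_mono)
  also have "\<dots> = sqrt ((a * \<epsilon>) ^ 3) / (a * sqrt 12)"
    using a by (simp only: real_sqrt_divide real_sqrt_mult real_sqrt_abs abs_of_pos)
  finally have "p * sqrt (torsional_rigidity (slab A \<epsilon>)) \<le> (2 * a + \<epsilon> * K) * (sqrt ((a * \<epsilon>) ^ 3) / (a * sqrt 12))"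
    using p_le p(2) torsional_rigidity_bounds(3)[OF S(1,4)] by (intro mult_mono) auto
  then have "p * sqrt (torsional_rigidity (slab A \<epsilon>)) / sqrt ((a * \<epsilon>) ^ 3) \<le>
      (2 * a + \<epsilon> * K) * (sqrt ((a * \<epsilon>) ^ 3) / (a * sqrt 12)) / sqrt ((a * \<epsilon>) ^ 3)"
    using a \<epsilon> by (intro divide_right_mono) auto
  also have "\<dots> = (2 * a + \<epsilon> * K) / (a * sqrt 12)" using a \<epsilon> by simp
  finally have bound: "p * sqrt (torsional_rigidity (slab A \<epsilon>)) / sqrt ((a * \<epsilon>) ^ 3) \<le>
      (2 * a + \<epsilon> * K) / (a * sqrt 12)" .
  have pos: "0 < measure lborel (slab A \<epsilon>)" using V a \<epsilon> by simp
  from bound show ?thesis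
    unfolding F_half_eq[OF S(1,4) p(1) pos] V a_def[symmetric] by simp
qed

lemma F_half_slab_tendsto:
  fixes A :: "'a::euclidean_space set"
  assumes A: "open A" "convex A" "A \<noteq> {}" "bounded A"
  shows "((\<lambda>\<epsilon>. F_half (slab A \<epsilon>)) \<longlongrightarrow> ereal (3 powr (- 1 / 2))) (at_right 0)"
proof -
  let ?a = "measure lborel A"
  have a: "?a > 0" by (rule open_measure_pos[OF A(1,3) emeasure_bounded_finite[OF A(4)]])
  obtain K where K: "\<And>\<epsilon>. \<epsilon> > 0 \<Longrightarrow> perimeter (slab A \<epsilon>) \<le> ereal (2 * ?a + \<epsilon> * K)"
    using slab_perimeter[OF A] by metis
  have pos: "\<forall>\<^sub>F \<epsilon> in at_right (0::real). 0 < \<epsilon>" by (rule eventually_at_right_less)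
  show ?thesis
  proof (rule tendsto_sandwich)
    show "\<forall>\<^sub>F \<epsilon> in at_right 0. ereal (3 powr (- 1 / 2)) \<le> F_half (slab A \<epsilon>)"
      using pos by eventually_elim (intro F_half_lower_bound slab_properties A)
    show "\<forall>\<^sub>F \<epsilon> in at_right 0. F_half (slab A \<epsilon>) \<le> ereal ((2 * ?a + \<epsilon> * K) / (?a * sqrt 12))"
      using pos by eventually_elim (intro F_half_slab_upper_bound A K)
    have "((\<lambda>\<epsilon>. (2 * ?a + \<epsilon> * K) / (?a * sqrt 12)) \<longlongrightarrow> (2 * ?a + 0 * K) / (?a * sqrt 12)) (at_right 0)"
      using a by (intro tendsto_intros) auto
    moreover have "(2 * ?a + 0 * K) / (?a * sqrt 12) = 3 powr (- 1 / 2)"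
    proof -
      have "sqrt 12 = 2 * sqrt (3::real)" using real_sqrt_mult[of 4 3] by simp
      then show ?thesis unfolding three_powr_minus_half using a by simp
    qed
    ultimately show "((\<lambda>\<epsilon>. ereal ((2 * ?a + \<epsilon> * K) / (?a * sqrt 12))) \<longlongrightarrow> ereal (3 powr (- 1 / 2))) (at_right 0)"
      by simp
  qed simp
qed

text \<open>The type \<open>'a \<times> real\<close> with \<open>'a\<close> Euclidean encodes
  dimension at least 2 and singles out the thin direction. The infimum is bounded from above by
  slabs over the unit ball of \<open>'a\<close>.\<close>

theorem proposition3p2:
  shows "(INF \<Omega> \<in> (A_convex :: ('a::euclidean_space \<times> real) set set). F_half \<Omega>)
           = ereal (3 powr (- 1 / 2)) \<and>
         (\<forall>A :: 'a set. A \<noteq> {} \<and> bounded A \<and> open A \<and> convex A \<longrightarrow>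
            ((\<lambda>\<epsilon>::real. F_half (A \<times> {- \<epsilon> / 2 <..< \<epsilon> / 2})) \<longlongrightarrow> ereal (3 powr (- 1 / 2))) (at_right 0))"
proof (intro conjI allI impI antisym)
  show "((\<lambda>\<epsilon>::real. F_half (slab A \<epsilon>)) \<longlongrightarrow> ereal (3 powr (- 1 / 2))) (at_right 0)"
    if "A \<noteq> {} \<and> bounded A \<and> open A \<and> convex A" for A :: "'a set"
    using that by (intro F_half_slab_tendsto) auto
  show "ereal (3 powr (- 1 / 2)) \<le> (INF \<Omega> \<in> (A_convex :: ('a \<times> real) set set). F_half \<Omega>)"
  proof (rule INF_greatest)
    fix \<Omega> :: "('a \<times> real) set" assume "\<Omega> \<in> A_convex"
    then have "\<Omega> \<noteq> {}" "open \<Omega>" "convex \<Omega>" "emeasure lborel \<Omega> < \<infinity>"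
      by (auto simp: A_convex_def)
    then show "ereal (3 powr (- 1 / 2)) \<le> F_half \<Omega>"
      by (intro F_half_lower_bound finite_measure_convex_imp_bounded)
  qed
  let ?A = "ball (0::'a) 1"
  have A: "open ?A" "convex ?A" "?A \<noteq> {}" "bounded ?A" by auto
  show "(INF \<Omega> \<in> (A_convex :: ('a \<times> real) set set). F_half \<Omega>) \<le> ereal (3 powr (- 1 / 2))"
  proof (rule tendsto_lowerbound[OF F_half_slab_tendsto[OF A]])
    show "\<forall>\<^sub>F \<epsilon> in at_right 0. (INF \<Omega> \<in> (A_convex :: ('a \<times> real) set set). F_half \<Omega>) \<le> F_half (slab ?A \<epsilon>)"
      using eventually_at_right_less[of "0::real"]
    proof eventually_elim
      case (elim \<epsilon>)
      note S = slab_properties[OF A elim]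
      show ?case
        using S emeasure_bounded_finite[OF S(4)] by (intro INF_lower) (simp add: A_convex_def)
    qed
  qed simp
qed

end
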